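(* Let $(M,\mathcal B,\mu,\Phi_t)$ be a system with pure point spectrum as described in the context, assume that the generating Koopman eigenfunctions $\zeta_1,\dots,\zeta_m$ are smooth, and let $v_i$ be the smooth vector fields on $M$ defined as $v_i=\Omega_i\,\frac{\partial}{\partial\theta^i}$, $i=1,\dots,m$, where $\Omega_i$ and $\theta^i$ are the eigenfrequency and canonical angle coordinate associated with $\zeta_i$, respectively. Then: (i) Every Koopman eigenfunction $z_k=\prod_{i=1}^m\zeta_i^{k_i}$, $k=(k_1,\dots,k_m)\in\mathbb Z^m$, is also an eigenfunction of $v_i$ at eigenvalue $\omega^{(i)}_k=\mathrm i k_i\Omega_i$. As a result, $v_i$ has the nullspace $\ker v_i=\bigotimes_{j\ne i}\mathcal Z_j$, where $\{\mathcal Z_j\}_{j=1}^m$ are the orthogonal subrings of $L^2(M,\mu)$ generated by $\zeta_j$. (ii) The $v_i$ are nowhere-vanishing, linearly independent, and have vanishing commutator, $[v_i,v_j]=v_iv_j-v_jv_i=0$. (iii) The flows $\Phi_{i,t}:M\to M$, $t\in\mathbb R$, generated by $v_i$ preserve the invariant measure $\mu$ of the full dynamics. (iv) The $\Phi_{j,t}$ act on the $v_i$ by translations, in the sense that the tangent vector $u\in T_bM$ with $u=\Phi_{j,t*}(v_i|_a)$ and $b=\Phi_{j,t}(a)$ acts on $f\in C^\infty(M)$ according to $u(f)=v_i|_b(f)$ for every $a\in M$, where $\Phi_{j,t*}:TM\to TM$ is the derivative map associated with $\Phi_{j,t}$. (v) The decomposition $v=\sum_{i=1}^m v_i$ ho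lds.
   Context: Setting. $M$ is a closed, connected, compact, orientable $C^\infty$ manifold of dimension $m$ with Borel $\sigma$-algebra $\mathcal B$; $\Phi_t:M\to M$, $t\in\mathbb R$, is a smooth flow with generating smooth vector field $v$, $v(f)=\lim_{t\to0}(f\circ\Phi_t-f)/t$ (the "full dynamics"); $\mu$ is a $\Phi_t$-invariant Borel probability measure with smooth positive density in local coordinates. For a fixed sampling interval $T>0$ the discrete-time system $\hat\Phi_n=\Phi_{nT}$, $n\in\mathbb Z$, is ergodic for $\mu$. $U_tf=f\circ\Phi_t$ is the unitary Koopman group on $L^2(M,\mu)$ and $\tilde v$ its skew-adjoint generator, which extends $v$ from $C^\infty(M)$. Pure point spectrum. There are rationally independent real numbers $\Omega_1,\dots,\Omega_m$ (basic frequencies) and eigenfunctions $\zeta_i$ of $\tilde v$ (generating Koopman eigenfunctions) with $\tilde v(\zeta_i)=\mathrm i\,\Omega_i\zeta_i$ such that the functions $z_k=\prod_{i=1}^m\zeta_i^{k_i}$, $k\in\mathbb Z^m$, which are eigenfunctions of $\tilde v$ at eigenvalue $\mathrm i\sum_i k_i\Omega_i$, form an orthonormal basis of $L^2(M,\mu)$. The $\zeta_i$ are normalized so that $|\zeta_i|=1$. When the $\zeta_i$ are $C^\infty$, the map $\pi=(\zeta_1,\dots,\zeta_m):M\to\mathbb T^m\subset\mathbb C^m$ is a $C^\infty$ diffeomorphism, and $\theta=(\theta^1,\dots,\theta^m)$ denote the corresponding canonical angle coordinates on $M$, $\zeta_i=e^{\mathrm i\theta^i}$; the $\frac{\partial}{\partial\theta^i}$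 are the associated globally defined smooth basis vector fields. *)

theory Defs
  imports "HOL-Probability.Probability"
begin

section \<open>Smooth maps between open subsets of Euclidean spaces\<close>

primrec Ck_on :: "nat \<Rightarrow> 'e::real_normed_vector set \<Rightarrow> ('e \<Rightarrow> 'b::real_normed_vector) \<Rightarrow> bool"
  where
    "Ck_on 0 S f \<longleftrightarrow> continuous_on S f"
  | "Ck_on (Suc n) S f \<longleftrightarrow>
       (\<forall>x\<in>S. f differentiable (at x)) \<and> (\<forall>u. Ck_on n S (\<lambda>x. frechet_derivative f (at x) u))"

text \<open>Only used for open \<^term>\<open>S\<close>.\<close>

definition smooth_on :: "'e::real_normed_vector set \<Rightarrow> ('e \<Rightarrow> 'b::real_normed_vector) \<Rightarrow> bool"
  where "smooth_on S f \<longleftrightarrow> (\<forall>n. Ck_on n S f)"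


section \<open>Manifolds, smooth maps, vector fields and flows\<close>

text \<open>A manifold is a topological space (a type, Hausdorff and second countable by its type classes)
  with an atlas of charts with values in a Euclidean space. A chart is its domain together with the
  coordinate map, whose values outside the domain are irrelevant. No maximality of the atlas is
  required.\<close>

type_synonym ('a, 'e) chart = "'a set \<times> ('a \<Rightarrow> 'e)"

definition chart_image :: "('a, 'e) chart \<Rightarrow> 'e set"
  where "chart_image c = snd c ` fst c"

definition chart_inv :: "('a, 'e) chart \<Rightarrow> 'e \<Rightarrow> 'a"
  where "chart_inv c = inv_into (fst c) (snd c)"

definition is_chart :: "('a::topological_space, 'e::euclidean_space) chart \<Rightarrow> bool"
  where "is_chart c \<longleftrightarrow>
    open (fst c) \<and> open (chart_image c) \<and>
    homeomorphism (fst c) (chart_image c) (snd c) (chart_inv c)"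

definition smooth_atlas :: "('a::topological_space, 'e::euclidean_space) chart set \<Rightarrow> bool"
  where "smooth_atlas A \<longleftrightarrow>
    (\<forall>c\<in>A. is_chart c) \<and> (\<Union>c\<in>A. fst c) = UNIV \<and>
    (\<forall>c\<in>A. \<forall>d\<in>A. smooth_on (snd c ` (fst c \<inter> fst d)) (snd d \<circ> chart_inv c))"

definition orientable :: "('a::topological_space, real^'m) chart set \<Rightarrow> bool"
  where "orientable A \<longleftrightarrow>
    (\<exists>B. smooth_atlas B \<and> smooth_atlas (A \<union> B) \<and>
      (\<forall>c\<in>B. \<forall>d\<in>B. \<forall>x\<in>snd c ` (fst c \<inter> fst d). 0 < det (jacobian (snd d \<circ> chart_inv c) (at x))))"

text \<open>The dimension is \<^term>\<open>CARD('m)\<close>; "closed" means compact without boundary, and the charts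
  take values in open subsets of Euclidean space.\<close>

definition closed_orientable_manifold ::
    "('a::{t2_space, second_countable_topology}, real^'m) chart set \<Rightarrow> bool"
  where "closed_orientable_manifold A \<longleftrightarrow>
    smooth_atlas A \<and> orientable A \<and> compact (UNIV :: 'a set) \<and> connected (UNIV :: 'a set)"

definition smooth_fun ::
    "('a::topological_space, 'e::euclidean_space) chart set \<Rightarrow> ('a \<Rightarrow> 'b::real_normed_vector) \<Rightarrow> bool"
  where "smooth_fun A f \<longleftrightarrow> (\<forall>c\<in>A. smooth_on (chart_image c) (f \<circ> chart_inv c))"

text \<open>Smooth maps from the manifold covered by the charts \<^term>\<open>A\<close> to the one covered by \<^term>\<open>B\<close>.\<close>

definition smooth_map ::
    "('a::topological_space, 'e::euclidean_space) chart set \<Rightarrow>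
     ('b::topological_space, 'f::euclidean_space) chart set \<Rightarrow> ('a \<Rightarrow> 'b) \<Rightarrow> bool"
  where "smooth_map A B F \<longleftrightarrow>
    continuous_on (\<Union>c\<in>A. fst c) F \<and> F ` (\<Union>c\<in>A. fst c) \<subseteq> (\<Union>d\<in>B. fst d) \<and>
    (\<forall>c\<in>A. \<forall>d\<in>B. smooth_on (snd c ` (fst c \<inter> F -` fst d)) (snd d \<circ> F \<circ> chart_inv c))"

text \<open>The product manifold of the real line with the manifold given by \<^term>\<open>A\<close>.\<close>

definition line_times :: "('a, 'e) chart set \<Rightarrow> (real \<times> 'a, real \<times> 'e) chart set"
  where "line_times A = (\<lambda>c. (UNIV \<times> fst c, \<lambda>(t, a). (t, snd c a))) ` A"

text \<open>Diffeomorphisms onto an embedded subset \<^term>\<open>S\<close> of a Euclidean space: the inverse is smooth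
  on \<^term>\<open>S\<close> in the sense that it locally extends to smooth maps on open sets of the ambient space.\<close>

definition diffeomorphism_onto ::
    "('a::topological_space, 'e::euclidean_space) chart set \<Rightarrow> 'f::euclidean_space set \<Rightarrow>
     ('a \<Rightarrow> 'f) \<Rightarrow> bool"
  where "diffeomorphism_onto A S p \<longleftrightarrow>
    smooth_fun A p \<and> bij_betw p UNIV S \<and>
    (\<forall>y\<in>S. \<exists>W G. open W \<and> y \<in> W \<and> smooth_map {(W, \<lambda>x. x)} A G \<and> (\<forall>x\<in>W \<inter> S. G x = inv p x))"

text \<open>Tangent vectors are derivations on the real smooth functions. To make them unique as functionals,
  they are required to be 0 on functions that are not smooth.\<close>

definition tangent_space ::
    "('a::topological_space, 'e::euclidean_space) chart set \<Rightarrow> 'a \<Rightarrow> (('a \<Rightarrow> real) \<Rightarrow> real) set"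
  where "tangent_space A a = {D.
    (\<forall>f g r s. smooth_fun A f \<longrightarrow> smooth_fun A g \<longrightarrow>
       D (\<lambda>x. r * f x + s * g x) = r * D f + s * D g) \<and>
    (\<forall>f g. smooth_fun A f \<longrightarrow> smooth_fun A g \<longrightarrow>
       D (\<lambda>x. f x * g x) = f a * D g + g a * D f) \<and>
    (\<forall>f. \<not> smooth_fun A f \<longrightarrow> D f = 0)}"

type_synonym 'a vfield = "'a \<Rightarrow> ('a \<Rightarrow> real) \<Rightarrow> real"

definition smooth_vector_field ::
    "('a::topological_space, 'e::euclidean_space) chart set \<Rightarrow> 'a vfield \<Rightarrow> bool"
  where "smooth_vector_field A X \<longleftrightarrow>
    (\<forall>a. X a \<in> tangent_space A a) \<and> (\<forall>f. smooth_fun A f \<longrightarrow> smooth_fun A (\<lambda>a. X a f))"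

text \<open>The action of a vector field on complex-valued functions, by complex linearity.\<close>

definition vf_complex :: "'a vfield \<Rightarrow> ('a \<Rightarrow> complex) \<Rightarrow> 'a \<Rightarrow> complex"
  where "vf_complex X f a = Complex (X a (\<lambda>x. Re (f x))) (X a (\<lambda>x. Im (f x)))"

definition vf_eigenfunction ::
    "('a::topological_space, 'e::euclidean_space) chart set \<Rightarrow> 'a vfield \<Rightarrow> complex \<Rightarrow>
     ('a \<Rightarrow> complex) \<Rightarrow> bool"
  where "vf_eigenfunction A X c f \<longleftrightarrow>
    smooth_fun A f \<and> f \<noteq> (\<lambda>_. 0) \<and> (\<forall>a. vf_complex X f a = c * f a)"

definition commutator :: "'a vfield \<Rightarrow> 'a vfield \<Rightarrow> 'a vfield"
  where "commutator X Y = (\<lambda>a f. X a (\<lambda>b. Y b f) - Y a (\<lambda>b. X b f))"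

text \<open>The derivative map of \<^term>\<open>F\<close>, applied to a tangent vector \<^term>\<open>D\<close>.\<close>

definition pushforward ::
    "('a::topological_space, 'e::euclidean_space) chart set \<Rightarrow> ('a \<Rightarrow> 'a) \<Rightarrow>
     (('a \<Rightarrow> real) \<Rightarrow> real) \<Rightarrow> ('a \<Rightarrow> real) \<Rightarrow> real"
  where "pushforward A F D = (\<lambda>f. if smooth_fun A f then D (f \<circ> F) else 0)"

definition smooth_flow ::
    "('a::topological_space, 'e::euclidean_space) chart set \<Rightarrow> (real \<Rightarrow> 'a \<Rightarrow> 'a) \<Rightarrow> bool"
  where "smooth_flow A \<Phi> \<longleftrightarrow>
    \<Phi> 0 = id \<and> (\<forall>s t. \<Phi> (s + t) = \<Phi> s \<circ> \<Phi> t) \<and>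
    smooth_map (line_times A) A (\<lambda>(t, a). \<Phi> t a)"

definition generates_flow ::
    "('a::topological_space, 'e::euclidean_space) chart set \<Rightarrow> 'a vfield \<Rightarrow>
     (real \<Rightarrow> 'a \<Rightarrow> 'a) \<Rightarrow> bool"
  where "generates_flow A X \<Phi> \<longleftrightarrow>
    smooth_flow A \<Phi> \<and>
    (\<forall>a f. smooth_fun A f \<longrightarrow> ((\<lambda>t. (f (\<Phi> t a) - f a) / t) \<longlongrightarrow> X a f) (at 0))"

definition flow_of ::
    "('a::topological_space, 'e::euclidean_space) chart set \<Rightarrow> 'a vfield \<Rightarrow> real \<Rightarrow> 'a \<Rightarrow> 'a"
  where "flow_of A X = (THE \<Phi>. generates_flow A X \<Phi>)"


section \<open>Measures and the Koopman group\<close>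

definition smooth_positive_density ::
    "('a::topological_space, 'e::euclidean_space) chart set \<Rightarrow> 'a measure \<Rightarrow> bool"
  where "smooth_positive_density A \<mu> \<longleftrightarrow>
    (\<forall>c\<in>A. \<exists>\<rho>. smooth_on (chart_image c) \<rho> \<and> (\<forall>x\<in>chart_image c. 0 < \<rho> x) \<and>
      (\<forall>E\<in>sets borel. E \<subseteq> chart_image c \<longrightarrow>
         emeasure \<mu> (fst c \<inter> snd c -` E) = (\<integral>\<^sup>+x\<in>E. ennreal (\<rho> x) \<partial>lborel)))"

definition preserves_measure :: "'a measure \<Rightarrow> ('a \<Rightarrow> 'a) \<Rightarrow> bool"
  where "preserves_measure \<mu> F \<longleftrightarrow> F \<in> measurable \<mu> \<mu> \<and> distr \<mu> \<mu> F = \<mu>"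

definition ergodic_sampling :: "'a measure \<Rightarrow> (real \<Rightarrow> 'a \<Rightarrow> 'a) \<Rightarrow> real \<Rightarrow> bool"
  where "ergodic_sampling \<mu> \<Phi> T \<longleftrightarrow>
    (\<forall>B\<in>sets \<mu>. (\<forall>n::int. \<Phi> (of_int n * T) -` B = B) \<longrightarrow> measure \<mu> B = 0 \<or> measure \<mu> B = 1)"

text \<open>Elements of the space of square-integrable functions are represented by functions; all
  notions below are invariant under changes on null sets.\<close>

definition L2 :: "'a measure \<Rightarrow> ('a \<Rightarrow> complex) set"
  where "L2 \<mu> = {f \<in> borel_measurable \<mu>. integrable \<mu> (\<lambda>x. (cmod (f x))\<^sup>2)}"

definition L2_inner :: "'a measure \<Rightarrow> ('a \<Rightarrow> complex) \<Rightarrow> ('a \<Rightarrow> complex) \<Rightarrow> complex"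
  where "L2_inner \<mu> f g = (\<integral>x. cnj (f x) * g x \<partial>\<mu>)"

definition L2_norm :: "'a measure \<Rightarrow> ('a \<Rightarrow> complex) \<Rightarrow> real"
  where "L2_norm \<mu> f = sqrt (\<integral>x. (cmod (f x))\<^sup>2 \<partial>\<mu>)"

definition L2_closure :: "'a measure \<Rightarrow> ('a \<Rightarrow> complex) set \<Rightarrow> ('a \<Rightarrow> complex) set"
  where "L2_closure \<mu> S =
    {f \<in> L2 \<mu>. \<forall>e>0. \<exists>g\<in>S \<inter> L2 \<mu>. L2_norm \<mu> (\<lambda>x. f x - g x) < e}"

definition cspan :: "('a \<Rightarrow> complex) set \<Rightarrow> ('a \<Rightarrow> complex) set"
  where "cspan S = {(\<lambda>x. \<Sum>p\<in>P. c p * p x) | P c. finite P \<and> P \<subseteq> S}"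

definition L2_orthonormal_basis :: "'a measure \<Rightarrow> ('k \<Rightarrow> 'a \<Rightarrow> complex) \<Rightarrow> bool"
  where "L2_orthonormal_basis \<mu> z \<longleftrightarrow>
    (\<forall>k. z k \<in> L2 \<mu>) \<and> (\<forall>k l. L2_inner \<mu> (z k) (z l) = (if k = l then 1 else 0)) \<and>
    L2_closure \<mu> (cspan (range z)) = L2 \<mu>"

text \<open>The graph of the generator of the Koopman group of \<^term>\<open>\<Phi>\<close>: \<^term>\<open>f\<close> belongs to its domain
  and is mapped to \<^term>\<open>g\<close>.\<close>

definition koopman_generator ::
    "'a measure \<Rightarrow> (real \<Rightarrow> 'a \<Rightarrow> 'a) \<Rightarrow> ('a \<Rightarrow> complex) \<Rightarrow> ('a \<Rightarrow> complex) \<Rightarrow> bool"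
  where "koopman_generator \<mu> \<Phi> f g \<longleftrightarrow>
    f \<in> L2 \<mu> \<and> g \<in> L2 \<mu> \<and>
    ((\<lambda>t. L2_norm \<mu> (\<lambda>x. (f (\<Phi> t x) - f x) / of_real t - g x)) \<longlongrightarrow> 0) (at 0)"

text \<open>The ring generated by a function and its complex conjugate (its inverse, when the function is
  unimodular) over the complex constants, and its closure, which is the subring of the space of
  square-integrable functions generated by \<^term>\<open>g\<close>.\<close>

inductive_set generated_ring :: "('a \<Rightarrow> complex) \<Rightarrow> ('a \<Rightarrow> complex) set" for g where
  const: "(\<lambda>_. c) \<in> generated_ring g"
| gen: "g \<in> generated_ring g"
| gen_cnj: "(\<lambda>x. cnj (g x)) \<in> generated_ring g"
| add: "f \<in> generated_ring g \<Longrightarrow> h \<in> generated_ring g \<Longrightarrow> (\<lambda>x. f x + h x) \<in> generated_ring g"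
| mult: "f \<in> generated_ring g \<Longrightarrow> h \<in> generated_ring g \<Longrightarrow> (\<lambda>x. f x * h x) \<in> generated_ring g"

definition L2_subring :: "'a measure \<Rightarrow> ('a \<Rightarrow> complex) \<Rightarrow> ('a \<Rightarrow> complex) set"
  where "L2_subring \<mu> g = L2_closure \<mu> (generated_ring g)"

text \<open>The (Hilbert space) tensor product of spaces of square-integrable functions of independent
  variables, realized inside the square-integrable functions by multiplication. For empty
  \<^term>\<open>J\<close> these are the functions that are almost everywhere constant.\<close>

definition L2_tensor :: "'a measure \<Rightarrow> 'j set \<Rightarrow> ('j \<Rightarrow> ('a \<Rightarrow> complex) set) \<Rightarrow> ('a \<Rightarrow> complex) set"
  where "L2_tensor \<mu> J Z =
    L2_closure \<mu> (cspan {(\<lambda>x. \<Prod>j\<in>J. f j x) | f. \<forall>j\<in>J. f j \<in> Z j})"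


section \<open>Frequencies, eigenfunctions and angle coordinates\<close>

definition rationally_independent :: "('m::finite \<Rightarrow> real) \<Rightarrow> bool"
  where "rationally_independent \<Omega> \<longleftrightarrow>
    (\<forall>q::'m \<Rightarrow> rat. (\<Sum>i\<in>UNIV. of_rat (q i) * \<Omega> i) = 0 \<longrightarrow> (\<forall>i. q i = 0))"

definition eigenfun :: "('m::finite \<Rightarrow> 'a \<Rightarrow> complex) \<Rightarrow> ('m \<Rightarrow> int) \<Rightarrow> 'a \<Rightarrow> complex"
  where "eigenfun \<zeta> k = (\<lambda>x. \<Prod>i\<in>UNIV. \<zeta> i x powi k i)"

definition torus :: "(complex^'m) set"
  where "torus = {y. \<forall>i. cmod (y $ i) = 1}"

definition torus_map :: "('m::finite \<Rightarrow> 'a \<Rightarrow> complex) \<Rightarrow> 'a \<Rightarrow> complex^'m"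
  where "torus_map \<zeta> a = (\<chi> i. \<zeta> i a)"

definition torus_exp :: "real^'m \<Rightarrow> complex^'m"
  where "torus_exp x = (\<chi> i. cis (x $ i))"

definition angle_coord :: "('m::finite \<Rightarrow> 'a \<Rightarrow> complex) \<Rightarrow> 'a \<Rightarrow> real^'m"
  where "angle_coord \<zeta> a = (\<chi> i. Arg (\<zeta> i a))"

text \<open>The coordinate vector field of the i-th angle: the partial derivative of the coordinate
  representation of \<^term>\<open>f\<close>, which is a \<open>2\<pi>\<close>-periodic function of all angles. By
  periodicity, the jumps of the principal argument do not matter.\<close>

definition angle_field ::
    "('a::topological_space, 'e::euclidean_space) chart set \<Rightarrow> ('m::finite \<Rightarrow> 'a \<Rightarrow> complex) \<Rightarrow>
     'm \<Rightarrow> 'a vfield"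
  where "angle_field A \<zeta> i = (\<lambda>a f.
    if smooth_fun A f
    then frechet_derivative (f \<circ> inv (torus_map \<zeta>) \<circ> torus_exp) (at (angle_coord \<zeta> a)) (axis i 1)
    else 0)"

end

theory Submission
  imports Defs
begin

text \<open>The torus \<open>\<real>\<^sup>m / (2\<pi>\<int>)\<^sup>m\<close> acts on the manifold through \<^term>\<open>torus_map \<zeta>\<close>. Each constant vector
  \<open>s\<close> generates a one-parameter group of rotations \<open>\<zeta>\<^sub>j \<mapsto> cis (t s\<^sub>j) \<zeta>\<^sub>j\<close>, and its generator is the derivative
  in the direction \<open>s\<close> of the angle representation; \<open>v\<^sub>i\<close> is the case \<open>s = \<Omega>\<^sub>i e\<^sub>i\<close>. A flow is determined by how it
  moves the \<open>\<zeta>\<^sub>j\<close>, so the full dynamics is the rotation with \<open>s = \<Omega>\<close>, and all commutation properties reduce to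
  the commutativity of the torus and of partial derivatives. The measure is invariant under all rotations
  because its Fourier coefficients \<open>\<integral> z\<^sub>k d\<mu> = \<delta>\<^sub>k\<^sub>0\<close> are, and trigonometric polynomials are uniformly dense by
  Stone-Weierstrass. The kernels, the rings \<open>Z\<^sub>j\<close> and their tensor products are all described by the set
  of frequencies \<open>k\<close> with nonzero coefficient. For tensor products this needs that products of functions of
  different angles are again square-integrable, which follows from the multiplicativity of the norm on
  trigonometric polynomials.\<close>

section \<open>Calculus of smooth maps\<close>

text \<open>Three gaps shape the argument. The angles are not smooth functions on the manifold:
  \<open>angle_coord\<close> jumps, and the inverse of \<open>torus_map\<close> is smooth only
  through local extensions to open subsets of the ambient space. Derivatives are therefore computed
  along orbits of rotations, and the smoothness of these orbits comes from the local extensions.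
  Next, the eigenvalue equation in the hypotheses holds in mean square, while vector fields act
  pointwise; the passage uses continuity of both sides and the fact that a positive density gives
  positive measure to every nonempty open set. Last, a product of two square-integrable functions is
  a priori only integrable. Angles with disjoint index sets are independent random variables,
  because \<open>k\<close> and \<open>l\<close> with disjoint supports have sum 0 only if both are
  0; this is why norms multiply. Rational independence enters as
  \<open>\<Omega> i \<noteq> 0\<close>, which turns the kernel condition
  \<open>k i * \<Omega> i = 0\<close> into \<open>k i = 0\<close>.\<close>

lemma Ck_on_subset: "Ck_on n S f \<Longrightarrow> U \<subseteq> S \<Longrightarrow> Ck_on n U f"
  by (induction n arbitrary: f) (auto intro: continuous_on_subset)

lemma differentiable_has_derivative:
  "f differentiable F \<Longrightarrow> (f has_derivative frechet_derivative f F) F"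
  by (simp add: frechet_derivative_works)

lemma frechet_derivative_cong_open:
  assumes "open S" "x \<in> S" "\<And>y. y \<in> S \<Longrightarrow> f y = g y"
  shows "frechet_derivative f (at x) = frechet_derivative g (at x)"
proof -
  have "(f has_derivative D) (at x) \<longleftrightarrow> (g has_derivative D) (at x)" for D
    using assms by (metis has_derivative_transform_within_open)
  then show ?thesis
    by (simp add: frechet_derivative_def)
qed

lemma Ck_on_cong:
  assumes "open S" "\<And>x. x \<in> S \<Longrightarrow> f x = g x"
  shows "Ck_on n S f \<longleftrightarrow> Ck_on n S g"
  using assms(2)
proof (induction n arbitrary: f g)
  case 0
  then show ?case by (auto cong: continuous_on_cong)
next
  case (Suc n)
  have "f differentiable (at x) \<longleftrightarrow> g differentiable (at x)" if "x \<in> S" for x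
    using Suc.prems that \<open>open S\<close> unfolding differentiable_def
    by (metis has_derivative_transform_within_open)
  moreover have "Ck_on n S (\<lambda>x. frechet_derivative f (at x) u) = Ck_on n S (\<lambda>x. frechet_derivative g (at x) u)" for u
  proof (rule Suc.IH)
    fix x assume "x \<in> S"
    from frechet_derivative_cong_open[of S x f g, OF \<open>open S\<close> this Suc.prems]
    show "frechet_derivative f (at x) u = frechet_derivative g (at x) u"
      by simp
  qed
  ultimately show ?case by simp
qed

text \<open>The neighbourhood \<open>U\<close> need not lie in \<open>S\<close>: functions are total
  and derivatives are taken in the full space, so nothing depends on the surrounding set.\<close>

lemma Ck_on_local:
  assumes "\<And>x. x \<in> S \<Longrightarrow> \<exists>U. open U \<and> x \<in> U \<and> Ck_on n U f"
  shows "Ck_on n S f"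
  using assms
proof (induction n arbitrary: f)
  case 0
  then have "isCont f x" if "x \<in> S" for x
    using that by (metis Ck_on.simps(1) continuous_on_eq_continuous_at)
  then show ?case
    by (simp add: continuous_at_imp_continuous_on)
next
  case (Suc n)
  have "f differentiable (at x)" if "x \<in> S" for x
    using Suc.prems[OF that] by auto
  moreover have "Ck_on n S (\<lambda>x. frechet_derivative f (at x) u)" for u
  proof (rule Suc.IH)
    fix x assume "x \<in> S"
    then show "\<exists>U. open U \<and> x \<in> U \<and> Ck_on n U (\<lambda>x. frechet_derivative f (at x) u)"
      using Suc.prems by fastforce
  qed
  ultimately show ?case by simp
qed

text \<open>By uniqueness of the derivative, any explicit formula \<open>D\<close> may stand for
  \<open>frechet_derivative\<close>; the closure properties below are inductions through this
  rule.\<close>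

lemma Ck_on_SucI:
  assumes "open S" "\<And>x. x \<in> S \<Longrightarrow> (f has_derivative D x) (at x)"
    "\<And>u. Ck_on n S (\<lambda>x. D x u)"
  shows "Ck_on (Suc n) S f"
proof -
  have "Ck_on n S (\<lambda>x. frechet_derivative f (at x) u) = Ck_on n S (\<lambda>x. D x u)" for u
    using assms(2) by (intro Ck_on_cong[OF \<open>open S\<close>]) (metis frechet_derivative_at)
  then show ?thesis
    using assms by (auto simp: differentiable_def)
qed

lemma Ck_on_SucD: "Ck_on (Suc n) S f \<Longrightarrow> Ck_on n S f"
proof (induction n arbitrary: f)
  case 0
  then show ?case
    by (auto intro!: continuous_at_imp_continuous_on differentiable_imp_continuous_within)
next
  case (Suc n)
  then show ?case by simp
qed

lemma Ck_on_const: "Ck_on n S (\<lambda>_. c)"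
  by (induction n arbitrary: c) auto

lemma Ck_on_bounded_linear:
  assumes "bounded_linear L"
  shows "Ck_on n S L"
proof -
  have "(L has_derivative L) (at x)" for x
    using assms by (rule bounded_linear_imp_has_derivative)
  then have "L differentiable (at x)" "frechet_derivative L (at x) = L" for x
    by (auto simp: differentiable_def frechet_derivative_at[symmetric])
  then show ?thesis
    using assms by (cases n) (auto simp: Ck_on_const linear_continuous_on)
qed

lemma Ck_on_linear_compose:
  assumes L: "bounded_linear L" and "open S" and f: "Ck_on n S f"
  shows "Ck_on n S (\<lambda>x. L (f x))"
  using f
proof (induction n arbitrary: f)
  case 0
  then show ?case
    using bounded_linear.continuous_on[OF L, of S f] by simp
next
  case (Suc n)
  show ?case
  proof (rule Ck_on_SucI[OF \<open>open S\<close>])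
    show "((\<lambda>x. L (f x)) has_derivative (\<lambda>u. L (frechet_derivative f (at x) u))) (at x)"
      if "x \<in> S" for x
      using Suc.prems that
      by (intro bounded_linear.has_derivative[OF L]) (auto intro: differentiable_has_derivative)
  next
    show "Ck_on n S (\<lambda>x. L (frechet_derivative f (at x) u))" for u
      using Suc by simp
  qed
qed

lemma Ck_on_add:
  assumes "open S" "Ck_on n S f" "Ck_on n S g"
  shows "Ck_on n S (\<lambda>x. f x + g x)"
  using assms(2-)
proof (induction n arbitrary: f g)
  case 0
  then show ?case by (auto intro: continuous_intros)
next
  case (Suc n)
  show ?case
  proof (rule Ck_on_SucI[OF \<open>open S\<close>])
    show "((\<lambda>x. f x + g x) has_derivative
        (\<lambda>u. frechet_derivative f (at x) u + frechet_derivative g (at x) u)) (at x)"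
      if "x \<in> S" for x
      using Suc.prems that
      by (intro has_derivative_add) (auto intro: differentiable_has_derivative)
  qed (use Suc in auto)
qed

lemma Ck_on_sum:
  assumes "open S" "\<And>i. i \<in> I \<Longrightarrow> Ck_on n S (f i)"
  shows "Ck_on n S (\<lambda>x. \<Sum>i\<in>I. f i x)"
  using assms(2)
  by (induction I rule: infinite_finite_induct) (auto simp: Ck_on_const Ck_on_add[OF \<open>open S\<close>])

lemma Ck_on_bilinear:
  assumes B: "bounded_bilinear B" and "open S" "Ck_on n S f" "Ck_on n S g"
  shows "Ck_on n S (\<lambda>x. B (f x) (g x))"
  using assms(3-)
proof (induction n arbitrary: f g)
  case 0
  then show ?case
    using bounded_bilinear.continuous_on[OF B] by auto
next
  case (Suc n)
  show ?case
  proof (rule Ck_on_SucI[OF \<open>open S\<close>])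
    show "((\<lambda>x. B (f x) (g x)) has_derivative
        (\<lambda>u. B (f x) (frechet_derivative g (at x) u) + B (frechet_derivative f (at x) u) (g x))) (at x)"
      if "x \<in> S" for x
      using Suc.prems that
      by (intro bounded_bilinear.FDERIV[OF B]) (auto intro: differentiable_has_derivative)
    have "Ck_on n S f" "Ck_on n S g"
      using Suc.prems Ck_on_SucD by auto
    then show "Ck_on n S
      (\<lambda>x. B (f x) (frechet_derivative g (at x) u) + B (frechet_derivative f (at x) u) (g x))" for u
      using Suc by (intro Ck_on_add[OF \<open>open S\<close>]) auto
  qed
qed

text \<open>The chain rule produces a derivative of \<open>f\<close> in a direction that varies with
  \<open>x\<close>, whereas \<open>Ck_on\<close> speaks of fixed directions. Expanding the inner
  derivative in \<open>Basis\<close> turns it into a finite sum of products to which the induction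
  hypothesis applies; hence the Euclidean type in the middle.\<close>

lemma Ck_on_compose:
  fixes f :: "'b::euclidean_space \<Rightarrow> 'c::real_normed_vector"
  assumes "open S" "open U" "Ck_on n U f" "Ck_on n S g" "g ` S \<subseteq> U"
  shows "Ck_on n S (\<lambda>x. f (g x))"
  using assms(3-)
proof (induction n arbitrary: f)
  case 0
  then show ?case
    by (auto intro: continuous_on_compose2)
next
  case (Suc n)
  let ?Df = "\<lambda>x. frechet_derivative f (at x)" and ?Dg = "\<lambda>x. frechet_derivative g (at x)"
  show ?case
  proof (rule Ck_on_SucI[OF \<open>open S\<close>])
    fix x assume "x \<in> S"
    then have f: "(f has_derivative ?Df (g x)) (at (g x))" and g: "(g has_derivative ?Dg x) (at x)"
      using Suc.prems by (auto intro: differentiable_has_derivative)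
    have lin: "linear (?Df (g x))"
      using f by (rule has_derivative_linear)
    have "?Df (g x) (?Dg x u) = (\<Sum>b\<in>Basis. (?Dg x u \<bullet> b) *\<^sub>R ?Df (g x) b)" for u
      by (subst (1) euclidean_representation[symmetric, of "?Dg x u"])
        (simp only: linear_sum[OF lin] linear_cmul[OF lin])
    then show "((\<lambda>x. f (g x)) has_derivative (\<lambda>u. \<Sum>b\<in>Basis. (?Dg x u \<bullet> b) *\<^sub>R ?Df (g x) b)) (at x)"
      using has_derivative_compose[OF g f] by simp
  next
    fix u
    have "Ck_on n S (\<lambda>x. ?Df (g x) b)" for b
      using Suc.prems by (intro Suc.IH) (auto intro: Ck_on_SucD)
    moreover have "Ck_on n S (\<lambda>x. ?Dg x u \<bullet> b)" for b
      using Suc.prems by (intro Ck_on_linear_compose[OF bounded_linear_inner_left \<open>open S\<close>]) simp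
    ultimately show "Ck_on n S (\<lambda>x. \<Sum>b\<in>Basis. (?Dg x u \<bullet> b) *\<^sub>R ?Df (g x) b)"
      by (intro Ck_on_sum[OF \<open>open S\<close>] Ck_on_bilinear[OF bounded_bilinear_scaleR \<open>open S\<close>])
  qed
qed

text \<open>The factor \<open>c\<close> is there for the induction: each derivative is again a
  constant times \<open>cis\<close>.\<close>

lemma Ck_on_cis: "Ck_on n UNIV (\<lambda>t. c * cis t)"
proof (induction n arbitrary: c)
  case 0
  then show ?case by (auto intro!: continuous_intros)
next
  case (Suc n)
  show ?case
  proof (rule Ck_on_SucI[OF open_UNIV])
    show "((\<lambda>t. c * cis t) has_derivative (\<lambda>u. (c * (u *\<^sub>R \<i>)) * cis t)) (at t)" for t
      by (rule has_derivative_eq_rhs, (rule derivative_intros has_derivative_cis)+)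
         (auto simp: fun_eq_iff scaleR_conv_of_real)
  qed (rule Suc)
qed

lemma smooth_on_subset: "smooth_on S f \<Longrightarrow> U \<subseteq> S \<Longrightarrow> smooth_on U f"
  by (auto simp: smooth_on_def intro: Ck_on_subset)

lemma smooth_on_eqI:
  "open S \<Longrightarrow> smooth_on S f \<Longrightarrow> (\<And>x. x \<in> S \<Longrightarrow> g x = f x) \<Longrightarrow> smooth_on S g"
  using Ck_on_cong[of S f g] unfolding smooth_on_def by auto

lemma smooth_on_local:
  assumes "\<And>x. x \<in> S \<Longrightarrow> \<exists>U. open U \<and> x \<in> U \<and> smooth_on U f"
  shows "smooth_on S f"
  using assms unfolding smooth_on_def by (meson Ck_on_local)

lemma smooth_on_const: "smooth_on S (\<lambda>_. c)"
  by (simp add: smooth_on_def Ck_on_const)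

lemma smooth_on_bounded_linear: "bounded_linear L \<Longrightarrow> smooth_on S L"
  by (simp add: smooth_on_def Ck_on_bounded_linear)

lemma smooth_on_linear_compose:
  "bounded_linear L \<Longrightarrow> open S \<Longrightarrow> smooth_on S f \<Longrightarrow> smooth_on S (\<lambda>x. L (f x))"
  by (simp add: smooth_on_def Ck_on_linear_compose)

lemma smooth_on_add:
  "open S \<Longrightarrow> smooth_on S f \<Longrightarrow> smooth_on S g \<Longrightarrow> smooth_on S (\<lambda>x. f x + g x)"
  by (simp add: smooth_on_def Ck_on_add)

lemma smooth_on_sum:
  "open S \<Longrightarrow> (\<And>i. i \<in> I \<Longrightarrow> smooth_on S (f i)) \<Longrightarrow> smooth_on S (\<lambda>x. \<Sum>i\<in>I. f i x)"
  by (simp add: smooth_on_def Ck_on_sum)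

lemma smooth_on_bilinear:
  "bounded_bilinear B \<Longrightarrow> open S \<Longrightarrow> smooth_on S f \<Longrightarrow> smooth_on S g \<Longrightarrow> smooth_on S (\<lambda>x. B (f x) (g x))"
  by (simp add: smooth_on_def Ck_on_bilinear)

lemmas smooth_on_mult = smooth_on_bilinear[OF bounded_bilinear_mult]

lemma smooth_on_compose:
  fixes f :: "'b::euclidean_space \<Rightarrow> 'c::real_normed_vector"
  shows "open S \<Longrightarrow> open U \<Longrightarrow> smooth_on U f \<Longrightarrow> smooth_on S g \<Longrightarrow> g ` S \<subseteq> U \<Longrightarrow> smooth_on S (\<lambda>x. f (g x))"
  by (simp add: smooth_on_def Ck_on_compose)

lemma smooth_on_cis: "open S \<Longrightarrow> smooth_on S f \<Longrightarrow> smooth_on S (\<lambda>x. cis (f x))"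
  using smooth_on_compose[of S UNIV cis f] Ck_on_cis[of _ 1] by (auto simp: smooth_on_def)

lemma smooth_on_vec_lambda:
  fixes f :: "'i::finite \<Rightarrow> 'e::real_normed_vector \<Rightarrow> 'b::euclidean_space"
  assumes "open S" "\<And>i. smooth_on S (f i)"
  shows "smooth_on S (\<lambda>x. \<chi> i. f i x)"
proof -
  have "linear (axis i :: 'b \<Rightarrow> 'b ^ 'i)" for i
    by (rule linearI) (simp_all add: vec_eq_iff axis_def)
  then have "bounded_linear (axis i :: 'b \<Rightarrow> 'b ^ 'i)" for i
    by (simp add: linear_conv_bounded_linear)
  then have "smooth_on S (\<lambda>x. axis i (f i x))" for i
    using smooth_on_linear_compose[of "axis i" S "f i"] assms by blast
  then have "smooth_on S (\<lambda>x. \<Sum>i\<in>UNIV. axis i (f i x))"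
    by (rule smooth_on_sum[OF \<open>open S\<close>])
  also have "(\<lambda>x. \<Sum>i\<in>UNIV. axis i (f i x)) = (\<lambda>x. \<chi> i. f i x)"
    by (auto simp: vec_eq_iff axis_def fun_eq_iff if_distrib cong: if_cong)
  finally show ?thesis .
qed

lemma smooth_on_directional_derivative:
  "smooth_on S f \<Longrightarrow> smooth_on S (\<lambda>x. frechet_derivative f (at x) u)"
  unfolding smooth_on_def by (metis Ck_on.simps(2))

lemma smooth_on_imp_has_derivative:
  "smooth_on S f \<Longrightarrow> x \<in> S \<Longrightarrow> (f has_derivative frechet_derivative f (at x)) (at x)"
  unfolding smooth_on_def by (metis Ck_on.simps(2) differentiable_has_derivative)

lemma smooth_on_imp_continuous_on: "smooth_on S f \<Longrightarrow> continuous_on S f"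
  unfolding smooth_on_def by (metis Ck_on.simps(1))

section \<open>Symmetry of second derivatives\<close>

lemma has_vector_derivative_line:
  assumes "(f has_derivative D) (at (x + t *\<^sub>R u))"
  shows "((\<lambda>s. f (x + s *\<^sub>R u)) has_vector_derivative D u) (at t)"
proof -
  have "((\<lambda>s. x + s *\<^sub>R u) has_derivative (\<lambda>s. s *\<^sub>R u)) (at t)"
    by (auto intro!: derivative_eq_intros)
  from has_derivative_compose[OF this assms] show ?thesis
    unfolding has_vector_derivative_def using has_derivative_linear[OF assms]
    by (simp add: linear_cmul)
qed

text \<open>The mean value theorem is used twice: along \<open>u\<close> for the difference of
  \<open>f\<close> on two parallel segments, then along \<open>w\<close> for the derivative of
  \<open>f\<close> in direction \<open>u\<close>.\<close>

lemma second_difference_mean_value: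
  fixes f :: "'e::real_normed_vector \<Rightarrow> real"
  assumes f: "smooth_on UNIV f" and h: "0 < h"
  shows "\<exists>s\<in>{0..h}. \<exists>t\<in>{0..h}.
    f (x + h *\<^sub>R u + h *\<^sub>R w) - f (x + h *\<^sub>R u) - f (x + h *\<^sub>R w) + f x =
    h * h * frechet_derivative (\<lambda>y. frechet_derivative f (at y) u) (at (x + s *\<^sub>R u + t *\<^sub>R w)) w"
proof -
  let ?D = "\<lambda>y. frechet_derivative f (at y) u"
  have 1: "((\<lambda>s. f (y + s *\<^sub>R u)) has_real_derivative ?D (y + s *\<^sub>R u)) (at s)" for y s
    using has_vector_derivative_line[OF smooth_on_imp_has_derivative[OF f UNIV_I]]
    by (simp add: has_real_derivative_iff_has_vector_derivative)
  have 2: "((\<lambda>t. ?D (y + t *\<^sub>R w)) has_real_derivative frechet_derivative ?D (at (y + t *\<^sub>R w)) w) (at t)" for y t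
    using has_vector_derivative_line[OF smooth_on_imp_has_derivative[OF smooth_on_directional_derivative[OF f] UNIV_I]]
    by (simp add: has_real_derivative_iff_has_vector_derivative)
  let ?\<phi> = "\<lambda>s. f ((x + h *\<^sub>R w) + s *\<^sub>R u) - f (x + s *\<^sub>R u)"
  have "(?\<phi> has_real_derivative ?D ((x + h *\<^sub>R w) + s *\<^sub>R u) - ?D (x + s *\<^sub>R u)) (at s)" for s
    by (intro DERIV_diff 1)
  from MVT2[OF h this] obtain s where s: "0 < s" "s < h"
    "?\<phi> h - ?\<phi> 0 = h * (?D ((x + h *\<^sub>R w) + s *\<^sub>R u) - ?D (x + s *\<^sub>R u))"
    by auto
  from MVT2[OF h 2[of "x + s *\<^sub>R u"]] obtain t where t: "0 < t" "t < h"
    "?D (x + s *\<^sub>R u + h *\<^sub>R w) - ?D (x + s *\<^sub>R u) = h * frechet_derivative ?D (at (x + s *\<^sub>R u + t *\<^sub>R w)) w"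
    by auto
  show ?thesis
    using s t by (intro bexI[of _ s] bexI[of _ t]) (auto simp: algebra_simps)
qed

text \<open>Schwarz's theorem. The second difference is symmetric in \<open>u\<close> and
  \<open>w\<close>, so the two mixed derivatives agree at intermediate points that tend to
  \<open>x\<close>; continuity of the second derivatives does the rest.\<close>

lemma frechet_derivative_commute:
  fixes f :: "'e::real_normed_vector \<Rightarrow> real"
  assumes f: "smooth_on UNIV f"
  shows "frechet_derivative (\<lambda>y. frechet_derivative f (at y) u) (at x) w =
         frechet_derivative (\<lambda>y. frechet_derivative f (at y) w) (at x) u"
proof -
  let ?D = "\<lambda>u w y. frechet_derivative (\<lambda>y. frechet_derivative f (at y) u) (at y) w"
  define h where "h n = inverse (real (Suc n))" for n
  have h: "h n > 0" "h \<longlonglongrightarrow> 0" for n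
    unfolding h_def by (simp, rule LIMSEQ_inverse_real_of_nat)
  \<comment> \<open>Stated as a predicate in \<open>u\<close> and \<open>w\<close>, so that one
    choice of intermediate points serves both orders of differentiation.\<close>
  define P where "P u w n a b \<longleftrightarrow> a \<in> {0..h n} \<and> b \<in> {0..h n} \<and>
    f (x + h n *\<^sub>R u + h n *\<^sub>R w) - f (x + h n *\<^sub>R u) - f (x + h n *\<^sub>R w) + f x =
    h n * h n * ?D u w (x + a *\<^sub>R u + b *\<^sub>R w)" for u w n a b
  have "\<exists>a b. P u w n a b" for u w n
    using second_difference_mean_value[OF f h(1)[of n], of x u w] unfolding P_def by blast
  then obtain a b where P: "P u w n (a u w n) (b u w n)" for u w n
    by metis
  have p: "a u w n \<in> {0..h n}" "b u w n \<in> {0..h n}"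
    "f (x + h n *\<^sub>R u + h n *\<^sub>R w) - f (x + h n *\<^sub>R u) - f (x + h n *\<^sub>R w) + f x =
    h n * h n * ?D u w (x + a u w n *\<^sub>R u + b u w n *\<^sub>R w)" for u w n
    using P[of u w n] unfolding P_def by blast+
  have lim: "(\<lambda>n. ?D u w (x + a u w n *\<^sub>R u + b u w n *\<^sub>R w)) \<longlonglongrightarrow> ?D u w x" for u w
  proof -
    have "(\<lambda>n. a u w n) \<longlonglongrightarrow> 0" "(\<lambda>n. b u w n) \<longlonglongrightarrow> 0"
      using p(1,2)[of u w] by (auto intro: tendsto_sandwich[OF _ _ tendsto_const h(2)])
    then have "(\<lambda>n. x + a u w n *\<^sub>R u + b u w n *\<^sub>R w) \<longlonglongrightarrow> x + 0 *\<^sub>R u + 0 *\<^sub>R w"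
      by (intro tendsto_intros)
    moreover have "isCont (?D u w) x"
      using smooth_on_imp_continuous_on[OF smooth_on_directional_derivative[OF smooth_on_directional_derivative[OF f]]]
      by (auto simp: continuous_on_eq_continuous_at)
    ultimately show ?thesis
      using isCont_tendsto_compose by fastforce
  qed
  have "?D u w (x + a u w n *\<^sub>R u + b u w n *\<^sub>R w) =
        ?D w u (x + a w u n *\<^sub>R w + b w u n *\<^sub>R u)" for n
  proof -
    have "h n * h n * ?D u w (x + a u w n *\<^sub>R u + b u w n *\<^sub>R w) =
        h n * h n * ?D w u (x + a w u n *\<^sub>R w + b w u n *\<^sub>R u)"
      unfolding p(3)[symmetric] by (simp add: algebra_simps)
    then show ?thesis using h(1)[of n] by simp
  qed
  then show ?thesis
    using LIMSEQ_unique[OF lim[of u w]] lim[of w u] by simp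
qed

section \<open>Smooth maps on a manifold\<close>

lemma chart_properties:
  assumes "smooth_atlas A" "c \<in> A"
  shows "open (fst c)" "open (chart_image c)" "continuous_on (fst c) (snd c)"
    "continuous_on (chart_image c) (chart_inv c)"
    "\<And>a. a \<in> fst c \<Longrightarrow> chart_inv c (snd c a) = a"
    "\<And>y. y \<in> chart_image c \<Longrightarrow> snd c (chart_inv c y) = y"
    "\<And>y. y \<in> chart_image c \<Longrightarrow> chart_inv c y \<in> fst c"
    "\<And>a. a \<in> fst c \<Longrightarrow> snd c a \<in> chart_image c"
  using assms unfolding smooth_atlas_def is_chart_def homeomorphism_def chart_image_def by auto

lemma obtain_chart:
  assumes "smooth_atlas A"
  obtains c where "c \<in> A" "a \<in> fst c"
  using assms unfolding smooth_atlas_def by blast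

lemma smooth_fun_on_chart:
  "smooth_fun A f \<Longrightarrow> c \<in> A \<Longrightarrow> smooth_on (chart_image c) (\<lambda>y. f (chart_inv c y))"
  unfolding smooth_fun_def by (simp add: comp_def)

lemma smooth_fun_continuous:
  fixes A :: "('a::t2_space, 'e::euclidean_space) chart set"
  assumes "smooth_atlas A" "smooth_fun A f"
  shows "continuous_on UNIV f"
proof -
  have "continuous (at a) f" for a
  proof -
    obtain c where c: "c \<in> A" "a \<in> fst c"
      using obtain_chart[OF assms(1)] .
    note ch = chart_properties[OF assms(1) c(1)]
    have "continuous_on (fst c) (\<lambda>a. (\<lambda>y. f (chart_inv c y)) (snd c a))"
      by (rule continuous_on_compose2[OF smooth_on_imp_continuous_on[OF smooth_fun_on_chart[OF assms(2) c(1)]]])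
        (use ch in auto)
    then have "continuous_on (fst c) f"
      using ch(5) by (simp cong: continuous_on_cong)
    then show ?thesis
      using ch(1) c(2) continuous_on_eq_continuous_at by blast
  qed
  then show ?thesis
    by (simp add: continuous_at_imp_continuous_on)
qed

lemma smooth_fun_const: "smooth_fun A (\<lambda>_. c)"
  by (simp add: smooth_fun_def comp_def smooth_on_const)

lemma smooth_fun_add:
  "smooth_atlas A \<Longrightarrow> smooth_fun A f \<Longrightarrow> smooth_fun A g \<Longrightarrow> smooth_fun A (\<lambda>a. f a + g a)"
  unfolding smooth_fun_def comp_def using smooth_on_add chart_properties(2) by blast

lemma smooth_fun_mult:
  fixes f :: "'a::topological_space \<Rightarrow> 'b::real_normed_algebra"
  shows "smooth_atlas A \<Longrightarrow> smooth_fun A f \<Longrightarrow> smooth_fun A g \<Longrightarrow> smooth_fun A (\<lambda>a. f a * g a)"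
  unfolding smooth_fun_def comp_def using smooth_on_mult chart_properties(2) by blast

lemma smooth_fun_linear:
  "smooth_atlas A \<Longrightarrow> bounded_linear L \<Longrightarrow> smooth_fun A f \<Longrightarrow> smooth_fun A (\<lambda>a. L (f a))"
  unfolding smooth_fun_def comp_def using smooth_on_linear_compose chart_properties(2) by blast

lemmas smooth_fun_Re = smooth_fun_linear[OF _ bounded_linear_Re]
lemmas smooth_fun_Im = smooth_fun_linear[OF _ bounded_linear_Im]

lemma smooth_fun_prod:
  fixes f :: "'i \<Rightarrow> 'a::topological_space \<Rightarrow> 'b::{real_normed_algebra,comm_monoid_mult}"
  assumes "smooth_atlas A" "\<And>i. i \<in> I \<Longrightarrow> smooth_fun A (f i)"
  shows "smooth_fun A (\<lambda>a. \<Prod>i\<in>I. f i a)"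
  using assms(2)
  by (induction I rule: infinite_finite_induct) (auto simp: smooth_fun_const smooth_fun_mult[OF assms(1)])

text \<open>Smoothness into the manifold from an open set of a normed space. Only the target carries
  charts, which avoids the artificial inverse \<open>chart_inv\<close> on the source; sources are
  chart images, their products with the line, and the space of angles.\<close>

definition smooth_into ::
    "('a::topological_space, 'e::euclidean_space) chart set \<Rightarrow> 'f::real_normed_vector set \<Rightarrow> ('f \<Rightarrow> 'a) \<Rightarrow> bool"
  where "smooth_into A S H \<longleftrightarrow>
    continuous_on S H \<and> (\<forall>d\<in>A. smooth_on (S \<inter> H -` fst d) (\<lambda>x. snd d (H x)))"

lemma smooth_into_open:
  "smooth_atlas A \<Longrightarrow> open S \<Longrightarrow> smooth_into A S H \<Longrightarrow> d \<in> A \<Longrightarrow> open (S \<inter> H -` fst d)"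
  unfolding smooth_into_def using chart_properties(1) continuous_open_preimage by blast

text \<open>Near each point, \<open>f\<close> after \<open>H\<close> factors through a chart around
  the value of \<open>H\<close>, and both factors are smooth maps between open sets.\<close>

lemma smooth_into_compose:
  fixes A :: "('a::topological_space, 'e::euclidean_space) chart set"
  assumes A: "smooth_atlas A" and "open S" and H: "smooth_into A S H" and f: "smooth_fun A f"
  shows "smooth_on S (\<lambda>x. f (H x))"
proof (rule smooth_on_local)
  fix x assume "x \<in> S"
  obtain d where d: "d \<in> A" "H x \<in> fst d"
    using obtain_chart[OF A] .
  let ?U = "S \<inter> H -` fst d"
  note ch = chart_properties[OF A d(1)]
  have U: "open ?U"
    using smooth_into_open[OF A \<open>open S\<close> H d(1)] .
  have "smooth_on ?U (\<lambda>x. snd d (H x))"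
    using H d(1) unfolding smooth_into_def by blast
  from smooth_on_compose[OF U ch(2) smooth_fun_on_chart[OF f d(1)] this]
  have "smooth_on ?U (\<lambda>x. f (chart_inv d (snd d (H x))))"
    using ch(8) by auto
  then have "smooth_on ?U (\<lambda>x. f (H x))"
    by (rule smooth_on_eqI[OF U]) (use ch(5) in auto)
  then show "\<exists>U. open U \<and> x \<in> U \<and> smooth_on U (\<lambda>x. f (H x))"
    using U \<open>x \<in> S\<close> d(2) by blast
qed

lemma smooth_into_cong:
  assumes "smooth_atlas A" "open S" "smooth_into A S H" "\<And>x. x \<in> S \<Longrightarrow> H x = H' x"
  shows "smooth_into A S H'"
  unfolding smooth_into_def
proof (intro conjI ballI)
  show "continuous_on S H'"
    using assms(3,4) unfolding smooth_into_def by (metis continuous_on_cong)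
  fix d assume d: "d \<in> A"
  have "S \<inter> H' -` fst d = S \<inter> H -` fst d"
    using assms(4) by auto
  moreover have "smooth_on (S \<inter> H -` fst d) (\<lambda>x. snd d (H x))"
    using assms(3) d unfolding smooth_into_def by blast
  then have "smooth_on (S \<inter> H -` fst d) (\<lambda>x. snd d (H' x))"
    by (rule smooth_on_eqI[OF smooth_into_open[OF assms(1-3) d]]) (use assms(4) in auto)
  ultimately show "smooth_on (S \<inter> H' -` fst d) (\<lambda>x. snd d (H' x))"
    by simp
qed

lemma smooth_into_local:
  assumes A: "smooth_atlas A" and H: "\<And>x. x \<in> S \<Longrightarrow> \<exists>U. open U \<and> x \<in> U \<and> smooth_into A U H"
  shows "smooth_into A S H"
  unfolding smooth_into_def
proof (intro conjI ballI)
  have "isCont H x" if "x \<in> S" for x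
    using H[OF that] unfolding smooth_into_def by (metis continuous_on_eq_continuous_at)
  then show "continuous_on S H"
    by (simp add: continuous_at_imp_continuous_on)
  fix d assume d: "d \<in> A"
  show "smooth_on (S \<inter> H -` fst d) (\<lambda>x. snd d (H x))"
  proof (rule smooth_on_local)
    fix x assume x: "x \<in> S \<inter> H -` fst d"
    then obtain U where U: "open U" "x \<in> U" "smooth_into A U H"
      using H by blast
    then have "open (U \<inter> H -` fst d)" "x \<in> U \<inter> H -` fst d"
      "smooth_on (U \<inter> H -` fst d) (\<lambda>x. snd d (H x))"
      using smooth_into_open[OF A _ _ d] x d unfolding smooth_into_def by auto
    then show "\<exists>U. open U \<and> x \<in> U \<and> smooth_on U (\<lambda>x. snd d (H x))"
      by blast
  qed
qed

lemma smooth_into_comp: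
  fixes G :: "'f::euclidean_space \<Rightarrow> 'a::topological_space"
  assumes A: "smooth_atlas A" and W: "open W" and G: "smooth_into A W G"
    and S: "open S" and h: "smooth_on S h" "h ` S \<subseteq> W"
  shows "smooth_into A S (\<lambda>x. G (h x))"
  unfolding smooth_into_def
proof (intro conjI ballI)
  have "continuous_on W G"
    using G by (simp add: smooth_into_def)
  from continuous_on_compose2[OF this smooth_on_imp_continuous_on[OF h(1)] h(2)]
  show cont: "continuous_on S (\<lambda>x. G (h x))" .
  fix d assume d: "d \<in> A"
  let ?U = "S \<inter> (\<lambda>x. G (h x)) -` fst d"
  have U: "open ?U"
    using continuous_open_preimage[OF cont S chart_properties(1)[OF A d]] .
  have "smooth_on (W \<inter> G -` fst d) (\<lambda>y. snd d (G y))"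
    using G d unfolding smooth_into_def by blast
  moreover have "smooth_on ?U h"
    using h(1) by (rule smooth_on_subset) auto
  ultimately show "smooth_on ?U (\<lambda>x. snd d (G (h x)))"
    by (rule smooth_on_compose[OF U smooth_into_open[OF A W G d]]) (use h(2) in auto)
qed

text \<open>The local extensions in \<open>diffeomorphism_onto\<close> are smooth maps on a manifold
  with a single identity chart; this removes that chart.\<close>

lemma smooth_map_identity_chart:
  assumes A: "smooth_atlas A" and W: "open W" and G: "smooth_map {(W, \<lambda>x. x)} A G"
  shows "smooth_into A W G"
  unfolding smooth_into_def
proof (intro conjI ballI)
  show cont: "continuous_on W G"
    using G by (simp add: smooth_map_def)
  fix d assume d: "d \<in> A"
  have op: "open (W \<inter> G -` fst d)"
    using continuous_open_preimage[OF cont W chart_properties(1)[OF A d]] .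
  have "smooth_on (W \<inter> G -` fst d) (snd d \<circ> G \<circ> chart_inv (W, \<lambda>x. x))"
    using G d by (simp add: smooth_map_def)
  then show "smooth_on (W \<inter> G -` fst d) (\<lambda>x. snd d (G x))"
    by (rule smooth_on_eqI[OF op]) (auto simp: chart_inv_def inv_into_f_f[where f = "\<lambda>x. x"])
qed

text \<open>\<open>chart_inv\<close> is a choice of preimage, which injectivity makes computable for
  product charts.\<close>

lemma chart_line_times:
  assumes "c \<in> A"
  defines "c' \<equiv> (UNIV \<times> fst c, \<lambda>(t, a). (t, snd c a))"
  assumes inj: "inj_on (snd c) (fst c)" and "x \<in> chart_image c"
  shows "chart_inv c' (t, x) = (t, chart_inv c x)"
proof -
  have "inj_on (snd c') (fst c')"
    using inj unfolding c'_def inj_on_def by auto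
  moreover have "(t, chart_inv c x) \<in> fst c'" "snd c' (t, chart_inv c x) = (t, x)"
    using assms(4) unfolding c'_def chart_inv_def chart_image_def
    by (auto simp: inv_into_into f_inv_into_f)
  ultimately show ?thesis
    unfolding chart_inv_def[of c'] by (metis inv_into_f_f)
qed

lemma smooth_map_line_times:
  fixes F :: "real \<Rightarrow> 'a::topological_space \<Rightarrow> 'a"
  assumes A: "smooth_atlas A" and cont: "continuous_on UNIV (\<lambda>(t, a). F t a)"
    and F: "\<And>c. c \<in> A \<Longrightarrow> smooth_into A (UNIV \<times> chart_image c) (\<lambda>(t, x). F t (chart_inv c x))"
  shows "smooth_map (line_times A) A (\<lambda>(t, a). F t a)"
  unfolding smooth_map_def
proof (intro conjI ballI)
  show "continuous_on (\<Union>c\<in>line_times A. fst c) (\<lambda>(t, a). F t a)"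
    using cont by (rule continuous_on_subset) simp
  show "(\<lambda>(t, a). F t a) ` (\<Union>c\<in>line_times A. fst c) \<subseteq> (\<Union>d\<in>A. fst d)"
    using A by (simp add: smooth_atlas_def)
  fix c' d assume "c' \<in> line_times A" and d: "d \<in> A"
  then obtain c where c: "c \<in> A" and c': "c' = (UNIV \<times> fst c, \<lambda>(t, a). (t, snd c a))"
    unfolding line_times_def by auto
  note ch = chart_properties[OF A c]
  let ?S = "UNIV \<times> chart_image c" and ?H = "\<lambda>(t, x). F t (chart_inv c x)"
  have S: "open ?S"
    using ch(2) by (simp add: open_Times)
  have inj: "inj_on (snd c) (fst c)"
    by (metis ch(5) inj_onI)
  have eq: "(t, x) \<in> snd c' ` (fst c' \<inter> (\<lambda>(t, a). F t a) -` fst d) \<longleftrightarrow> (t, x) \<in> ?S \<inter> ?H -` fst d" for t x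
  proof
    assume "(t, x) \<in> snd c' ` (fst c' \<inter> (\<lambda>(t, a). F t a) -` fst d)"
    then obtain a where "a \<in> fst c" "x = snd c a" "F t a \<in> fst d"
      unfolding c' by auto
    then show "(t, x) \<in> ?S \<inter> ?H -` fst d"
      using ch(5,8) by simp
  next
    assume "(t, x) \<in> ?S \<inter> ?H -` fst d"
    then show "(t, x) \<in> snd c' ` (fst c' \<inter> (\<lambda>(t, a). F t a) -` fst d)"
      using ch(6,7) unfolding c' by (intro image_eqI[of _ _ "(t, chart_inv c x)"]) auto
  qed
  have *: "snd c' ` (fst c' \<inter> (\<lambda>(t, a). F t a) -` fst d) = ?S \<inter> ?H -` fst d"
    unfolding set_eq_iff split_paired_All by (intro allI eq)
  have "smooth_on (?S \<inter> ?H -` fst d) (\<lambda>x. snd d (?H x))"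
    using F[OF c] d unfolding smooth_into_def by blast
  then show "smooth_on (snd c' ` (fst c' \<inter> (\<lambda>(t, a). F t a) -` fst d)) (snd d \<circ> (\<lambda>(t, a). F t a) \<circ> chart_inv c')"
    unfolding *
    by (rule smooth_on_eqI[OF smooth_into_open[OF A S F[OF c] d]])
      (auto simp: c' chart_line_times[OF c inj])
qed

section \<open>The torus action\<close>

lemma inverse_eq_cnj: "cmod w = 1 \<Longrightarrow> inverse w = cnj w"
  by (simp add: inverse_complex_def complex_eq_iff cmod_def)

lemma norm_eigenfun:
  assumes "\<And>i. cmod (\<zeta> i a) = 1"
  shows "cmod (eigenfun \<zeta> k a) = 1"
  by (simp add: eigenfun_def assms norm_power_int flip: prod_norm)

text \<open>A rotation multiplies the Fourier coefficients by factors \<open>cis (t * r)\<close>;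
  this is the infinitesimal factor of the Koopman generator.\<close>

lemma cis_difference_quotient: "((\<lambda>t. (cis (t * r) - 1) / of_real t) \<longlongrightarrow> \<i> * of_real r) (at 0)"
proof -
  have "((\<lambda>t. cos (t * r)) has_real_derivative 0) (at 0)" "((\<lambda>t. sin (t * r)) has_real_derivative r) (at 0)"
    by (auto intro!: derivative_eq_intros)
  then have "((\<lambda>t. Complex ((cos (t * r) - 1) / t) (sin (t * r) / t)) \<longlongrightarrow> Complex 0 r) (at 0)"
    unfolding DERIV_def by (intro tendsto_Complex) simp_all
  moreover have "Complex ((cos (t * r) - 1) / t) (sin (t * r) / t) = (cis (t * r) - 1) / of_real t" for t
    by (simp add: complex_eq_iff)
  moreover have "Complex 0 r = \<i> * of_real r"
    by (simp add: complex_eq_iff)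
  ultimately show ?thesis
    by simp
qed

locale torus_manifold =
  fixes A :: "('a::t2_space, 'e::euclidean_space) chart set" and \<zeta> :: "'m::finite \<Rightarrow> 'a \<Rightarrow> complex"
  assumes atlas: "smooth_atlas A"
    and normalized: "cmod (\<zeta> i a) = 1"
    and smooth: "smooth_fun A (\<zeta> i)"
    and diffeomorphism: "diffeomorphism_onto A torus (torus_map \<zeta>)"
begin

text \<open>The covering of the manifold by the space of angles. In contrast to
  \<open>angle_coord\<close>, which only selects one preimage, it has no jumps.\<close>

definition angle_param :: "real^'m \<Rightarrow> 'a"
  where "angle_param x = inv (torus_map \<zeta>) (torus_exp x)"

text \<open>Defined through the values of the \<open>\<zeta> j\<close> instead of angles, so that no
  branch of the argument has to be chosen.\<close>

definition rotation :: "real^'m \<Rightarrow> real \<Rightarrow> 'a \<Rightarrow> 'a"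
  where "rotation s t a = inv (torus_map \<zeta>) (\<chi> j. cis (t * s $ j) * \<zeta> j a)"

text \<open>The direction \<open>s\<close> is constant in the angles. The value 0 off the smooth
  functions matches the convention in \<open>tangent_space\<close>.\<close>

definition constant_field :: "real^'m \<Rightarrow> 'a vfield"
  where "constant_field s a f =
    (if smooth_fun A f then frechet_derivative (\<lambda>x. f (angle_param x)) (at (angle_coord \<zeta> a)) s else 0)"

lemma bij_torus_map: "bij_betw (torus_map \<zeta>) UNIV torus"
  using diffeomorphism by (simp add: diffeomorphism_onto_def)

lemma inv_torus_map [simp]: "inv (torus_map \<zeta>) (torus_map \<zeta> a) = a"
  using bij_torus_map by (simp add: bij_betw_inv_into_left)

lemma torus_map_inv: "y \<in> torus \<Longrightarrow> torus_map \<zeta> (inv (torus_map \<zeta>) y) = y"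
  using bij_torus_map by (rule bij_betw_inv_into_right)

lemma zeta_inv: "y \<in> torus \<Longrightarrow> \<zeta> j (inv (torus_map \<zeta>) y) = y $ j"
  using torus_map_inv[of y] by (simp add: torus_map_def vec_eq_iff)

text \<open>Injectivity of \<open>torus_map\<close>, in the form that reduces identities between
  points, such as the group laws of rotations, to identities for \<open>cis\<close>.\<close>

lemma eq_if_zeta_eq:
  assumes "\<And>j. \<zeta> j a = \<zeta> j b"
  shows "a = b"
proof -
  have "torus_map \<zeta> a = torus_map \<zeta> b"
    by (simp add: torus_map_def assms)
  then show ?thesis
    by (metis inv_torus_map)
qed

lemma rotated_in_torus: "(\<chi> j. cis (t * s $ j) * \<zeta> j a) \<in> torus"
  by (simp add: torus_def norm_mult normalized)

lemma zeta_angle_param [simp]: "\<zeta> j (angle_param x) = cis (x $ j)"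
  unfolding angle_param_def by (subst zeta_inv) (simp_all add: torus_exp_def torus_def)

lemma zeta_rotation [simp]: "\<zeta> j (rotation s t a) = cis (t * s $ j) * \<zeta> j a"
  unfolding rotation_def by (subst zeta_inv) (simp_all add: rotated_in_torus)

lemma angle_param_angle_coord [simp]: "angle_param (angle_coord \<zeta> a) = a"
proof (rule eq_if_zeta_eq)
  fix j
  have "\<zeta> j a \<noteq> 0"
    using normalized[of j a] by auto
  then show "\<zeta> j (angle_param (angle_coord \<zeta> a)) = \<zeta> j a"
    using normalized[of j a] by (simp add: angle_coord_def cis_Arg sgn_div_norm)
qed

lemma rotation_angle_param: "rotation s t (angle_param x) = angle_param (x + t *\<^sub>R s)"
  by (rule eq_if_zeta_eq) (simp add: cis_mult add.commute)

lemma rotation_0 [simp]: "rotation s 0 a = a"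
  by (rule eq_if_zeta_eq) simp

lemma rotation_add: "rotation s (t + t') a = rotation s t (rotation s t' a)"
  by (rule eq_if_zeta_eq) (simp add: cis_mult distrib_right flip: mult.assoc)

lemma rotation_commute: "rotation s t (rotation s' t' a) = rotation s' t' (rotation s t a)"
  by (rule eq_if_zeta_eq) (simp add: ac_simps)

text \<open>Near \<open>h x\<close> the inverse of \<open>torus_map\<close> agrees on the torus with
  a smooth map \<open>G\<close> of the ambient space. As \<open>h\<close> takes values in the torus,
  composing with \<open>G\<close> or with the inverse makes no difference.\<close>

lemma smooth_into_inv:
  fixes h :: "'f::real_normed_vector \<Rightarrow> complex^'m"
  assumes S: "open S" and h: "smooth_on S h" "h ` S \<subseteq> torus"
  shows "smooth_into A S (\<lambda>x. inv (torus_map \<zeta>) (h x))"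
proof (rule smooth_into_local[OF atlas])
  fix x assume x: "x \<in> S"
  then have "h x \<in> torus"
    using h by auto
  then obtain W G where W: "open W" "h x \<in> W" "smooth_map {(W, \<lambda>x. x)} A G"
      "\<And>y. y \<in> W \<inter> torus \<Longrightarrow> G y = inv (torus_map \<zeta>) y"
    using diffeomorphism unfolding diffeomorphism_onto_def by meson
  let ?U = "S \<inter> h -` W"
  have U: "open ?U"
    using continuous_open_preimage[OF smooth_on_imp_continuous_on[OF h(1)] S W(1)] .
  have "smooth_into A ?U (\<lambda>x. G (h x))"
    by (rule smooth_into_comp[OF atlas W(1) smooth_map_identity_chart[OF atlas W(1,3)] U])
      (auto intro: smooth_on_subset[OF h(1)])
  then have "smooth_into A ?U (\<lambda>x. inv (torus_map \<zeta>) (h x))"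
    by (rule smooth_into_cong[OF atlas U]) (use W(4) h(2) in auto)
  then show "\<exists>U. open U \<and> x \<in> U \<and> smooth_into A U (\<lambda>x. inv (torus_map \<zeta>) (h x))"
    using U x W(2) by blast
qed

lemma smooth_angle_param: "smooth_fun A f \<Longrightarrow> smooth_on UNIV (\<lambda>x. f (angle_param x))"
proof (rule smooth_into_compose[OF atlas open_UNIV])
  have "smooth_on UNIV (torus_exp :: real^'m \<Rightarrow> complex^'m)"
    unfolding torus_exp_def
    by (intro smooth_on_vec_lambda smooth_on_cis smooth_on_bounded_linear bounded_linear_vec_nth open_UNIV)
  then show "smooth_into A UNIV angle_param"
    unfolding angle_param_def by (rule smooth_into_inv[OF open_UNIV]) (auto simp: torus_exp_def torus_def)
qed

lemma has_derivative_angle_param: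
  "smooth_fun A f \<Longrightarrow> ((\<lambda>x. f (angle_param x)) has_derivative frechet_derivative (\<lambda>x. f (angle_param x)) (at x)) (at x)"
  using smooth_on_imp_has_derivative[OF smooth_angle_param] by blast

text \<open>A line with direction \<open>s\<close> in the space of angles covers a rotation orbit.
  So the field is the derivative along the orbit, and uniqueness of derivatives allows computing it
  without any reference to angles.\<close>

lemma constant_field_eqI:
  assumes f: "smooth_fun A f" and D: "((\<lambda>t. f (rotation s t a)) has_real_derivative D) (at 0)"
  shows "constant_field s a f = D"
proof -
  define x where "x = angle_coord \<zeta> a"
  have "((\<lambda>t. f (angle_param (x + t *\<^sub>R s))) has_vector_derivative frechet_derivative (\<lambda>x. f (angle_param x)) (at x) s) (at 0)"
    using has_vector_derivative_line[of "\<lambda>x. f (angle_param x)" _ x 0 s] has_derivative_angle_param[OF f] by simp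
  moreover have "rotation s t a = angle_param (x + t *\<^sub>R s)" for t
    using rotation_angle_param[of s t x] by (simp add: x_def)
  ultimately have "((\<lambda>t. f (rotation s t a)) has_real_derivative frechet_derivative (\<lambda>x. f (angle_param x)) (at x) s) (at 0)"
    by (simp add: has_real_derivative_iff_has_vector_derivative)
  then show ?thesis
    using D f DERIV_unique unfolding constant_field_def x_def by auto
qed

text \<open>Here the periodicity enters: every lift \<open>x\<close> of the point gives the same
  derivative as the principal angles used in the definition.\<close>

lemma constant_field_angle_param:
  assumes f: "smooth_fun A f"
  shows "constant_field s (angle_param x) f = frechet_derivative (\<lambda>x. f (angle_param x)) (at x) s"
proof (rule constant_field_eqI[OF f])
  show "((\<lambda>t. f (rotation s t (angle_param x))) has_real_derivative frechet_derivative (\<lambda>x. f (angle_param x)) (at x) s) (at 0)"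
    using has_vector_derivative_line[of "\<lambda>x. f (angle_param x)" _ x 0 s] has_derivative_angle_param[OF f]
    by (simp add: has_real_derivative_iff_has_vector_derivative rotation_angle_param)
qed

lemma DERIV_rotation:
  assumes f: "smooth_fun A f"
  shows "((\<lambda>t. f (rotation s t a)) has_real_derivative constant_field s (rotation s t a) f) (at t)"
proof -
  define x where "x = angle_coord \<zeta> a"
  have [simp]: "a = angle_param x"
    by (simp add: x_def)
  show ?thesis
    using has_vector_derivative_line[of "\<lambda>x. f (angle_param x)" _ x t s] has_derivative_angle_param[OF f]
    by (simp add: has_real_derivative_iff_has_vector_derivative rotation_angle_param constant_field_angle_param[OF f])
qed

lemma DERIV_rotation_0:
  "smooth_fun A f \<Longrightarrow> ((\<lambda>t. f (rotation s t a)) has_real_derivative constant_field s a f) (at 0)"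
  using DERIV_rotation[of f s a 0] by simp

lemma smooth_into_rotation_chart:
  assumes c: "c \<in> A"
  shows "smooth_into A (UNIV \<times> chart_image c) (\<lambda>(t, x). rotation s t (chart_inv c x))"
proof -
  let ?S = "UNIV \<times> chart_image c :: (real \<times> 'e) set"
  note ch = chart_properties[OF atlas c]
  have S: "open ?S"
    using ch(2) by (simp add: open_Times)
  have "smooth_on ?S (\<lambda>y. \<zeta> j (chart_inv c (snd y)))" for j
    by (rule smooth_on_compose[OF S ch(2) smooth_fun_on_chart[OF smooth c] smooth_on_bounded_linear[OF bounded_linear_snd]]) auto
  moreover have "smooth_on ?S (\<lambda>y. cis (fst y * s $ j))" for j
    by (intro smooth_on_cis S smooth_on_bounded_linear bounded_linear_mult_const bounded_linear_fst)
  ultimately have "smooth_on ?S (\<lambda>y. \<chi> j. cis (fst y * s $ j) * \<zeta> j (chart_inv c (snd y)))"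
    by (intro smooth_on_vec_lambda S smooth_on_mult)
  then show ?thesis
    unfolding rotation_def case_prod_beta' by (rule smooth_into_inv[OF S]) (auto simp: rotated_in_torus)
qed

text \<open>The definition evaluates at \<open>angle_coord\<close>, which jumps, and so does not
  show smoothness. Instead, in a chart the field is the partial derivative in time, at time 0, of a
  function \<open>h\<close> that is jointly smooth in time and position.\<close>

lemma smooth_fun_constant_field:
  assumes f: "smooth_fun A f"
  shows "smooth_fun A (\<lambda>a. constant_field s a f)"
  unfolding smooth_fun_def
proof
  fix c assume c: "c \<in> A"
  let ?S = "UNIV \<times> chart_image c :: (real \<times> 'e) set"
  note ch = chart_properties[OF atlas c]
  have S: "open ?S"
    using ch(2) by (simp add: open_Times)
  define h where "h y = f (rotation s (fst y) (chart_inv c (snd y)))" for y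
  have h: "smooth_on ?S h"
    using smooth_into_compose[OF atlas S smooth_into_rotation_chart[OF c] f]
    by (simp add: h_def[abs_def] case_prod_beta')
  have eq: "constant_field s (chart_inv c x) f = frechet_derivative h (at (0, x)) (1, 0)"
    if x: "x \<in> chart_image c" for x
  proof (rule constant_field_eqI[OF f])
    have "(h has_derivative frechet_derivative h (at (0, x))) (at ((0, x) + 0 *\<^sub>R (1, 0)))"
      using smooth_on_imp_has_derivative[OF h] x by simp
    from has_vector_derivative_line[OF this]
    show "((\<lambda>t. f (rotation s t (chart_inv c x))) has_real_derivative frechet_derivative h (at (0, x)) (1, 0)) (at 0)"
      by (simp add: h_def has_real_derivative_iff_has_vector_derivative)
  qed
  have "smooth_on (chart_image c) (\<lambda>x. frechet_derivative h (at (0, x)) (1, 0))"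
    by (rule smooth_on_compose[OF ch(2) S smooth_on_directional_derivative[OF h]
          smooth_on_bounded_linear[of "\<lambda>x. (0, x)"]]) (auto intro: bounded_linear_Pair bounded_linear_ident bounded_linear_zero)
  then show "smooth_on (chart_image c) ((\<lambda>a. constant_field s a f) \<circ> chart_inv c)"
    by (rule smooth_on_eqI[OF ch(2)]) (simp add: eq)
qed

lemma smooth_vector_field_constant_field: "smooth_vector_field A (constant_field s)"
  unfolding smooth_vector_field_def tangent_space_def mem_Collect_eq
proof (intro conjI allI impI)
  fix a and f g :: "'a \<Rightarrow> real" and r t :: real
  assume f: "smooth_fun A f" and g: "smooth_fun A g"
  note D = DERIV_rotation_0[OF f, of s a] DERIV_rotation_0[OF g, of s a]
  have "smooth_fun A (\<lambda>a. r * f a + t * g a)"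
    by (intro smooth_fun_add smooth_fun_mult smooth_fun_const atlas f g)
  then show "constant_field s a (\<lambda>x. r * f x + t * g x) = r * constant_field s a f + t * constant_field s a g"
    by (rule constant_field_eqI) (auto intro!: derivative_eq_intros D)
  have "smooth_fun A (\<lambda>a. f a * g a)"
    by (intro smooth_fun_mult atlas f g)
  then show "constant_field s a (\<lambda>x. f x * g x) = f a * constant_field s a g + g a * constant_field s a f"
    by (rule constant_field_eqI) (auto intro!: derivative_eq_intros D)
qed (auto simp: smooth_fun_constant_field, simp add: constant_field_def)

section \<open>Rotations as the flows of constant fields\<close>

lemma continuous_on_rotated:
  "continuous_on UNIV (\<lambda>(t, a). \<chi> j. cis (t * s $ j) * \<zeta> j a)"
proof -
  have "continuous_on UNIV (\<lambda>x. \<zeta> j (snd x))" for j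
    by (rule continuous_on_compose2[OF smooth_fun_continuous[OF atlas smooth]]) (auto intro: continuous_intros)
  then show ?thesis
    unfolding case_prod_beta' by (intro continuous_intros)
qed

lemma continuous_on_inv: "continuous_on torus (inv (torus_map \<zeta>))"
  unfolding continuous_on_eq_continuous_within
proof
  fix y :: "complex^'m" assume y: "y \<in> torus"
  then obtain W G where W: "open W" "y \<in> W" "smooth_map {(W, \<lambda>x. x)} A G"
      "\<And>y. y \<in> W \<inter> torus \<Longrightarrow> G y = inv (torus_map \<zeta>) y"
    using diffeomorphism unfolding diffeomorphism_onto_def by meson
  have "isCont G y"
    using smooth_map_identity_chart[OF atlas W(1,3)] W(1,2)
    unfolding smooth_into_def by (simp add: continuous_on_eq_continuous_at)
  then have "continuous (at y within torus) G"
    by (rule continuous_at_imp_continuous_at_within)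
  moreover have "eventually (\<lambda>x. G x = inv (torus_map \<zeta>) x) (at y within torus)"
    using W by (auto simp: eventually_at_topological)
  moreover have "G y = inv (torus_map \<zeta>) y"
    using W y by simp
  ultimately show "continuous (at y within torus) (inv (torus_map \<zeta>))"
    unfolding continuous_within using tendsto_cong by force
qed

lemma continuous_on_rotation: "continuous_on UNIV (\<lambda>(t, a). rotation s t a)"
  using continuous_on_compose2[OF continuous_on_inv continuous_on_rotated[of s]]
  by (force simp: rotation_def case_prod_beta' rotated_in_torus)

lemma continuous_rotation: "continuous_on UNIV (rotation s t)"
  using continuous_on_compose2[OF continuous_on_rotation[of s], of UNIV "\<lambda>a. (t, a)"]
  by (simp add: continuous_intros)

lemma generates_rotation: "generates_flow A (constant_field s) (rotation s)"
  unfolding generates_flow_def smooth_flow_def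
proof (intro conjI allI impI)
  show "rotation s 0 = id"
    by (simp add: fun_eq_iff)
  show "rotation s (t + t') = rotation s t \<circ> rotation s t'" for t t'
    by (simp add: fun_eq_iff rotation_add)
  show "smooth_map (line_times A) A (\<lambda>(t, a). rotation s t a)"
    by (intro smooth_map_line_times atlas continuous_on_rotation smooth_into_rotation_chart)
  show "((\<lambda>t. (f (rotation s t a) - f a) / t) \<longlongrightarrow> constant_field s a f) (at 0)"
    if "smooth_fun A f" for f a
    using DERIV_rotation_0[OF that, of s a] by (simp add: DERIV_def)
qed

text \<open>A flow is determined by its action on the \<open>\<zeta>\<^sub>j\<close>, on which the generator fixes a linear equation.\<close>

lemma generates_flow_eq_rotation:
  assumes X: "generates_flow A X \<Theta>"
    and eig: "\<And>j a. vf_complex X (\<zeta> j) a = \<i> * of_real (s $ j) * \<zeta> j a"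
  shows "\<Theta> = rotation s"
proof (intro ext eq_if_zeta_eq)
  fix t a j
  have deriv: "((\<lambda>t. \<zeta> j (\<Theta> t a)) has_vector_derivative \<i> * of_real (s $ j) * \<zeta> j (\<Theta> t a)) (at t)" for t
  proof -
    \<comment> \<open>\<open>generates_flow\<close> controls difference quotients at time 0 only;
      the group law carries them to time \<open>t\<close>.\<close>
    have add: "\<Theta> (t + h) a = \<Theta> h (\<Theta> t a)" for h
      using X unfolding generates_flow_def smooth_flow_def by (metis add.commute comp_apply)
    have "((\<lambda>t. f (\<Theta> t a)) has_real_derivative X (\<Theta> t a) f) (at t)" if "smooth_fun A f" for f
      using X that unfolding generates_flow_def DERIV_def add by blast
    from this[OF smooth_fun_Re[OF atlas smooth]] this[OF smooth_fun_Im[OF atlas smooth]]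
    show ?thesis
      by (simp only: has_vector_derivative_complex_iff flip: eig) (simp add: vf_complex_def)
  qed
  \<comment> \<open>The integrating factor cancels the linear equation for \<open>\<zeta> j\<close>
    along the orbit, so that \<open>g\<close> is constant.\<close>
  define g where "g t = cis (- (t * s $ j)) * \<zeta> j (\<Theta> t a)" for t
  have "(g has_vector_derivative 0) (at t)" for t
  proof -
    have "((\<lambda>t. cis (- (t * s $ j))) has_vector_derivative - \<i> * of_real (s $ j) * cis (- (t * s $ j))) (at t)"
      unfolding has_vector_derivative_def
      by (rule has_derivative_eq_rhs, (rule derivative_intros)+) (auto simp: fun_eq_iff scaleR_conv_of_real)
    from has_vector_derivative_mult[OF this deriv] show ?thesis
      by (simp add: g_def[abs_def] algebra_simps)
  qed
  then obtain c where "g t = c" for t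
    using has_vector_derivative_zero_constant[of UNIV g] by auto
  then have "g t = g 0"
    by metis
  then have "cis (t * s $ j) * g t = cis (t * s $ j) * \<zeta> j a"
    using X by (simp add: g_def generates_flow_def smooth_flow_def)
  then show "\<zeta> j (\<Theta> t a) = \<zeta> j (rotation s t a)"
    by (simp add: g_def cis_mult flip: mult.assoc)
qed

lemma eigenfun_rotation:
  "eigenfun \<zeta> k (rotation s t a) = cis (t * (\<Sum>j\<in>UNIV. of_int (k j) * s $ j)) * eigenfun \<zeta> k a"
proof -
  have "(\<Prod>j\<in>J. cis (of_int (k j) * (t * s $ j))) = cis (t * (\<Sum>j\<in>J. of_int (k j) * s $ j))" for J
    by (induction J rule: infinite_finite_induct) (auto simp: cis_mult algebra_simps)
  then show ?thesis
    by (simp add: eigenfun_def power_int_mult_distrib prod.distrib cis_power_int)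
qed

lemma smooth_zeta_powi: "smooth_fun A (\<lambda>a. \<zeta> j a powi n)"
proof -
  have power: "smooth_fun A (\<lambda>a. f a ^ l)" if "smooth_fun A f" for f :: "'a \<Rightarrow> complex" and l
    using smooth_fun_prod[OF atlas, of "{..<l}" "\<lambda>_. f"] that by simp
  show ?thesis
  proof (cases "0 \<le> n")
    case True
    then show ?thesis
      using power[OF smooth] by (simp add: power_int_def)
  next
    case False
    then show ?thesis
      using power[OF smooth_fun_linear[OF atlas bounded_linear_cnj smooth]]
      by (simp add: power_int_def inverse_eq_cnj[OF normalized])
  qed
qed

lemma smooth_eigenfun: "smooth_fun A (eigenfun \<zeta> k)"
  unfolding eigenfun_def by (intro smooth_fun_prod atlas smooth_zeta_powi)

text \<open>Along an orbit the eigenfunction is multiplied by \<open>cis (t * r)\<close>. Since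
  \<open>vf_complex\<close> acts on real and imaginary parts separately, these are differentiated
  one by one.\<close>

lemma constant_field_eigenfun:
  "vf_complex (constant_field s) (eigenfun \<zeta> k) a =
   \<i> * of_real (\<Sum>j\<in>UNIV. of_int (k j) * s $ j) * eigenfun \<zeta> k a"
proof -
  define r where "r = (\<Sum>j\<in>UNIV. of_int (k j) * s $ j)"
  have Re: "constant_field s a (\<lambda>a. Re (eigenfun \<zeta> k a)) = - r * Im (eigenfun \<zeta> k a)"
    by (rule constant_field_eqI[OF smooth_fun_Re[OF atlas smooth_eigenfun]])
      (auto intro!: derivative_eq_intros simp: eigenfun_rotation simp flip: r_def)
  have Im: "constant_field s a (\<lambda>a. Im (eigenfun \<zeta> k a)) = r * Re (eigenfun \<zeta> k a)"
    by (rule constant_field_eqI[OF smooth_fun_Im[OF atlas smooth_eigenfun]])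
      (auto intro!: derivative_eq_intros simp: eigenfun_rotation simp flip: r_def)
  show ?thesis
    unfolding vf_complex_def Re Im r_def[symmetric] by (simp add: complex_eq_iff)
qed

lemma eigenfun_axis: "eigenfun \<zeta> (\<lambda>i. if i = j then n else 0) = (\<lambda>a. \<zeta> j a powi n)"
  by (auto simp: eigenfun_def fun_eq_iff if_distrib[of "\<lambda>n. _ powi n"] cong: if_cong)

lemma constant_field_zeta:
  "vf_complex (constant_field s) (\<zeta> j) a = \<i> * of_real (s $ j) * \<zeta> j a"
  using constant_field_eigenfun[of s "\<lambda>i. if i = j then 1 else 0" a]
  by (simp add: eigenfun_axis if_distrib[of of_int] if_distrib[of "\<lambda>x. x * _"] cong: if_cong)

lemma generates_flow_constant_field: "generates_flow A (constant_field s) \<Theta> \<longleftrightarrow> \<Theta> = rotation s"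
  using generates_flow_eq_rotation[OF _ constant_field_zeta] generates_rotation by blast

lemma commutator_constant_field: "commutator (constant_field s) (constant_field s') = (\<lambda>_ _. 0)"
proof (intro ext)
  fix a f
  show "commutator (constant_field s) (constant_field s') a f = 0"
  proof (cases "smooth_fun A f")
    case True
    \<comment> \<open>The inner field must be known near the point, not just at it, so it is
      rewritten at every lift \<open>x\<close>; then both orders are second derivatives in the space
      of angles.\<close>
    have "constant_field s a (\<lambda>b. constant_field s' b f) =
      frechet_derivative (\<lambda>x. frechet_derivative (\<lambda>x. f (angle_param x)) (at x) s') (at (angle_coord \<zeta> a)) s" for s s'
      using smooth_fun_constant_field[OF True, of s'] by (simp add: constant_field_def[of s] constant_field_angle_param[OF True])
    then show ?thesis
      using frechet_derivative_commute[OF smooth_angle_param[OF True]] by (simp add: commutator_def)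
  next
    \<comment> \<open>On functions that are not smooth the fields are 0 by convention, so both terms
      apply a field to the zero function.\<close>
    case False
    then have "constant_field s b f = 0" for s b
      by (simp add: constant_field_def)
    moreover have "constant_field s a (\<lambda>_. 0) = 0" for s
      by (rule constant_field_eqI) (auto simp: smooth_fun_const)
    ultimately show ?thesis
      by (simp add: commutator_def)
  qed
qed

lemma smooth_fun_rotation:
  fixes f :: "'a \<Rightarrow> 'b::real_normed_vector"
  assumes f: "smooth_fun A f"
  shows "smooth_fun A (\<lambda>a. f (rotation s t a))"
  unfolding smooth_fun_def
proof
  fix c assume c: "c \<in> A"
  note ch = chart_properties[OF atlas c]
  have "smooth_on (chart_image c) (\<lambda>x. \<chi> j. cis (t * s $ j) * \<zeta> j (chart_inv c x))"
    by (intro smooth_on_vec_lambda ch(2) smooth_on_mult smooth_on_const smooth_fun_on_chart[OF smooth c])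
  then have "smooth_into A (chart_image c) (\<lambda>x. rotation s t (chart_inv c x))"
    unfolding rotation_def by (rule smooth_into_inv[OF ch(2)]) (auto simp: rotated_in_torus)
  from smooth_into_compose[OF atlas ch(2) this f]
  show "smooth_on (chart_image c) ((\<lambda>a. f (rotation s t a)) \<circ> chart_inv c)"
    by (simp add: comp_def)
qed

lemma pushforward_constant_field:
  "pushforward A (rotation s' t) (constant_field s a) = constant_field s (rotation s' t a)"
proof
  fix f
  show "pushforward A (rotation s' t) (constant_field s a) f = constant_field s (rotation s' t a) f"
  proof (cases "smooth_fun A f")
    case True
    have "constant_field s a (\<lambda>a. f (rotation s' t a)) = constant_field s (rotation s' t a) f"
      by (rule constant_field_eqI[OF smooth_fun_rotation[OF True]])
        (subst rotation_commute, rule DERIV_rotation_0[OF True])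
    then show ?thesis
      using True by (simp add: pushforward_def comp_def)
  qed (simp add: pushforward_def constant_field_def)
qed

text \<open>Linearity of the derivative in its direction. This gives both the scaled coordinate
  fields and the decomposition of the full generator.\<close>

lemma constant_field_decompose:
  "constant_field s a f = (\<Sum>i\<in>UNIV. s $ i * constant_field (axis i 1) a f)"
proof (cases "smooth_fun A f")
  case True
  let ?D = "frechet_derivative (\<lambda>x. f (angle_param x)) (at (angle_coord \<zeta> a))"
  have lin: "linear ?D"
    using has_derivative_linear[OF has_derivative_angle_param[OF True]] .
  have "?D s = ?D (\<Sum>i\<in>UNIV. s $ i *\<^sub>R axis i 1)"
    by (simp add: basis_expansion scalar_mult_eq_scaleR flip: scalar_mult_eq_scaleR)
  also have "\<dots> = (\<Sum>i\<in>UNIV. s $ i * ?D (axis i 1))"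
    by (simp add: linear_sum[OF lin] linear_cmul[OF lin])
  finally show ?thesis
    using True by (simp add: constant_field_def)
qed (simp add: constant_field_def)

lemma angle_field_eq: "angle_field A \<zeta> i a f = constant_field (axis i 1) a f"
  by (simp add: angle_field_def constant_field_def angle_param_def comp_def)

lemma scaled_angle_field: "(\<lambda>a f. w * angle_field A \<zeta> i a f) = constant_field (axis i w)"
proof (intro ext)
  fix a f
  have "(\<Sum>j\<in>UNIV. axis i w $ j * constant_field (axis j 1) a f) =
    (\<Sum>j\<in>UNIV. if j = i then w * constant_field (axis i 1) a f else 0)"
    by (rule sum.cong) (auto simp: axis_def)
  then show "w * angle_field A \<zeta> i a f = constant_field (axis i w) a f"
    by (simp add: angle_field_eq constant_field_decompose[of "axis i w"])
qed

end

section \<open>Square-integrable functions\<close>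

lemma L2_measurable: "f \<in> L2 \<mu> \<Longrightarrow> f \<in> borel_measurable \<mu>"
  by (simp add: L2_def)

lemma L2_square_integrable: "f \<in> L2 \<mu> \<Longrightarrow> integrable \<mu> (\<lambda>x. (cmod (f x))\<^sup>2)"
  by (simp add: L2_def)

lemma L2_zero: "(\<lambda>_. 0) \<in> L2 \<mu>"
  by (simp add: L2_def)

lemma L2_bounded_mult:
  assumes F: "F \<in> L2 \<mu>" and p: "p \<in> borel_measurable \<mu>" "\<And>x. cmod (p x) \<le> B"
  shows "(\<lambda>x. F x * p x) \<in> L2 \<mu>"
proof -
  note [measurable] = L2_measurable[OF F] p(1)
  have "integrable \<mu> (\<lambda>x. (cmod (F x * p x))\<^sup>2)"
  proof (rule Bochner_Integration.integrable_bound)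
    show "integrable \<mu> (\<lambda>x. B\<^sup>2 * (cmod (F x))\<^sup>2)"
      using L2_square_integrable[OF F] by simp
    have "(cmod (p x))\<^sup>2 \<le> B\<^sup>2" for x
      using p(2)[of x] by (intro power_mono) auto
    then show "AE x in \<mu>. norm ((cmod (F x * p x))\<^sup>2) \<le> norm (B\<^sup>2 * (cmod (F x))\<^sup>2)"
      by (auto simp: norm_mult power_mult_distrib mult.commute[of "B\<^sup>2"] mult_left_mono)
  qed measurable
  then show ?thesis
    by (simp add: L2_def)
qed

lemma L2_scale:
  assumes "f \<in> L2 \<mu>"
  shows "(\<lambda>x. c * f x) \<in> L2 \<mu>"
  using L2_bounded_mult[OF assms, of "\<lambda>_. c" "cmod c"] by (simp add: mult.commute)

lemma norm_add_square_le: "(norm (a + b))\<^sup>2 \<le> 2 * (norm a)\<^sup>2 + 2 * (norm b)\<^sup>2"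
  for a b :: "'b::real_normed_vector"
proof -
  have "(norm (a + b))\<^sup>2 \<le> (norm a + norm b)\<^sup>2"
    by (intro power_mono norm_triangle_ineq) auto
  also have "\<dots> \<le> 2 * (norm a)\<^sup>2 + 2 * (norm b)\<^sup>2"
    using sum_squares_bound[of "norm a" "norm b"] by (simp add: power2_sum)
  finally show ?thesis .
qed

lemma L2_add:
  assumes f: "f \<in> L2 \<mu>" and g: "g \<in> L2 \<mu>"
  shows "(\<lambda>x. f x + g x) \<in> L2 \<mu>"
proof -
  note [measurable] = L2_measurable[OF f] L2_measurable[OF g]
  have "integrable \<mu> (\<lambda>x. (cmod (f x + g x))\<^sup>2)"
  proof (rule Bochner_Integration.integrable_bound)
    show "integrable \<mu> (\<lambda>x. 2 * (cmod (f x))\<^sup>2 + 2 * (cmod (g x))\<^sup>2)"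
      using L2_square_integrable[OF f] L2_square_integrable[OF g] by simp
  qed (auto simp: norm_add_square_le)
  then show ?thesis
    by (simp add: L2_def)
qed

lemma L2_diff:
  assumes "f \<in> L2 \<mu>" "g \<in> L2 \<mu>"
  shows "(\<lambda>x. f x - g x) \<in> L2 \<mu>"
  using L2_add[OF assms(1) L2_scale[OF assms(2), of "-1"]] by simp

lemma borel_measurable_cnj: "f \<in> borel_measurable \<mu> \<Longrightarrow> (\<lambda>x. cnj (f x)) \<in> borel_measurable \<mu>"
  using measurable_compose[OF _ borel_measurable_continuous_onI[OF continuous_on_cnj[OF continuous_on_id]]] .

lemma L2_cnj: "f \<in> L2 \<mu> \<Longrightarrow> (\<lambda>x. cnj (f x)) \<in> L2 \<mu>"
  by (simp add: L2_def borel_measurable_cnj)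

lemma (in finite_measure) L2_bounded:
  assumes "f \<in> borel_measurable M" "\<And>x. cmod (f x) \<le> B"
  shows "f \<in> L2 M"
  using L2_bounded_mult[of "\<lambda>_. 1" M f B] assms by (simp add: L2_def)

lemma L2_norm_nonneg: "0 \<le> L2_norm \<mu> f"
  by (simp add: L2_norm_def)

lemma L2_norm_square: "(L2_norm \<mu> f)\<^sup>2 = (\<integral>x. (cmod (f x))\<^sup>2 \<partial>\<mu>)"
  by (simp add: L2_norm_def)

lemma L2_norm_scale: "L2_norm \<mu> (\<lambda>x. c * f x) = cmod c * L2_norm \<mu> f"
  by (simp add: L2_norm_def norm_mult power_mult_distrib real_sqrt_mult)

text \<open>Connects the norm, a Bochner integral, with the extended nonnegative integrals in
  Fatou's lemma and in the Cauchy-Schwarz inequality.\<close>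

lemma L2_nn_integral:
  assumes "f \<in> L2 \<mu>"
  shows "(\<integral>\<^sup>+x. ennreal ((cmod (f x))\<^sup>2) \<partial>\<mu>) = ennreal ((L2_norm \<mu> f)\<^sup>2)"
  unfolding L2_norm_square using L2_square_integrable[OF assms] by (rule nn_integral_eq_integral) simp

lemma L2_norm_eq_0_imp_AE:
  assumes "f \<in> L2 \<mu>" "L2_norm \<mu> f = 0"
  shows "AE x in \<mu>. f x = 0"
  using assms integral_nonneg_eq_0_iff_AE[OF L2_square_integrable[OF assms(1)]] by (simp add: L2_norm_def)

lemma L2_inner_cnj: "L2_inner \<mu> g f = cnj (L2_inner \<mu> f g)"
proof -
  have "L2_inner \<mu> g f = (\<integral>x. cnj (cnj (f x) * g x) \<partial>\<mu>)"
    by (simp add: L2_inner_def mult.commute)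
  then show ?thesis
    unfolding L2_inner_def by (simp only: Bochner_Integration.integral_cnj)
qed

lemma L2_inner_self: "L2_inner \<mu> f f = of_real ((L2_norm \<mu> f)\<^sup>2)"
proof -
  have "cnj (f x) * f x = of_real ((cmod (f x))\<^sup>2)" for x
    by (metis complex_norm_square mult.commute)
  then show ?thesis
    unfolding L2_inner_def L2_norm_square by (simp only: integral_complex_of_real)
qed

lemma L2_inner_integrable:
  assumes f: "f \<in> L2 \<mu>" and g: "g \<in> L2 \<mu>"
  shows "integrable \<mu> (\<lambda>x. cnj (f x) * g x)"
proof (rule Bochner_Integration.integrable_bound)
  note [measurable] = L2_measurable[OF f] L2_measurable[OF g]
  show "integrable \<mu> (\<lambda>x. (cmod (f x))\<^sup>2 + (cmod (g x))\<^sup>2)"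
    using L2_square_integrable[OF f] L2_square_integrable[OF g] by simp
  have "cmod (f x) * cmod (g x) \<le> (cmod (f x))\<^sup>2 + (cmod (g x))\<^sup>2" for x
  proof -
    have "0 \<le> cmod (f x) * cmod (g x)"
      by simp
    then show ?thesis
      using sum_squares_bound[of "cmod (f x)" "cmod (g x)"] unfolding mult.assoc by linarith
  qed
  then show "AE x in \<mu>. norm (cnj (f x) * g x) \<le> norm ((cmod (f x))\<^sup>2 + (cmod (g x))\<^sup>2)"
    by (simp add: norm_mult)
  show "(\<lambda>x. cnj (f x) * g x) \<in> borel_measurable \<mu>"
    using L2_measurable[OF L2_cnj[OF f]] by measurable
qed

lemma L2_inner_add_right:
  "f \<in> L2 \<mu> \<Longrightarrow> g \<in> L2 \<mu> \<Longrightarrow> h \<in> L2 \<mu> \<Longrightarrow> L2_inner \<mu> f (\<lambda>x. g x + h x) = L2_inner \<mu> f g + L2_inner \<mu> f h"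
  by (simp add: L2_inner_def distrib_left L2_inner_integrable)

lemma L2_inner_diff_right:
  "f \<in> L2 \<mu> \<Longrightarrow> g \<in> L2 \<mu> \<Longrightarrow> h \<in> L2 \<mu> \<Longrightarrow> L2_inner \<mu> f (\<lambda>x. g x - h x) = L2_inner \<mu> f g - L2_inner \<mu> f h"
  by (simp add: L2_inner_def right_diff_distrib L2_inner_integrable)

lemma L2_inner_scale_right: "L2_inner \<mu> f (\<lambda>x. c * g x) = c * L2_inner \<mu> f g"
  by (simp add: L2_inner_def mult.left_commute)

lemma L2_inner_zero_right: "L2_inner \<mu> f (\<lambda>_. 0) = 0"
  by (simp add: L2_inner_def)

lemma L2_inner_zero_commute: "L2_inner \<mu> f g = 0 \<longleftrightarrow> L2_inner \<mu> g f = 0"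
  by (metis L2_inner_cnj complex_cnj_zero_iff)

lemma L2_Cauchy_Schwarz:
  assumes f: "f \<in> L2 \<mu>" and g: "g \<in> L2 \<mu>"
  shows "cmod (L2_inner \<mu> f g) \<le> L2_norm \<mu> f * L2_norm \<mu> g"
proof -
  note [measurable] = L2_measurable[OF f] L2_measurable[OF g]
  have int: "integrable \<mu> (\<lambda>x. cmod (f x) * cmod (g x))"
    using integrable_norm[OF L2_inner_integrable[OF f g]] by (simp add: norm_mult)
  have "cmod (L2_inner \<mu> f g) \<le> (\<integral>x. cmod (f x) * cmod (g x) \<partial>\<mu>)"
    unfolding L2_inner_def using integral_norm_bound[of \<mu> "\<lambda>x. cnj (f x) * g x"] by (simp add: norm_mult)
  also have "\<dots> \<le> L2_norm \<mu> f * L2_norm \<mu> g"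
  proof (rule power2_le_imp_le)
    have "ennreal ((\<integral>x. cmod (f x) * cmod (g x) \<partial>\<mu>)\<^sup>2) = (\<integral>\<^sup>+x. ennreal (cmod (f x)) * ennreal (cmod (g x)) \<partial>\<mu>)\<^sup>2"
      using nn_integral_eq_integral[OF int] by (simp add: ennreal_mult ennreal_power integral_nonneg_AE)
    also have "\<dots> \<le> (\<integral>\<^sup>+x. ennreal (cmod (f x)) ^ 2 \<partial>\<mu>) * (\<integral>\<^sup>+x. ennreal (cmod (g x)) ^ 2 \<partial>\<mu>)"
      by (rule Cauchy_Schwarz_nn_integral) measurable
    also have "\<dots> = ennreal ((L2_norm \<mu> f * L2_norm \<mu> g)\<^sup>2)"
      using L2_nn_integral[OF f] L2_nn_integral[OF g] by (simp add: ennreal_power ennreal_mult power_mult_distrib)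
    finally show "(\<integral>x. cmod (f x) * cmod (g x) \<partial>\<mu>)\<^sup>2 \<le> (L2_norm \<mu> f * L2_norm \<mu> g)\<^sup>2"
      by (simp add: ennreal_le_iff)
  qed (simp add: L2_norm_nonneg)
  finally show ?thesis .
qed

lemma L2_norm_bounded_mult_le:
  assumes F: "F \<in> L2 \<mu>" and p: "p \<in> borel_measurable \<mu>" "\<And>x. cmod (p x) \<le> B"
  shows "L2_norm \<mu> (\<lambda>x. F x * p x) \<le> B * L2_norm \<mu> F"
proof -
  have "0 \<le> B"
    using p(2) norm_ge_zero order_trans by blast
  have "(\<integral>x. (cmod (F x * p x))\<^sup>2 \<partial>\<mu>) \<le> (\<integral>x. B\<^sup>2 * (cmod (F x))\<^sup>2 \<partial>\<mu>)"
  proof (rule integral_mono)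
    have "(cmod (p x))\<^sup>2 \<le> B\<^sup>2" for x
      using p(2)[of x] by (intro power_mono) auto
    then show "(cmod (F x * p x))\<^sup>2 \<le> B\<^sup>2 * (cmod (F x))\<^sup>2" for x
      by (auto simp: norm_mult power_mult_distrib mult.commute[of "B\<^sup>2"] mult_left_mono)
  qed (use L2_square_integrable[OF F] L2_square_integrable[OF L2_bounded_mult[OF F p]] in auto)
  then have "(L2_norm \<mu> (\<lambda>x. F x * p x))\<^sup>2 \<le> (B * L2_norm \<mu> F)\<^sup>2"
    by (simp add: L2_norm_square power_mult_distrib)
  then show ?thesis
    by (rule power2_le_imp_le) (simp add: L2_norm_nonneg \<open>0 \<le> B\<close>)
qed

section \<open>Complex linear spans of functions\<close>

lemma cspan_zero: "(\<lambda>_. 0) \<in> cspan S"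
  unfolding cspan_def by (auto intro!: exI[of _ "{}"])

lemma cspan_add_scaled:
  assumes "p \<in> S" "f \<in> cspan S"
  shows "(\<lambda>x. c * p x + f x) \<in> cspan S"
proof -
  obtain P d where P: "finite P" "P \<subseteq> S" and f: "f = (\<lambda>x. \<Sum>p\<in>P. d p * p x)"
    using assms(2) unfolding cspan_def by auto
  \<comment> \<open>The terms are indexed by the functions themselves: if \<open>p\<close> already
    belongs to \<open>P\<close>, its coefficient has to be increased and no new term appears.
    \<open>d'\<close> covers both cases.\<close>
  define d' where "d' r = (if r = p then c else 0) + (if r \<in> P then d r else 0)" for r
  have "(\<Sum>r\<in>insert p P. d' r * r x) = c * p x + f x" for x
  proof -
    have "(\<Sum>r\<in>insert p P. d' r * r x) =
      (\<Sum>r\<in>insert p P. (if r = p then c * p x else 0)) + (\<Sum>r\<in>insert p P. (if r \<in> P then d r * r x else 0))"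
      unfolding sum.distrib[symmetric] d'_def by (rule sum.cong) (auto simp: distrib_right)
    also have "(\<Sum>r\<in>insert p P. (if r \<in> P then d r * r x else 0)) = f x"
      unfolding f using P(1) by (intro sum.mono_neutral_cong_right) auto
    finally show ?thesis
      using P(1) by simp
  qed
  then show ?thesis
    unfolding cspan_def using P assms(1)
    by (auto intro!: exI[of _ "insert p P"] exI[of _ d'])
qed

lemma cspan_induct [consumes 1, case_names zero add]:
  assumes "f \<in> cspan S" "Q (\<lambda>_. 0)"
    and "\<And>c p f. p \<in> S \<Longrightarrow> f \<in> cspan S \<Longrightarrow> Q f \<Longrightarrow> Q (\<lambda>x. c * p x + f x)"
  shows "Q f"
proof -
  have "Q (\<lambda>x. \<Sum>p\<in>P. d p * p x) \<and> (\<lambda>x. \<Sum>p\<in>P. d p * p x) \<in> cspan S" if "finite P" "P \<subseteq> S" for P d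
    using that by (induction P) (auto simp: assms(2,3) cspan_zero cspan_add_scaled)
  then show ?thesis
    using assms(1) unfolding cspan_def by auto
qed

lemma cspan_superset: "p \<in> S \<Longrightarrow> p \<in> cspan S"
  using cspan_add_scaled[OF _ cspan_zero, of p S 1] by simp

lemma cspan_scale: "f \<in> cspan S \<Longrightarrow> (\<lambda>x. c * f x) \<in> cspan S"
proof (induction rule: cspan_induct)
  case (add d p f)
  then show ?case
    using cspan_add_scaled[of p S "\<lambda>x. c * f x" "c * d"] by (simp add: algebra_simps)
qed (simp add: cspan_zero)

lemma cspan_add: "f \<in> cspan S \<Longrightarrow> g \<in> cspan S \<Longrightarrow> (\<lambda>x. f x + g x) \<in> cspan S"
proof (induction rule: cspan_induct)
  case (add c p f)
  then show ?case
    using cspan_add_scaled[of p S "\<lambda>x. f x + g x" c] by (simp add: algebra_simps)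
qed simp

lemma cspan_diff: "f \<in> cspan S \<Longrightarrow> g \<in> cspan S \<Longrightarrow> (\<lambda>x. f x - g x) \<in> cspan S"
  using cspan_add[of f S "\<lambda>x. (-1) * g x"] cspan_scale[of g S "-1"] by simp

lemma cspan_subset:
  assumes "S \<subseteq> U" "(\<lambda>_. 0) \<in> U" "\<And>f g. f \<in> U \<Longrightarrow> g \<in> U \<Longrightarrow> (\<lambda>x. f x + g x) \<in> U"
    "\<And>c f. f \<in> U \<Longrightarrow> (\<lambda>x. c * f x) \<in> U"
  shows "cspan S \<subseteq> U"
proof
  fix f assume "f \<in> cspan S"
  then show "f \<in> U"
    by (induction rule: cspan_induct) (use assms in blast)+
qed

lemma cspan_mono: "S \<subseteq> U \<Longrightarrow> cspan S \<subseteq> cspan U"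
  by (rule cspan_subset) (auto simp: cspan_superset cspan_zero cspan_add cspan_scale)

lemma cspan_mult:
  assumes "f \<in> cspan S" "g \<in> cspan U" "\<And>p r. p \<in> S \<Longrightarrow> r \<in> U \<Longrightarrow> (\<lambda>x. p x * r x) \<in> cspan W"
  shows "(\<lambda>x. f x * g x) \<in> cspan W"
  using assms(1)
proof (induction rule: cspan_induct)
  case (add c p f)
  have "(\<lambda>x. p x * g x) \<in> cspan W"
    using assms(2)
  proof (induction rule: cspan_induct)
    case (add d r g)
    then show ?case
      using cspan_add[OF cspan_scale[OF assms(3), of p r d] add.IH] \<open>p \<in> S\<close>
      by (simp add: algebra_simps)
  qed (simp add: cspan_zero)
  from cspan_add[OF cspan_scale[OF this, of c] add.IH] show ?case
    by (simp add: algebra_simps)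
qed (simp add: cspan_zero)

section \<open>Orthonormal bases\<close>

locale orthonormal_basis =
  fixes \<mu> :: "'a measure" and z :: "'k \<Rightarrow> 'a \<Rightarrow> complex"
  assumes basis: "L2_orthonormal_basis \<mu> z"
begin

text \<open>The closed span of the basis elements indexed by \<open>K\<close>, as
  \<open>L2_closure_eq_spectral\<close> shows. Encoding it by vanishing coefficients avoids infinite
  series.\<close>

definition spectral :: "'k set \<Rightarrow> ('a \<Rightarrow> complex) set"
  where "spectral K = {f \<in> L2 \<mu>. \<forall>k. k \<notin> K \<longrightarrow> L2_inner \<mu> (z k) f = 0}"

lemma z_L2: "z k \<in> L2 \<mu>"
  using basis by (simp add: L2_orthonormal_basis_def)

lemma z_orthonormal: "L2_inner \<mu> (z k) (z l) = (if k = l then 1 else 0)"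
  using basis by (simp add: L2_orthonormal_basis_def)

lemma z_norm: "L2_norm \<mu> (z k) = 1"
proof -
  have "(L2_norm \<mu> (z k))\<^sup>2 = 1"
    using L2_inner_self[of \<mu> "z k"] z_orthonormal[of k k] by (metis of_real_eq_1_iff)
  then show ?thesis
    using L2_norm_nonneg[of \<mu> "z k"] by (simp add: power2_eq_1_iff)
qed

lemma span_dense: "f \<in> L2 \<mu> \<Longrightarrow> 0 < e \<Longrightarrow> \<exists>g\<in>cspan (range z). L2_norm \<mu> (\<lambda>x. f x - g x) < e"
  using basis unfolding L2_orthonormal_basis_def L2_closure_def by blast

lemma spectral_L2: "f \<in> spectral K \<Longrightarrow> f \<in> L2 \<mu>"
  by (simp add: spectral_def)

lemma spectral_zero: "(\<lambda>_. 0) \<in> spectral K"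
  by (simp add: spectral_def L2_zero L2_inner_zero_right)

lemma spectral_add: "f \<in> spectral K \<Longrightarrow> g \<in> spectral K \<Longrightarrow> (\<lambda>x. f x + g x) \<in> spectral K"
  by (simp add: spectral_def L2_add L2_inner_add_right z_L2)

lemma spectral_scale: "f \<in> spectral K \<Longrightarrow> (\<lambda>x. c * f x) \<in> spectral K"
  by (simp add: spectral_def L2_scale L2_inner_scale_right)

lemma span_subset_spectral: "cspan (z ` K) \<subseteq> spectral K"
proof (rule cspan_subset)
  show "z ` K \<subseteq> spectral K"
    by (auto simp: spectral_def z_L2 z_orthonormal)
qed (auto simp: spectral_zero spectral_add spectral_scale)

lemma span_L2: "f \<in> cspan (z ` K) \<Longrightarrow> f \<in> L2 \<mu>"
  using span_subset_spectral spectral_L2 by blast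

text \<open>Coefficients depend continuously on the function by the Cauchy-Schwarz inequality, and
  basis elements have norm 1.\<close>

lemma spectral_closed:
  assumes f: "f \<in> L2 \<mu>" and appr: "\<And>e. 0 < e \<Longrightarrow> \<exists>g\<in>spectral K. L2_norm \<mu> (\<lambda>x. f x - g x) < e"
  shows "f \<in> spectral K"
proof -
  have "L2_inner \<mu> (z k) f = 0" if k: "k \<notin> K" for k
  proof -
    have "cmod (L2_inner \<mu> (z k) f) \<le> e" if e: "0 < e" for e
    proof -
      obtain g where g: "g \<in> spectral K" "L2_norm \<mu> (\<lambda>x. f x - g x) < e"
        using appr[OF e] by blast
      have "L2_inner \<mu> (z k) f = L2_inner \<mu> (z k) (\<lambda>x. f x - g x)"
        using g(1) k by (simp add: L2_inner_diff_right z_L2 f spectral_L2) (simp add: spectral_def)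
      also have "cmod \<dots> \<le> L2_norm \<mu> (z k) * L2_norm \<mu> (\<lambda>x. f x - g x)"
        by (intro L2_Cauchy_Schwarz z_L2 L2_diff f spectral_L2[OF g(1)])
      finally show ?thesis
        using g(2) by (simp add: z_norm)
    qed
    then show ?thesis
      using field_le_epsilon[of "cmod (L2_inner \<mu> (z k) f)" 0] by auto
  qed
  then show ?thesis
    using f by (simp add: spectral_def)
qed

lemma span_split:
  assumes "g \<in> cspan (range z)"
  shows "\<exists>g'\<in>cspan (z ` K). (\<lambda>x. g x - g' x) \<in> cspan (z ` (- K))"
  using assms
proof (induction rule: cspan_induct)
  case zero
  then show ?case
    by (auto intro!: bexI[of _ "\<lambda>_. 0"] cspan_zero)
next
  case (add c p f)
  obtain k where k: "p = z k"
    using add by auto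
  obtain f' where f': "f' \<in> cspan (z ` K)" "(\<lambda>x. f x - f' x) \<in> cspan (z ` (- K))"
    using add by auto
  show ?case
  proof (cases "k \<in> K")
    case True
    then show ?thesis
      using cspan_add_scaled[OF _ f'(1), of p c] f'(2) k
      by (intro bexI[of _ "\<lambda>x. c * p x + f' x"]) auto
  next
    case False
    then show ?thesis
      using cspan_add_scaled[OF _ f'(2), of p c] f'(1) k
      by (intro bexI[of _ f']) (auto simp: algebra_simps)
  qed
qed

lemma spectral_orthogonal_span:
  assumes "g \<in> cspan (z ` (- K))" and f: "f \<in> spectral K"
  shows "L2_inner \<mu> f g = 0"
  using assms(1)
proof (induction rule: cspan_induct)
  case (add c p g)
  have "L2_inner \<mu> f p = 0"
    using add(1) f by (subst L2_inner_zero_commute) (auto simp: spectral_def)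
  then show ?case
    using add L2_inner_add_right[OF spectral_L2[OF f] L2_scale[of p] span_L2[of g "- K"], of c]
    by (auto simp: L2_inner_scale_right z_L2)
qed (simp add: L2_inner_zero_right)

text \<open>The part of an approximant with frequencies outside \<^term>\<open>K\<close> is orthogonal to the rest, so
  dropping it does not increase the error.\<close>

lemma spectral_approx:
  assumes f: "f \<in> spectral K" and e: "0 < e"
  shows "\<exists>g\<in>cspan (z ` K). L2_norm \<mu> (\<lambda>x. f x - g x) < e"
proof -
  obtain g where g: "g \<in> cspan (range z)" "L2_norm \<mu> (\<lambda>x. f x - g x) < e"
    using span_dense[OF spectral_L2[OF f] e] by blast
  obtain g' where g': "g' \<in> cspan (z ` K)" "(\<lambda>x. g x - g' x) \<in> cspan (z ` (- K))"
    using span_split[OF g(1)] by blast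
  let ?u = "\<lambda>x. f x - g' x"
  have u: "?u \<in> spectral K"
    using spectral_add[OF f spectral_scale[of g' K "-1"]] g'(1) span_subset_spectral by auto
  have L2: "?u \<in> L2 \<mu>" "(\<lambda>x. g x - g' x) \<in> L2 \<mu>" "(\<lambda>x. f x - g x) \<in> L2 \<mu>"
    using u g' g spectral_L2[OF f] by (auto intro: spectral_L2 span_L2 L2_diff)
  \<comment> \<open>With \<open>?u\<close> for the new error, the old error \<open>f - g\<close> is
    \<open>?u\<close> minus the discarded part \<open>g - g'\<close>, which is orthogonal to
    \<open>?u\<close>. Pairing with \<open>?u\<close> and Cauchy-Schwarz then bound the new error by
    the old one.\<close>
  have "L2_inner \<mu> ?u (\<lambda>x. ?u x - (g x - g' x)) = of_real ((L2_norm \<mu> ?u)\<^sup>2)"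
    using L2_inner_diff_right[OF L2(1,1,2)] spectral_orthogonal_span[OF g'(2) u] by (simp add: L2_inner_self)
  then have "L2_inner \<mu> ?u (\<lambda>x. f x - g x) = of_real ((L2_norm \<mu> ?u)\<^sup>2)"
    by simp
  then have "(L2_norm \<mu> ?u)\<^sup>2 = cmod (L2_inner \<mu> ?u (\<lambda>x. f x - g x))"
    by (simp only: norm_of_real) simp
  also have "\<dots> \<le> L2_norm \<mu> ?u * L2_norm \<mu> (\<lambda>x. f x - g x)"
    by (rule L2_Cauchy_Schwarz[OF L2(1,3)])
  finally have "L2_norm \<mu> ?u \<le> L2_norm \<mu> (\<lambda>x. f x - g x)"
    using L2_norm_nonneg[of \<mu> ?u] L2_norm_nonneg[of \<mu> "\<lambda>x. f x - g x"]
    by (cases "L2_norm \<mu> ?u = 0") (auto simp: power2_eq_square)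
  then show ?thesis
    using g(2) g'(1) by (intro bexI[of _ g']) auto
qed

text \<open>A sandwich: any set between the finite span and the spectral space has the same closure.
  It is applied both to the generated rings and to spans of products.\<close>

lemma L2_closure_eq_spectral:
  assumes "cspan (z ` K) \<subseteq> S" "S \<inter> L2 \<mu> \<subseteq> spectral K"
  shows "L2_closure \<mu> S = spectral K"
proof
  show "L2_closure \<mu> S \<subseteq> spectral K"
  proof
    fix f assume "f \<in> L2_closure \<mu> S"
    then have "f \<in> L2 \<mu>" "\<exists>g\<in>S \<inter> L2 \<mu>. L2_norm \<mu> (\<lambda>x. f x - g x) < e" if "0 < e" for e
      using that by (auto simp: L2_closure_def)
    then show "f \<in> spectral K"
      using assms(2) by (intro spectral_closed) (use zero_less_one in blast)+
  qed
  show "spectral K \<subseteq> L2_closure \<mu> S"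
  proof
    fix f assume f: "f \<in> spectral K"
    have "\<exists>g\<in>S \<inter> L2 \<mu>. L2_norm \<mu> (\<lambda>x. f x - g x) < e" if "0 < e" for e
      using spectral_approx[OF f that] assms(1) span_L2 by blast
    then show "f \<in> L2_closure \<mu> S"
      using spectral_L2[OF f] by (simp add: L2_closure_def)
  qed
qed

lemma spectral_inner_eq_0:
  assumes f: "f \<in> spectral K" and g: "g \<in> L2 \<mu>" and orth: "\<And>p. p \<in> cspan (z ` K) \<Longrightarrow> L2_inner \<mu> p g = 0"
  shows "L2_inner \<mu> f g = 0"
proof -
  have "cmod (L2_inner \<mu> f g) \<le> e" if e: "0 < e" for e
  proof -
    \<comment> \<open>The summand 1 keeps the denominator positive when \<open>g\<close> has norm
      0.\<close>
    have "0 < e / (1 + L2_norm \<mu> g)"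
      using e L2_norm_nonneg[of \<mu> g] by simp
    from spectral_approx[OF f this] obtain p where
      p: "p \<in> cspan (z ` K)" "L2_norm \<mu> (\<lambda>x. f x - p x) < e / (1 + L2_norm \<mu> g)"
      by blast
    have "L2_inner \<mu> g f = L2_inner \<mu> g (\<lambda>x. f x - p x)"
      using orth[OF p(1)] by (simp add: L2_inner_diff_right g spectral_L2[OF f] span_L2[OF p(1)] L2_inner_zero_commute[of \<mu> g p])
    also have "cmod \<dots> \<le> L2_norm \<mu> g * L2_norm \<mu> (\<lambda>x. f x - p x)"
      by (intro L2_Cauchy_Schwarz g L2_diff spectral_L2[OF f] span_L2[OF p(1)])
    also have "\<dots> \<le> L2_norm \<mu> g * (e / (1 + L2_norm \<mu> g))"
      using p(2) L2_norm_nonneg[of \<mu> g] by (intro mult_left_mono) auto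
    also have "\<dots> \<le> e"
      using e L2_norm_nonneg[of \<mu> g] by (simp add: field_simps)
    finally show ?thesis
      by (subst L2_inner_cnj) simp
  qed
  then show ?thesis
    using field_le_epsilon[of "cmod (L2_inner \<mu> f g)" 0] by auto
qed

text \<open>The consequence of Parseval's identity that is needed, obtained without series:
  \<open>f\<close> is approximated by polynomials in its own frequencies, all of which are
  orthogonal to \<open>g\<close>.\<close>

lemma L2_inner_eq_0I:
  assumes f: "f \<in> L2 \<mu>" and g: "g \<in> L2 \<mu>" and "\<And>k. L2_inner \<mu> (z k) f = 0 \<or> L2_inner \<mu> (z k) g = 0"
  shows "L2_inner \<mu> f g = 0"
proof (rule spectral_inner_eq_0[OF _ g])
  let ?K = "{k. L2_inner \<mu> (z k) f \<noteq> 0}"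
  show "f \<in> spectral ?K"
    using f by (simp add: spectral_def)
  have "g \<in> spectral (- ?K)"
    using g assms(3) by (auto simp: spectral_def)
  then show "L2_inner \<mu> p g = 0" if "p \<in> cspan (z ` ?K)" for p
    using that by (subst L2_inner_zero_commute) (rule spectral_orthogonal_span[of _ "- ?K"], simp_all)
qed

lemma L2_norm_eq_0I:
  assumes "f \<in> L2 \<mu>" "\<And>k. L2_inner \<mu> (z k) f = 0"
  shows "L2_norm \<mu> f = 0"
  using L2_inner_eq_0I[OF assms(1,1)] assms(2) by (simp add: L2_inner_self)

end

section \<open>Trigonometric polynomials and tensor products\<close>

locale unimodular_basis = prob_space \<mu> + orthonormal_basis \<mu> "eigenfun \<zeta>"
  for \<mu> :: "'a measure" and \<zeta> :: "'m::finite \<Rightarrow> 'a \<Rightarrow> complex" +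
  assumes unimodular: "cmod (\<zeta> i x) = 1"
begin

text \<open>The frequencies of functions that depend only on the angles in \<open>J\<close>;
  \<open>trig J\<close> below consists of the trigonometric polynomials in these angles.\<close>

definition freqs :: "'m set \<Rightarrow> ('m \<Rightarrow> int) set"
  where "freqs J = {k. \<forall>i. i \<notin> J \<longrightarrow> k i = 0}"

definition trig :: "'m set \<Rightarrow> ('a \<Rightarrow> complex) set"
  where "trig J = cspan (eigenfun \<zeta> ` freqs J)"

lemma zeta_nonzero: "\<zeta> i x \<noteq> 0"
  using unimodular[of i x] by auto

lemma eigenfun_add: "eigenfun \<zeta> k x * eigenfun \<zeta> l x = eigenfun \<zeta> (\<lambda>i. k i + l i) x"
  by (simp add: eigenfun_def prod.distrib power_int_add zeta_nonzero)

lemma eigenfun_cnj: "cnj (eigenfun \<zeta> k x) = eigenfun \<zeta> (\<lambda>i. - k i) x"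
  by (simp add: eigenfun_def power_int_minus power_int_inverse inverse_eq_cnj[OF unimodular, symmetric])

lemma eigenfun_zero: "eigenfun \<zeta> (\<lambda>_. 0) = (\<lambda>_. 1)"
  by (simp add: eigenfun_def)

text \<open>The constant 1 is the eigenfunction of frequency 0, so means are inner products of basis
  elements.\<close>

lemma eigenfun_mean: "(\<integral>x. eigenfun \<zeta> k x \<partial>\<mu>) = (if k = (\<lambda>_. 0) then 1 else 0)"
  using z_orthonormal[of "\<lambda>_. 0" k] by (auto simp: L2_inner_def eigenfun_zero)

lemma trig_spectral: "trig J \<subseteq> spectral (freqs J)"
  unfolding trig_def by (rule span_subset_spectral)

lemma trig_L2: "p \<in> trig J \<Longrightarrow> p \<in> L2 \<mu>"
  using trig_spectral spectral_L2 by blast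

lemma trig_measurable: "p \<in> trig J \<Longrightarrow> p \<in> borel_measurable \<mu>"
  using trig_L2 L2_measurable by blast

lemma trig_eigenfun: "k \<in> freqs J \<Longrightarrow> eigenfun \<zeta> k \<in> trig J"
  unfolding trig_def by (auto intro: cspan_superset)

lemma trig_const: "(\<lambda>_. c) \<in> trig J"
proof -
  have "eigenfun \<zeta> (\<lambda>_. 0) \<in> trig J"
    by (rule trig_eigenfun) (simp add: freqs_def)
  then show ?thesis
    using cspan_scale[of _ _ c] unfolding trig_def eigenfun_zero by fastforce
qed

lemma trig_mult:
  assumes "p \<in> trig J" "r \<in> trig J'"
  shows "(\<lambda>x. p x * r x) \<in> trig (J \<union> J')"
  using assms unfolding trig_def
proof (rule cspan_mult)
  fix p r assume "p \<in> eigenfun \<zeta> ` freqs J" "r \<in> eigenfun \<zeta> ` freqs J'"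
  then obtain k l where "k \<in> freqs J" "l \<in> freqs J'" "p = eigenfun \<zeta> k" "r = eigenfun \<zeta> l"
    by auto
  then show "(\<lambda>x. p x * r x) \<in> cspan (eigenfun \<zeta> ` freqs (J \<union> J'))"
    using trig_eigenfun[of "\<lambda>i. k i + l i" "J \<union> J'"] by (simp add: eigenfun_add freqs_def trig_def)
qed

lemma trig_cnj: "p \<in> trig J \<Longrightarrow> (\<lambda>x. cnj (p x)) \<in> trig J"
  unfolding trig_def
proof (induction rule: cspan_induct)
  case (add c p f)
  then obtain k where "k \<in> freqs J" "p = eigenfun \<zeta> k"
    by auto
  then have "(\<lambda>x. cnj (p x)) \<in> cspan (eigenfun \<zeta> ` freqs J)"
    using trig_eigenfun[of "\<lambda>i. - k i" J] by (simp add: eigenfun_cnj freqs_def trig_def)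
  then show ?case
    using add by (simp add: cspan_add cspan_scale)
qed (simp add: cspan_zero)

lemma trig_bounded: "p \<in> trig J \<Longrightarrow> \<exists>B. \<forall>x. cmod (p x) \<le> B"
  unfolding trig_def
proof (induction rule: cspan_induct)
  case (add c p f)
  then obtain B k where B: "\<And>x. cmod (f x) \<le> B" and "p = eigenfun \<zeta> k"
    by auto
  then have "cmod (c * p x + f x) \<le> cmod c + B" for x
    using norm_triangle_ineq[of "c * p x" "f x"] B[of x] by (auto simp: norm_mult norm_eigenfun unimodular intro: order_trans)
  then show ?case
    by blast
qed auto

lemma trig_integrable: "p \<in> trig J \<Longrightarrow> integrable \<mu> p"
  using trig_bounded trig_measurable by (metis integrable_const_bound AE_I2)

text \<open>Independence of the angles in \<open>J\<close> from those in \<open>J'\<close>. By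
  bilinearity it is a statement about two characters, where it says that frequencies with disjoint
  supports cannot cancel.\<close>

lemma integral_trig_mult:
  assumes p: "p \<in> trig J" and r: "r \<in> trig J'" and disj: "J \<inter> J' = {}"
  shows "(\<integral>x. p x * r x \<partial>\<mu>) = (\<integral>x. p x \<partial>\<mu>) * (\<integral>x. r x \<partial>\<mu>)"
proof -
  have int: "integrable \<mu> (\<lambda>x. p x * r x)" if "p \<in> trig J" "r \<in> trig J'" for p r
    using trig_integrable[OF trig_mult[OF that]] .
  have base: "(\<integral>x. eigenfun \<zeta> k x * r x \<partial>\<mu>) = (\<integral>x. eigenfun \<zeta> k x \<partial>\<mu>) * (\<integral>x. r x \<partial>\<mu>)"
    if k: "k \<in> freqs J" for k
    using r unfolding trig_def
  proof (induction rule: cspan_induct)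
    case (add c p f)
    then obtain l where l: "l \<in> freqs J'" "p = eigenfun \<zeta> l"
      by auto
    have "(\<lambda>i. k i + l i) = (\<lambda>_. 0) \<longleftrightarrow> k = (\<lambda>_. 0) \<and> l = (\<lambda>_. 0)"
    proof
      assume *: "(\<lambda>i. k i + l i) = (\<lambda>_. 0)"
      have "k i = 0 \<and> l i = 0" for i
        using fun_cong[OF *, of i] k l(1) disj by (cases "i \<in> J") (auto simp: freqs_def)
      then show "k = (\<lambda>_. 0) \<and> l = (\<lambda>_. 0)"
        by auto
    qed auto
    then have "(\<integral>x. eigenfun \<zeta> k x * p x \<partial>\<mu>) = (\<integral>x. eigenfun \<zeta> k x \<partial>\<mu>) * (\<integral>x. p x \<partial>\<mu>)"
      by (simp add: l eigenfun_add eigenfun_mean)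
    moreover have "f \<in> trig J'" "p \<in> trig J'"
      using add(2) l trig_eigenfun by (auto simp: trig_def)
    ultimately show ?case
      using add(3) int[OF trig_eigenfun[OF k]] trig_integrable
      by (simp add: distrib_left mult.left_commute[of _ c])
  qed simp
  show ?thesis
    using p unfolding trig_def
  proof (induction rule: cspan_induct)
    case (add c p f)
    then have "f \<in> trig J" "p \<in> trig J" "(\<integral>x. p x * r x \<partial>\<mu>) = (\<integral>x. p x \<partial>\<mu>) * (\<integral>x. r x \<partial>\<mu>)"
      using base trig_eigenfun by (auto simp: trig_def)
    then show ?case
      using add(3) int[OF _ r] trig_integrable by (simp add: distrib_right mult.assoc)
  qed simp
qed

lemma spectral_approx_trig:
  "F \<in> spectral (freqs J) \<Longrightarrow> 0 < e \<Longrightarrow> \<exists>P\<in>trig J. L2_norm \<mu> (\<lambda>x. F x - P x) < e"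
  using spectral_approx unfolding trig_def by blast

lemma L2_mult_trig:
  assumes "F \<in> L2 \<mu>" "p \<in> trig J'"
  shows "(\<lambda>x. F x * p x) \<in> L2 \<mu>"
  using trig_bounded[OF assms(2)] L2_bounded_mult[OF assms(1) trig_measurable[OF assms(2)]] by blast

text \<open>Multiplication by a bounded function is continuous in mean square, so the case of two
  polynomials passes to the limit.\<close>

lemma spectral_mult_trig:
  assumes F: "F \<in> spectral (freqs J)" and p: "p \<in> trig J'"
  shows "(\<lambda>x. F x * p x) \<in> spectral (freqs (J \<union> J'))"
proof (rule spectral_closed[OF L2_mult_trig[OF spectral_L2[OF F] p]])
  fix e :: real assume e: "0 < e"
  obtain B where B: "\<And>x. cmod (p x) \<le> B"
    using trig_bounded[OF p] by blast
  have "0 \<le> B"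
    using B norm_ge_zero order_trans by blast
  then have "0 < e / (1 + B)"
    using e by simp
  from spectral_approx_trig[OF F this] obtain P where
    P: "P \<in> trig J" "L2_norm \<mu> (\<lambda>x. F x - P x) < e / (1 + B)"
    by blast
  have "L2_norm \<mu> (\<lambda>x. F x * p x - P x * p x) = L2_norm \<mu> (\<lambda>x. (F x - P x) * p x)"
    by (simp add: left_diff_distrib)
  also have "\<dots> \<le> B * L2_norm \<mu> (\<lambda>x. F x - P x)"
    by (rule L2_norm_bounded_mult_le[OF L2_diff[OF spectral_L2[OF F] trig_L2[OF P(1)]] trig_measurable[OF p] B])
  also have "\<dots> \<le> B * (e / (1 + B))"
    using P(2) \<open>0 \<le> B\<close> by (intro mult_left_mono) auto
  also have "\<dots> < e"
    using e \<open>0 \<le> B\<close> by (simp add: field_simps)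
  finally show "\<exists>g\<in>spectral (freqs (J \<union> J')). L2_norm \<mu> (\<lambda>x. F x * p x - g x) < e"
    using trig_mult[OF P(1) p] trig_spectral by (intro bexI[of _ "\<lambda>x. P x * p x"]) auto
qed

text \<open>For a polynomial \<open>F\<close> this is independence of \<open>F\<close> and
  \<open>w\<close>. As \<open>F\<close> occurs in both slots of the inner product, the approximation
  is made in one slot at a time.\<close>

lemma spectral_weighted_norm:
  assumes F: "F \<in> spectral (freqs J)" and w: "w \<in> trig J'" and disj: "J \<inter> J' = {}"
  shows "L2_inner \<mu> F (\<lambda>x. F x * w x) = L2_inner \<mu> F F * (\<integral>x. w x \<partial>\<mu>)"
proof -
  define c where "c = (\<integral>x. w x \<partial>\<mu>)"
  have c: "(\<integral>x. cnj (w x) \<partial>\<mu>) = cnj c"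
    by (simp add: c_def)
  note w' = trig_cnj[OF w]
  note FL2 = spectral_L2[OF F]
  have inner: "L2_inner \<mu> P (\<lambda>x. Q x * w x) = L2_inner \<mu> P Q * (\<integral>x. w x \<partial>\<mu>)"
    if "P \<in> trig J" "Q \<in> trig J" "w \<in> trig J'" for P Q w
    using integral_trig_mult[OF trig_mult[OF trig_cnj[OF that(1)] that(2)] that(3)] disj
    by (simp add: L2_inner_def mult.assoc)
  \<comment> \<open>First slot: \<open>F\<close> against a polynomial \<open>P\<close>. The
    conjugates of \<open>w\<close> and \<open>c\<close> are those that arise when the multiplier is
    moved to the other slot, which is done next.\<close>
  have 1: "L2_inner \<mu> F (\<lambda>x. P x * cnj (w x) - cnj c * P x) = 0" if P: "P \<in> trig J" for P
  proof (rule spectral_inner_eq_0[OF F])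
    show "(\<lambda>x. P x * cnj (w x) - cnj c * P x) \<in> L2 \<mu>"
      by (intro L2_diff L2_scale L2_mult_trig[OF _ w'] trig_L2[OF P])
    fix Q assume "Q \<in> cspan (eigenfun \<zeta> ` freqs J)"
    then have Q: "Q \<in> trig J"
      by (simp add: trig_def)
    show "L2_inner \<mu> Q (\<lambda>x. P x * cnj (w x) - cnj c * P x) = 0"
      using inner[OF Q P w'] c
      by (simp add: L2_inner_diff_right trig_L2[OF Q] trig_L2[OF P] L2_scale L2_mult_trig[OF _ w'] L2_inner_scale_right)
  qed
  have "L2_inner \<mu> F (\<lambda>x. F x * w x - c * F x) = 0"
  proof (rule spectral_inner_eq_0[OF F])
    show "(\<lambda>x. F x * w x - c * F x) \<in> L2 \<mu>"
      by (intro L2_diff L2_scale L2_mult_trig[OF _ w] FL2)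
    fix P assume "P \<in> cspan (eigenfun \<zeta> ` freqs J)"
    then have P: "P \<in> trig J"
      by (simp add: trig_def)
    have "L2_inner \<mu> P (\<lambda>x. F x * w x - c * F x) = (\<integral>x. cnj (cnj (F x) * (P x * cnj (w x) - cnj c * P x)) \<partial>\<mu>)"
      by (simp add: L2_inner_def algebra_simps)
    also have "\<dots> = cnj (L2_inner \<mu> F (\<lambda>x. P x * cnj (w x) - cnj c * P x))"
      unfolding L2_inner_def by (rule Bochner_Integration.integral_cnj)
    finally show "L2_inner \<mu> P (\<lambda>x. F x * w x - c * F x) = 0"
      using 1[OF P] by simp
  qed
  then show ?thesis
    by (simp add: L2_inner_diff_right FL2 L2_scale L2_mult_trig[OF _ w] L2_inner_scale_right mult.commute[of _ c]
        flip: c_def)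
qed

text \<open>The weight is the squared modulus of \<open>p\<close>, again a trigonometric polynomial
  in the angles of \<open>J'\<close>.\<close>

lemma L2_norm_spectral_mult_trig:
  assumes F: "F \<in> spectral (freqs J)" and p: "p \<in> trig J'" and disj: "J \<inter> J' = {}"
  shows "L2_norm \<mu> (\<lambda>x. F x * p x) = L2_norm \<mu> F * L2_norm \<mu> p"
proof -
  have w: "(\<lambda>x. cnj (p x) * p x) \<in> trig J'"
    using trig_mult[OF trig_cnj[OF p] p] by simp
  have "of_real ((L2_norm \<mu> (\<lambda>x. F x * p x))\<^sup>2) = L2_inner \<mu> F (\<lambda>x. F x * (cnj (p x) * p x))"
    unfolding L2_inner_self[symmetric] by (simp add: L2_inner_def ac_simps)
  also have "\<dots> = L2_inner \<mu> F F * L2_inner \<mu> p p"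
    using spectral_weighted_norm[OF F w disj] by (simp add: L2_inner_def)
  also have "\<dots> = of_real ((L2_norm \<mu> F * L2_norm \<mu> p)\<^sup>2)"
    by (simp add: L2_inner_self power_mult_distrib)
  finally have "(L2_norm \<mu> (\<lambda>x. F x * p x))\<^sup>2 = (L2_norm \<mu> F * L2_norm \<mu> p)\<^sup>2"
    using of_real_eq_iff by blast
  then show ?thesis
    by (simp add: L2_norm_nonneg power2_eq_iff_nonneg)
qed

text \<open>The constant 2 is an artefact of using the parallelogram inequality instead of continuity of the
  norm. The almost everywhere convergent subsequence makes Fatou's lemma applicable.\<close>

lemma nn_integral_spectral_mult_diff_le:
  assumes F: "F \<in> spectral (freqs J)" and f: "f \<in> spectral (freqs J')" and p: "p \<in> trig J'"
    and disj: "J \<inter> J' = {}"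
  shows "(\<integral>\<^sup>+x. ennreal ((cmod (F x * (f x - p x)))\<^sup>2) \<partial>\<mu>)
    \<le> ennreal (2 * (L2_norm \<mu> F)\<^sup>2 * (L2_norm \<mu> (\<lambda>x. f x - p x))\<^sup>2)"
proof -
  define e where "e n = inverse (real (Suc n))" for n
  have e: "0 < e n" "e \<longlonglongrightarrow> 0" for n
    unfolding e_def by (simp, rule LIMSEQ_inverse_real_of_nat)
  have "\<exists>r\<in>trig J'. L2_norm \<mu> (\<lambda>x. f x - r x) < e n" for n
    using spectral_approx_trig[OF f e(1)] .
  then obtain r where r: "\<And>n. r n \<in> trig J'" "\<And>n. L2_norm \<mu> (\<lambda>x. f x - r n x) < e n"
    by metis
  define N where "N = L2_norm \<mu> (\<lambda>x. f x - p x)"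
  have L2: "(\<lambda>x. f x - r n x) \<in> L2 \<mu>" for n
    by (intro L2_diff spectral_L2[OF f] trig_L2[OF r(1)])
  note fpL2 = L2_diff[OF spectral_L2[OF f] trig_L2[OF p]]
  note [measurable] = L2_measurable[OF spectral_L2[OF F]] L2_measurable[OF spectral_L2[OF f]]
    trig_measurable[OF p] trig_measurable[OF r(1)]
  have e2: "(\<lambda>n. (e n)\<^sup>2) \<longlonglongrightarrow> 0"
    using tendsto_power[OF e(2), of 2] by simp
  have re: "(L2_norm \<mu> (\<lambda>x. f x - r n x))\<^sup>2 \<le> (e n)\<^sup>2" for n
    using r(2)[of n] by (intro power_mono) (auto simp: L2_norm_nonneg)
  have "(\<lambda>n. \<integral>x. norm ((cmod (f x - r n x))\<^sup>2) \<partial>\<mu>) \<longlonglongrightarrow> 0"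
    using re by (intro tendsto_sandwich[OF _ _ tendsto_const e2]) (auto simp: L2_norm_square)
  from tendsto_L1_AE_subseq[OF _ this] L2_square_integrable[OF L2]
  obtain s where s: "strict_mono s" "AE x in \<mu>. (\<lambda>n. (cmod (f x - r (s n) x))\<^sup>2) \<longlonglongrightarrow> 0"
    by blast
  let ?g = "\<lambda>n x. ennreal ((cmod (F x * (r (s n) x - p x)))\<^sup>2)"
  have "AE x in \<mu>. ennreal ((cmod (F x * (f x - p x)))\<^sup>2) = liminf (\<lambda>n. ?g n x)"
    using s(2)
  proof eventually_elim
    case (elim x)
    from tendsto_real_sqrt[OF elim] have "(\<lambda>n. cmod (f x - r (s n) x)) \<longlonglongrightarrow> 0"
      by simp
    then have "(\<lambda>n. f x - r (s n) x) \<longlonglongrightarrow> 0"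
      by (rule tendsto_norm_zero_cancel)
    from tendsto_diff[OF tendsto_const[of "f x"] this] have "(\<lambda>n. r (s n) x) \<longlonglongrightarrow> f x"
      by simp
    then have "(\<lambda>n. ?g n x) \<longlonglongrightarrow> ennreal ((cmod (F x * (f x - p x)))\<^sup>2)"
      by (intro tendsto_intros)
    then show ?case
      using lim_imp_Liminf[OF sequentially_bot] by metis
  qed
  then have "(\<integral>\<^sup>+x. ennreal ((cmod (F x * (f x - p x)))\<^sup>2) \<partial>\<mu>) = (\<integral>\<^sup>+x. liminf (\<lambda>n. ?g n x) \<partial>\<mu>)"
    by (rule nn_integral_cong_AE)
  also have "\<dots> \<le> liminf (\<lambda>n. \<integral>\<^sup>+x. ?g n x \<partial>\<mu>)"
    by (rule nn_integral_liminf) measurable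
  also have "\<dots> \<le> liminf (\<lambda>n. ennreal (2 * (L2_norm \<mu> F)\<^sup>2 * ((e (s n))\<^sup>2 + N\<^sup>2)))"
  proof (rule Liminf_mono, rule always_eventually, rule allI)
    fix n
    let ?d = "\<lambda>x. r (s n) x - p x"
    have d: "?d \<in> trig J'"
      using r(1) p unfolding trig_def by (rule cspan_diff)
    have "(L2_norm \<mu> ?d)\<^sup>2 \<le> (\<integral>x. 2 * (cmod (f x - r (s n) x))\<^sup>2 + 2 * (cmod (f x - p x))\<^sup>2 \<partial>\<mu>)"
      unfolding L2_norm_square
    proof (rule integral_mono)
      show "(cmod (?d x))\<^sup>2 \<le> 2 * (cmod (f x - r (s n) x))\<^sup>2 + 2 * (cmod (f x - p x))\<^sup>2" for x
        using norm_add_square_le[of "r (s n) x - f x" "f x - p x"] by (simp add: norm_minus_commute)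
    qed (use L2_square_integrable[OF trig_L2[OF d]] L2_square_integrable[OF L2] L2_square_integrable[OF fpL2] in auto)
    also have "\<dots> = 2 * (L2_norm \<mu> (\<lambda>x. f x - r (s n) x))\<^sup>2 + 2 * N\<^sup>2"
      unfolding N_def L2_norm_square
      using L2_square_integrable[OF L2] L2_square_integrable[OF fpL2] by simp
    also have "\<dots> \<le> 2 * ((e (s n))\<^sup>2 + N\<^sup>2)"
      using re[of "s n"] by simp
    finally have "(L2_norm \<mu> F)\<^sup>2 * (L2_norm \<mu> ?d)\<^sup>2 \<le> (L2_norm \<mu> F)\<^sup>2 * (2 * ((e (s n))\<^sup>2 + N\<^sup>2))"
      by (rule mult_left_mono) simp
    also have "\<dots> = 2 * (L2_norm \<mu> F)\<^sup>2 * ((e (s n))\<^sup>2 + N\<^sup>2)"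
      by simp
    finally have "ennreal ((L2_norm \<mu> F)\<^sup>2 * (L2_norm \<mu> ?d)\<^sup>2) \<le> ennreal (2 * (L2_norm \<mu> F)\<^sup>2 * ((e (s n))\<^sup>2 + N\<^sup>2))"
      by (rule ennreal_leI)
    moreover have "(\<integral>\<^sup>+x. ?g n x \<partial>\<mu>) = ennreal ((L2_norm \<mu> F)\<^sup>2 * (L2_norm \<mu> ?d)\<^sup>2)"
      using L2_nn_integral[OF L2_mult_trig[OF spectral_L2[OF F] d]]
      by (simp add: L2_norm_spectral_mult_trig[OF F d disj] power_mult_distrib)
    ultimately show "(\<integral>\<^sup>+x. ?g n x \<partial>\<mu>) \<le> ennreal (2 * (L2_norm \<mu> F)\<^sup>2 * ((e (s n))\<^sup>2 + N\<^sup>2))"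
      by simp
  qed
  also have "\<dots> = ennreal (2 * (L2_norm \<mu> F)\<^sup>2 * (0 + N\<^sup>2))"
    using LIMSEQ_subseq_LIMSEQ[OF e2 s(1)]
    by (intro lim_imp_Liminf sequentially_bot tendsto_ennrealI tendsto_intros) (simp add: comp_def)
  finally show ?thesis
    by (simp add: N_def)
qed

text \<open>Both factors may be unbounded. The preceding estimate makes multiplication by
  \<open>F\<close> continuous on functions of the other angles, so \<open>F * f\<close> is a limit
  of products \<open>F * p\<close> with polynomials \<open>p\<close>.\<close>

lemma spectral_mult:
  assumes F: "F \<in> spectral (freqs J)" and f: "f \<in> spectral (freqs J')" and disj: "J \<inter> J' = {}"
  shows "(\<lambda>x. F x * f x) \<in> spectral (freqs (J \<union> J'))"
proof -
  note [measurable] = L2_measurable[OF spectral_L2[OF F]] L2_measurable[OF spectral_L2[OF f]]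
  have diff: "(\<lambda>x. F x * (f x - p x)) \<in> L2 \<mu> \<and>
      (L2_norm \<mu> (\<lambda>x. F x * (f x - p x)))\<^sup>2 \<le> 2 * (L2_norm \<mu> F)\<^sup>2 * (L2_norm \<mu> (\<lambda>x. f x - p x))\<^sup>2"
    if p: "p \<in> trig J'" for p
  proof -
    note [measurable] = trig_measurable[OF p]
    note le = nn_integral_spectral_mult_diff_le[OF F f p disj]
    have "integrable \<mu> (\<lambda>x. (cmod (F x * (f x - p x)))\<^sup>2)"
      using le by (intro integrableI_bounded) (auto intro: le_less_trans)
    then have L2: "(\<lambda>x. F x * (f x - p x)) \<in> L2 \<mu>"
      by (simp add: L2_def)
    then show ?thesis
      using le unfolding L2_nn_integral[OF L2] by (simp add: ennreal_le_iff)
  qed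
  show ?thesis
  proof (rule spectral_closed)
    \<comment> \<open>The polynomial \<open>p = 0\<close> in \<open>diff\<close> gives
      square-integrability of the product itself.\<close>
    show "(\<lambda>x. F x * f x) \<in> L2 \<mu>"
      using diff[OF trig_const[of 0]] by simp
    fix e :: real assume e: "0 < e"
    have "0 < e / (1 + 2 * L2_norm \<mu> F)"
      using e L2_norm_nonneg[of \<mu> F] by simp
    from spectral_approx_trig[OF f this] obtain p where
      p: "p \<in> trig J'" "L2_norm \<mu> (\<lambda>x. f x - p x) < e / (1 + 2 * L2_norm \<mu> F)"
      by blast
    have "(L2_norm \<mu> (\<lambda>x. F x * (f x - p x)))\<^sup>2 \<le> (2 * L2_norm \<mu> F * L2_norm \<mu> (\<lambda>x. f x - p x))\<^sup>2"
    proof -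
      \<comment> \<open>The factor 2 is enlarged to 4, whose square root is rational.\<close>
      have "2 * ((L2_norm \<mu> F)\<^sup>2 * (L2_norm \<mu> (\<lambda>x. f x - p x))\<^sup>2) \<le>
          2\<^sup>2 * ((L2_norm \<mu> F)\<^sup>2 * (L2_norm \<mu> (\<lambda>x. f x - p x))\<^sup>2)"
        by (rule mult_right_mono) simp_all
      then show ?thesis
        using diff[OF p(1)] unfolding power_mult_distrib mult.assoc by (blast intro: order_trans)
    qed
    then have "L2_norm \<mu> (\<lambda>x. F x * (f x - p x)) \<le> 2 * L2_norm \<mu> F * L2_norm \<mu> (\<lambda>x. f x - p x)"
      by (rule power2_le_imp_le) (simp add: L2_norm_nonneg)
    also have "\<dots> \<le> 2 * L2_norm \<mu> F * (e / (1 + 2 * L2_norm \<mu> F))"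
      using p(2) by (intro mult_left_mono) (auto simp: L2_norm_nonneg)
    also have "\<dots> < e"
      using e L2_norm_nonneg[of \<mu> F] by (simp add: field_simps)
    finally show "\<exists>g\<in>spectral (freqs (J \<union> J')). L2_norm \<mu> (\<lambda>x. F x * f x - g x) < e"
      using spectral_mult_trig[OF F p(1)]
      by (intro bexI[of _ "\<lambda>x. F x * p x"]) (auto simp: right_diff_distrib)
  qed
qed

lemma spectral_prod:
  assumes "\<And>j. j \<in> J \<Longrightarrow> f j \<in> spectral (freqs {j})"
  shows "(\<lambda>x. \<Prod>j\<in>J. f j x) \<in> spectral (freqs J)"
  using finite[of J] assms
proof (induction J)
  case empty
  then show ?case
    using trig_const[of 1 "{}"] trig_spectral by auto
next
  case (insert j J)
  then show ?case
    using spectral_mult[of "f j" "{j}" "\<lambda>x. \<Prod>j\<in>J. f j x" J] by simp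
qed

section \<open>Rings generated by one eigenfunction and their tensor products\<close>

lemma eigenfun_single: "k \<in> freqs {j} \<Longrightarrow> eigenfun \<zeta> k x = \<zeta> j x powi k j"
proof -
  assume "k \<in> freqs {j}"
  then have "eigenfun \<zeta> k x = (\<Prod>i\<in>UNIV. if i = j then \<zeta> j x powi k j else 1)"
    unfolding eigenfun_def by (intro prod.cong) (auto simp: freqs_def)
  then show ?thesis
    by simp
qed

lemma generated_ring_power: "f \<in> generated_ring g \<Longrightarrow> (\<lambda>x. f x ^ n) \<in> generated_ring g"
  by (induction n) (auto intro: generated_ring.const generated_ring.mult)

lemma generated_ring_powi: "(\<lambda>x. \<zeta> j x powi n) \<in> generated_ring (\<zeta> j)"
proof (cases "0 \<le> n")
  case True
  then show ?thesis
    using generated_ring_power[OF generated_ring.gen, of "\<zeta> j" "nat n"] by (simp add: power_int_def)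
next
  case False
  then show ?thesis
    using generated_ring_power[OF generated_ring.gen_cnj, of "\<zeta> j" "nat (- n)"]
    by (simp add: power_int_def inverse_eq_cnj[OF unimodular])
qed

text \<open>The conjugate generator is the inverse of \<open>\<zeta> j\<close> and supplies the
  negative powers, so the ring consists of the Laurent polynomials in \<open>\<zeta> j\<close>
  already before closing.\<close>

lemma generated_ring_eq_trig: "generated_ring (\<zeta> j) = trig {j}"
proof
  show "trig {j} \<subseteq> generated_ring (\<zeta> j)"
    unfolding trig_def
  proof (rule cspan_subset)
    show "eigenfun \<zeta> ` freqs {j} \<subseteq> generated_ring (\<zeta> j)"
      using generated_ring_powi[of j] by (auto simp: eigenfun_single cong: image_cong)
         (metis (no_types) eigenfun_single ext)
  qed (auto intro: generated_ring.intros)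
  have gen: "\<zeta> j \<in> trig {j}"
  proof -
    let ?k = "\<lambda>i. if i = j then 1 else 0 :: int"
    have k: "?k \<in> freqs {j}"
      by (simp add: freqs_def)
    then have "eigenfun \<zeta> ?k = \<zeta> j"
      by (simp add: fun_eq_iff eigenfun_single)
    then show ?thesis
      using trig_eigenfun[OF k] by simp
  qed
  show "generated_ring (\<zeta> j) \<subseteq> trig {j}"
  proof
    fix f assume "f \<in> generated_ring (\<zeta> j)"
    then show "f \<in> trig {j}"
    proof induction
      case (mult f h)
      then show ?case
        using trig_mult[of f "{j}" h "{j}"] by simp
    next
      case (add f h)
      then show ?case
        unfolding trig_def by (simp add: cspan_add)
    qed (auto simp: trig_const gen trig_cnj[OF gen])
  qed
qed

lemma L2_subring_eq: "L2_subring \<mu> (\<zeta> j) = spectral (freqs {j})"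
  unfolding L2_subring_def
  by (rule L2_closure_eq_spectral) (use trig_spectral in \<open>auto simp: generated_ring_eq_trig trig_def\<close>)

text \<open>A character with frequencies in \<open>J\<close> is a product of characters of single
  angles, which gives one bound. The other is \<open>spectral_prod\<close>: products of arbitrary
  elements of the closed rings stay square-integrable and have frequencies in
  \<open>J\<close>.\<close>

lemma L2_tensor_eq: "L2_tensor \<mu> J (\<lambda>j. L2_subring \<mu> (\<zeta> j)) = spectral (freqs J)"
  unfolding L2_tensor_def L2_subring_eq
proof (rule L2_closure_eq_spectral)
  let ?S = "{(\<lambda>x. \<Prod>j\<in>J. f j x) |f. \<forall>j\<in>J. f j \<in> spectral (freqs {j})}"
  show "cspan (eigenfun \<zeta> ` freqs J) \<subseteq> cspan ?S"
  proof (rule cspan_mono, rule image_subsetI)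
    fix k assume k: "k \<in> freqs J"
    have "eigenfun \<zeta> (\<lambda>i. if i = j then k j else 0) = (\<lambda>x. \<zeta> j x powi k j)" for j
      using eigenfun_single[of "\<lambda>i. if i = j then k j else 0" j] by (simp add: fun_eq_iff freqs_def)
    then have "(\<lambda>x. \<zeta> j x powi k j) \<in> spectral (freqs {j})" for j
      using trig_eigenfun[of "\<lambda>i. if i = j then k j else 0" "{j}"] trig_spectral[of "{j}"] by (auto simp: freqs_def)
    moreover have "eigenfun \<zeta> k = (\<lambda>x. \<Prod>j\<in>J. \<zeta> j x powi k j)"
      using k unfolding eigenfun_def by (intro ext prod.mono_neutral_right) (auto simp: freqs_def)
    ultimately show "eigenfun \<zeta> k \<in> ?S"
      by auto
  qed
  have "cspan ?S \<subseteq> spectral (freqs J)"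
    by (rule cspan_subset) (auto simp: spectral_prod spectral_zero spectral_add spectral_scale)
  then show "cspan ?S \<inter> L2 \<mu> \<subseteq> spectral (freqs J)"
    by blast
qed

text \<open>The constants belong to every ring, so orthogonality can only hold between mean-zero
  elements: frequency 0 is the only one the two rings share.\<close>

lemma L2_subring_orthogonal:
  assumes "j \<noteq> l" "f \<in> L2_subring \<mu> (\<zeta> j)" "g \<in> L2_subring \<mu> (\<zeta> l)"
    "(\<integral>x. f x \<partial>\<mu>) = 0" "(\<integral>x. g x \<partial>\<mu>) = 0"
  shows "L2_inner \<mu> f g = 0"
proof (rule L2_inner_eq_0I)
  note fg = assms(2,3)[unfolded L2_subring_eq]
  show "f \<in> L2 \<mu>" "g \<in> L2 \<mu>"
    using fg spectral_L2 by auto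
  fix k
  show "L2_inner \<mu> (eigenfun \<zeta> k) f = 0 \<or> L2_inner \<mu> (eigenfun \<zeta> k) g = 0"
  proof (cases "k \<in> freqs {j} \<and> k \<in> freqs {l}")
    case True
    then have "k = (\<lambda>_. 0)"
      using assms(1) by (auto simp: freqs_def fun_eq_iff)
    then show ?thesis
      using assms(4) by (simp add: L2_inner_def eigenfun_zero)
  next
    case False
    then show ?thesis
      using fg by (auto simp: spectral_def)
  qed
qed

end

section \<open>Invariance of the measure\<close>

text \<open>The space carries no given metric. The continuous injection \<open>h\<close> provides
  distances from which continuous approximations to indicators of closed sets are built; by
  compactness, images of closed sets are closed.\<close>

lemma integral_eq_imp_measure_eq:
  fixes M N :: "'a::topological_space measure" and h :: "'a \<Rightarrow> 'b::metric_space"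
  assumes M: "finite_measure M" "sets M = sets borel" and N: "finite_measure N" "sets N = sets borel"
    and compact: "compact (UNIV :: 'a set)" and h: "continuous_on UNIV h" "inj h"
    and eq: "\<And>f :: 'a \<Rightarrow> real. continuous_on UNIV f \<Longrightarrow> (\<integral>x. f x \<partial>M) = (\<integral>x. f x \<partial>N)"
  shows "M = N"
proof (rule measure_eqI_generator_eq[where \<Omega> = UNIV and A = "\<lambda>_. UNIV" and E = "Collect closed"])
  show "sets M = sigma_sets UNIV (Collect closed)" "sets N = sigma_sets UNIV (Collect closed)"
    using M(2) N(2) by (simp_all add: borel_eq_closed)
  show "emeasure M X = emeasure N X" if "X \<in> Collect closed" for X
  \<comment> \<open>For empty \<open>X\<close> the distance \<open>infdist\<close> is 0 by
    convention and the approximation below would fail.\<close>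
  proof (cases "X = {}")
    case False
    have closed: "closed X"
      using that by simp
    have "compact X"
      using compact closed compact_Int_closed[of UNIV X] by simp
    then have "closed (h ` X)"
      using compact_continuous_image[OF continuous_on_subset[OF h(1)]] compact_imp_closed by blast
    \<comment> \<open>Equal to 1 on \<open>X\<close>, and 0 at a point outside as soon as
      \<open>n\<close> times its positive distance exceeds 1.\<close>
    define f where "f n x = max 0 (1 - real n * infdist (h x) (h ` X))" for n x
    have cont: "continuous_on UNIV (f n)" for n
      unfolding f_def by (intro continuous_intros h(1))
    have lim: "(\<lambda>n. f n x) \<longlonglongrightarrow> indicator X x" for x
    proof (cases "x \<in> X")
      case True
      then show ?thesis
        by (simp add: f_def)
    next
      case notin: False
      then have "h x \<notin> h ` X"
        using h(2) by (auto simp: inj_def)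
      then have pos: "0 < infdist (h x) (h ` X)"
        using \<open>closed (h ` X)\<close> False by (simp add: infdist_pos_not_in_closed)
      obtain n0 where n0: "1 < real n0 * infdist (h x) (h ` X)"
        using ex_less_of_nat_mult[OF pos] by blast
      have "f n x = 0" if "n0 \<le> n" for n
      proof -
        have "real n0 * infdist (h x) (h ` X) \<le> real n * infdist (h x) (h ` X)"
          using that pos by (intro mult_right_mono) auto
        then show ?thesis
          using n0 by (simp add: f_def)
      qed
      then have "eventually (\<lambda>n. f n x = indicator X x) sequentially"
        using notin by (auto simp: eventually_sequentially)
      then show ?thesis
        by (rule tendsto_eventually)
    qed
    have "(\<lambda>n. \<integral>x. f n x \<partial>L) \<longlonglongrightarrow> measure L X" if L: "finite_measure L" "sets L = sets borel" for L
    proof -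
      interpret L: finite_measure L by fact
      have X: "X \<in> sets L"
        using closed L(2) by simp
      have sp: "space L = UNIV"
        using sets_eq_imp_space_eq[OF L(2)] by simp
      have "(\<lambda>n. \<integral>x. f n x \<partial>L) \<longlonglongrightarrow> (\<integral>x. indicator X x \<partial>L)"
      proof (rule integral_dominated_convergence[where w = "\<lambda>_. 1"])
        show "f n \<in> borel_measurable L" for n
          using borel_measurable_continuous_onI[OF cont] measurable_cong_sets[OF L(2)] by blast
        show "AE x in L. norm (f n x) \<le> 1" for n
          by (auto simp: f_def infdist_nonneg)
      qed (use X lim in auto)
      then show ?thesis
        using X by (simp add: sp)
    qed
    from this[OF M] this[OF N] have "measure M X = measure N X"
      using eq[OF cont] LIMSEQ_unique by fastforce
    then show ?thesis
      using M(1) N(1) by (simp add: finite_measure.emeasure_eq_measure)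
  qed simp
qed (use M in \<open>auto simp: Int_stable_def finite_measure.emeasure_finite\<close>)

text \<open>In a chart, positivity of the density makes a null open set Lebesgue null, and a
  nonempty open set of a Euclidean space is not negligible.\<close>

lemma smooth_positive_density_support:
  fixes A :: "('a::topological_space, 'e::euclidean_space) chart set"
  assumes A: "smooth_atlas A" and dens: "smooth_positive_density A \<mu>" and borel: "sets \<mu> = sets borel"
    and U: "open U" "U \<noteq> {}"
  shows "emeasure \<mu> U \<noteq> 0"
proof
  assume null: "emeasure \<mu> U = 0"
  obtain a where a: "a \<in> U"
    using U by blast
  obtain c where c: "c \<in> A" "a \<in> fst c"
    using obtain_chart[OF A] .
  note ch = chart_properties[OF A c(1)]
  obtain \<rho> where \<rho>: "smooth_on (chart_image c) \<rho>" "\<And>x. x \<in> chart_image c \<Longrightarrow> 0 < \<rho> x"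
    "\<And>E. E \<in> sets borel \<Longrightarrow> E \<subseteq> chart_image c \<Longrightarrow>
      emeasure \<mu> (fst c \<inter> snd c -` E) = (\<integral>\<^sup>+x\<in>E. ennreal (\<rho> x) \<partial>lborel)"
    using dens c(1) unfolding smooth_positive_density_def by meson
  define E where "E = chart_image c \<inter> chart_inv c -` U"
  have E: "open E" "E \<subseteq> chart_image c" "snd c a \<in> E"
    using continuous_open_preimage[OF ch(4,2) U(1)] ch(5,8)[OF c(2)] a unfolding E_def by auto
  have "fst c \<inter> snd c -` E \<subseteq> U"
    using ch(5) unfolding E_def by auto
  then have "emeasure \<mu> (fst c \<inter> snd c -` E) \<le> emeasure \<mu> U"
    using U(1) borel by (intro emeasure_mono) auto
  then have "(\<integral>\<^sup>+x\<in>E. ennreal (\<rho> x) \<partial>lborel) = 0"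
    using \<rho>(3)[of E] E null by simp
  moreover have "(\<lambda>x. ennreal (\<rho> x) * indicator E x) \<in> borel_measurable lborel"
  proof -
    have "continuous_on E \<rho>"
      using smooth_on_imp_continuous_on[OF \<rho>(1)] E(2) by (rule continuous_on_subset)
    then have "(\<lambda>x. indicator E x *\<^sub>R \<rho> x) \<in> borel_measurable borel"
      using E(1) by (intro borel_measurable_continuous_on_indicator) auto
    then have "(\<lambda>x. ennreal (indicator E x *\<^sub>R \<rho> x)) \<in> borel_measurable lborel"
      by simp
    moreover have "ennreal (indicator E x *\<^sub>R \<rho> x) = ennreal (\<rho> x) * indicator E x" for x
      by (simp add: indicator_def)
    ultimately show ?thesis
      by simp
  qed
  ultimately have "AE x in lborel. ennreal (\<rho> x) * indicator E x = 0"
    by (simp add: nn_integral_0_iff_AE)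
  then have "AE x in lborel. x \<notin> E"
  proof eventually_elim
    case (elim x)
    then show ?case
      using \<rho>(2)[of x] E(2) by (auto simp: indicator_def split: if_splits)
  qed
  then have "emeasure lborel E = 0"
    using E(1) by (subst (asm) AE_iff_measurable[of E]) auto
  then have "E \<in> null_sets lborel"
    using E(1) by (simp add: null_sets_def)
  then have "negligible E"
    by (simp add: negligible_iff_null_sets null_sets_completionI)
  then show False
    using E open_not_negligible by blast
qed

locale torus_system = torus_manifold A \<zeta> + unimodular_basis \<mu> \<zeta>
  for A :: "('a::{t2_space, second_countable_topology}, 'e::euclidean_space) chart set"
    and \<zeta> :: "'m::finite \<Rightarrow> 'a \<Rightarrow> complex" and \<mu> +
  assumes compact: "compact (UNIV :: 'a set)"
    and sets_borel: "sets \<mu> = sets borel"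
    and full_support: "open U \<Longrightarrow> U \<noteq> {} \<Longrightarrow> emeasure \<mu> U \<noteq> 0"
begin

lemma continuous_measurable:
  fixes f :: "'a \<Rightarrow> 'b::topological_space"
  shows "continuous_on UNIV f \<Longrightarrow> f \<in> borel_measurable \<mu>"
  using borel_measurable_continuous_onI measurable_cong_sets[OF sets_borel] by blast

lemma smooth_L2:
  assumes f: "smooth_fun A f"
  shows "f \<in> L2 \<mu>"
proof -
  note cont = smooth_fun_continuous[OF atlas f]
  obtain B where "\<And>x. cmod (f x) \<le> B"
    using compact_imp_bounded[OF compact_continuous_image[OF cont compact]] by (auto simp: bounded_iff)
  then show ?thesis
    using L2_bounded[OF continuous_measurable[OF cont]] by blast
qed

text \<open>The set where the functions differ is open and null, hence empty. This is the passage
  from mean-square statements to pointwise ones.\<close>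

lemma AE_eq_continuous:
  fixes f g :: "'a \<Rightarrow> complex"
  assumes f: "continuous_on UNIV f" and g: "continuous_on UNIV g" and ae: "AE x in \<mu>. f x = g x"
  shows "f = g"
proof -
  have op: "open {x. f x \<noteq> g x}"
    using f g by (rule open_Collect_neq)
  then have "{x. f x \<noteq> g x} \<in> sets \<mu>"
    by (simp add: sets_borel)
  then have "emeasure \<mu> {x. f x \<noteq> g x} = 0"
    using ae by (subst (asm) AE_iff_measurable) (auto simp: sets_eq_imp_space_eq[OF sets_borel])
  then show ?thesis
    using full_support[OF op] by auto
qed

lemma trig_continuous: "p \<in> trig J \<Longrightarrow> continuous_on UNIV p"
  unfolding trig_def
proof (induction rule: cspan_induct)
  case (add c p f)
  then have "continuous_on UNIV p"
    using smooth_fun_continuous[OF atlas smooth_eigenfun] by auto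
  then show ?case
    using add by (intro continuous_intros)
qed simp

lemma trig_zeta: "\<zeta> j \<in> trig UNIV"
proof -
  have "eigenfun \<zeta> (\<lambda>i. if i = j then 1 else 0) \<in> trig UNIV"
    by (rule trig_eigenfun) (simp add: freqs_def)
  then show ?thesis
    by (simp add: eigenfun_axis)
qed

text \<open>Real functions \<open>g\<close> whose complexification lies in \<open>trig UNIV\<close>
  form a real algebra, as Stone-Weierstrass requires. Points are separated by some
  \<open>\<zeta> j\<close>, hence by its real or imaginary part.\<close>

lemma trig_uniformly_dense:
  fixes f :: "'a \<Rightarrow> real"
  assumes "continuous_on UNIV f" "0 < e"
  shows "\<exists>g. (\<lambda>x. complex_of_real (g x)) \<in> trig UNIV \<and> (\<forall>x. \<bar>f x - g x\<bar> < e)"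
proof -
  have "\<exists>g. (\<lambda>x. complex_of_real (g x)) \<in> trig UNIV \<and> (\<forall>x\<in>UNIV. \<bar>f x - g x\<bar> < e)"
  proof (rule Stone_Weierstrass_HOL[OF compact])
    show "continuous_on UNIV f" "0 < e" by fact+
    show "(\<lambda>x. complex_of_real c) \<in> trig UNIV" for c
      by (rule trig_const)
    show "continuous_on UNIV f" if "(\<lambda>x. complex_of_real (f x)) \<in> trig UNIV" for f
      using continuous_on_Re[OF trig_continuous[OF that]] by simp
    show "(\<lambda>x. complex_of_real (f x + g x)) \<in> trig UNIV"
      if "(\<lambda>x. complex_of_real (f x)) \<in> trig UNIV \<and> (\<lambda>x. complex_of_real (g x)) \<in> trig UNIV" for f g
      using that unfolding trig_def by (simp add: cspan_add)
    show "(\<lambda>x. complex_of_real (f x * g x)) \<in> trig UNIV"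
      if "(\<lambda>x. complex_of_real (f x)) \<in> trig UNIV \<and> (\<lambda>x. complex_of_real (g x)) \<in> trig UNIV" for f g
      using that trig_mult[of _ UNIV _ UNIV] by fastforce
    fix x y :: 'a assume "x \<in> UNIV \<and> y \<in> UNIV \<and> x \<noteq> y"
    then obtain j where j: "\<zeta> j x \<noteq> \<zeta> j y"
      using eq_if_zeta_eq by blast
    have "(\<lambda>x. (1/2) * (\<zeta> j x + cnj (\<zeta> j x))) \<in> trig UNIV"
      "(\<lambda>x. (-\<i>/2) * (\<zeta> j x - cnj (\<zeta> j x))) \<in> trig UNIV"
      using trig_zeta trig_cnj[OF trig_zeta] unfolding trig_def
      by (intro cspan_scale cspan_add cspan_diff; blast)+
    moreover have "(1/2) * (w + cnj w) = complex_of_real (Re w)" "(-\<i>/2) * (w - cnj w) = complex_of_real (Im w)" for w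
      by (simp_all add: complex_eq_iff)
    ultimately have "(\<lambda>x. complex_of_real (Re (\<zeta> j x))) \<in> trig UNIV" "(\<lambda>x. complex_of_real (Im (\<zeta> j x))) \<in> trig UNIV"
      by simp_all
    then show "\<exists>f. (\<lambda>x. complex_of_real (f x)) \<in> trig UNIV \<and> f x \<noteq> f y"
      using j by (cases "Re (\<zeta> j x) = Re (\<zeta> j y)") (auto simp: complex_eq_iff intro: exI[of _ "\<lambda>x. Re (\<zeta> j x)"] exI[of _ "\<lambda>x. Im (\<zeta> j x)"])
  qed
  then show ?thesis by simp
qed

lemma integral_trig_rotation:
  assumes "p \<in> trig UNIV"
  shows "(\<lambda>x. p (rotation s t x)) \<in> trig UNIV \<and> (\<integral>x. p (rotation s t x) \<partial>\<mu>) = (\<integral>x. p x \<partial>\<mu>)"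
  using assms unfolding trig_def
proof (induction rule: cspan_induct)
  case (add c p f)
  then obtain k where k: "p = eigenfun \<zeta> k"
    by auto
  have p: "(\<lambda>x. p (rotation s t x)) \<in> trig UNIV" "p \<in> trig UNIV"
    using add(1) unfolding trig_def k eigenfun_rotation by (intro cspan_scale cspan_superset; simp add: k)+
  \<comment> \<open>The rotation multiplies the character by a constant: for \<open>k = 0\<close>
    this constant is 1, and otherwise both means are 0.\<close>
  have "(\<integral>x. p (rotation s t x) \<partial>\<mu>) = (\<integral>x. p x \<partial>\<mu>)"
    by (simp add: k eigenfun_rotation eigenfun_mean)
  moreover have f: "(\<lambda>x. f (rotation s t x)) \<in> trig UNIV" "f \<in> trig UNIV"
    using add unfolding trig_def by auto
  ultimately have "(\<integral>x. c * p (rotation s t x) + f (rotation s t x) \<partial>\<mu>) = (\<integral>x. c * p x + f x \<partial>\<mu>)"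
    using add(3) trig_integrable[OF p(1)] trig_integrable[OF p(2)] trig_integrable[OF f(1)] trig_integrable[OF f(2)]
    by simp
  moreover have "(\<lambda>x. c * p (rotation s t x) + f (rotation s t x)) \<in> trig UNIV"
    using p(1) f(1) unfolding trig_def by (intro cspan_add cspan_scale)
  ultimately show ?case
    unfolding trig_def by blast
qed (simp add: cspan_zero)

lemma rotation_measurable: "rotation s t \<in> measurable \<mu> \<mu>"
  using borel_measurable_continuous_onI[OF continuous_rotation] measurable_cong_sets[OF sets_borel sets_borel] by blast

lemma continuous_integrable:
  fixes f :: "'a \<Rightarrow> real"
  assumes "continuous_on UNIV f"
  shows "integrable \<mu> f"
proof -
  obtain B where "\<And>x. norm (f x) \<le> B"
    using compact_imp_bounded[OF compact_continuous_image[OF assms compact]] by (auto simp: bounded_iff)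
  then show ?thesis
    using continuous_measurable[OF assms] by (intro integrable_const_bound[where B = B]) auto
qed

lemma integral_continuous_rotation:
  fixes f :: "'a \<Rightarrow> real"
  assumes f: "continuous_on UNIV f"
  shows "(\<integral>x. f (rotation s t x) \<partial>\<mu>) = (\<integral>x. f x \<partial>\<mu>)"
proof -
  let ?R = "rotation s t"
  have comp: "continuous_on UNIV (\<lambda>x. g (?R x))" if "continuous_on UNIV g" for g :: "'a \<Rightarrow> real"
    using continuous_on_compose2[OF that continuous_rotation] by auto
  \<comment> \<open>\<open>f\<close> is replaced by a polynomial under both integrals, each time
    with an error of at most \<open>e\<close>.\<close>
  have "\<bar>(\<integral>x. f (?R x) \<partial>\<mu>) - (\<integral>x. f x \<partial>\<mu>)\<bar> \<le> 2 * e" if e: "0 < e" for e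
  proof -
    obtain g where g: "(\<lambda>x. complex_of_real (g x)) \<in> trig UNIV" "\<And>x. \<bar>f x - g x\<bar> < e"
      using trig_uniformly_dense[OF f e] by blast
    have cg: "continuous_on UNIV g"
      using continuous_on_Re[OF trig_continuous[OF g(1)]] by simp
    have "(\<integral>x. complex_of_real (g (?R x)) \<partial>\<mu>) = (\<integral>x. complex_of_real (g x) \<partial>\<mu>)"
      using integral_trig_rotation[OF g(1)] by blast
    then have geq: "(\<integral>x. g (?R x) \<partial>\<mu>) = (\<integral>x. g x \<partial>\<mu>)"
      by simp
    have bound: "\<bar>\<integral>x. f (h x) - g (h x) \<partial>\<mu>\<bar> \<le> e" if "integrable \<mu> (\<lambda>x. f (h x) - g (h x))" for h
    proof -
      have "\<bar>\<integral>x. f (h x) - g (h x) \<partial>\<mu>\<bar> \<le> (\<integral>x. \<bar>f (h x) - g (h x)\<bar> \<partial>\<mu>)"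
        by (rule integral_abs_bound)
      also have "\<dots> \<le> e"
        using g(2) less_imp_le that by (intro integral_le_const) auto
      finally show ?thesis .
    qed
    show ?thesis
      using bound[of ?R] bound[of "\<lambda>x. x"] geq
        continuous_integrable[OF f] continuous_integrable[OF cg] continuous_integrable[OF comp[OF f]] continuous_integrable[OF comp[OF cg]]
      by simp
  qed
  from this[of "e / 2" for e] have "\<bar>(\<integral>x. f (?R x) \<partial>\<mu>) - (\<integral>x. f x \<partial>\<mu>)\<bar> \<le> 0 + e" if "0 < e" for e
    using that by simp
  then have "\<bar>(\<integral>x. f (?R x) \<partial>\<mu>) - (\<integral>x. f x \<partial>\<mu>)\<bar> \<le> 0"
    by (rule field_le_epsilon)
  then show ?thesis by simp
qed

lemma distr_rotation: "distr \<mu> \<mu> (rotation s t) = \<mu>"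
proof (rule integral_eq_imp_measure_eq[where h = "torus_map \<zeta>"])
  show "finite_measure (distr \<mu> \<mu> (rotation s t))"
    by (rule finite_measure_distr[OF rotation_measurable])
  show "finite_measure \<mu>"
    by (rule finite_measure_axioms)
  show "sets (distr \<mu> \<mu> (rotation s t)) = sets borel" "sets \<mu> = sets borel"
    by (simp_all add: sets_borel)
  show "compact (UNIV :: 'a set)"
    by (rule compact)
  show "continuous_on UNIV (torus_map \<zeta>)"
    unfolding torus_map_def[abs_def] by (intro continuous_intros smooth_fun_continuous[OF atlas smooth])
  show "inj (torus_map \<zeta>)"
    using bij_torus_map by (simp add: bij_betw_def)
  show "(\<integral>x. f x \<partial>distr \<mu> \<mu> (rotation s t)) = (\<integral>x. f x \<partial>\<mu>)" if "continuous_on UNIV f" for f :: "'a \<Rightarrow> real"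
    using integral_distr[OF rotation_measurable continuous_measurable[OF that]] integral_continuous_rotation[OF that]
    by simp
qed

lemma preserves_measure_rotation: "preserves_measure \<mu> (rotation s t)"
  by (simp add: preserves_measure_def rotation_measurable distr_rotation)

lemma integral_rotation:
  fixes f :: "'a \<Rightarrow> 'b::{banach, second_countable_topology}"
  assumes "f \<in> borel_measurable \<mu>"
  shows "(\<integral>x. f (rotation s t x) \<partial>\<mu>) = (\<integral>x. f x \<partial>\<mu>)"
  using integral_distr[OF rotation_measurable assms, of s t] by (simp add: distr_rotation)

section \<open>The kernels of the generators\<close>

lemma L2_rotation:
  assumes f: "f \<in> L2 \<mu>"
  shows "(\<lambda>x. f (rotation s t x)) \<in> L2 \<mu>"
proof -
  have "integrable (distr \<mu> \<mu> (rotation s t)) (\<lambda>x. (cmod (f x))\<^sup>2)"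
    using L2_square_integrable[OF f] by (simp add: distr_rotation)
  from integrable_distr[OF rotation_measurable this] show ?thesis
    using measurable_compose[OF rotation_measurable L2_measurable[OF f]] by (simp add: L2_def)
qed

lemma L2_inner_eigenfun_rotation:
  assumes f: "f \<in> L2 \<mu>"
  shows "L2_inner \<mu> (eigenfun \<zeta> k) (\<lambda>x. f (rotation s t x)) =
    cis (t * (\<Sum>j\<in>UNIV. of_int (k j) * s $ j)) * L2_inner \<mu> (eigenfun \<zeta> k) f"
proof -
  define r where "r = t * (\<Sum>j\<in>UNIV. of_int (k j) * s $ j)"
  \<comment> \<open>Writing the unrotated character as \<open>cnj (cis r)\<close> times the rotated
    one puts the whole integrand at the rotated point, where invariance of the measure
    applies.\<close>
  have "cnj (eigenfun \<zeta> k x) * f (rotation s t x) =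
      cis r * (cnj (eigenfun \<zeta> k (rotation s t x)) * f (rotation s t x))" for x
    by (simp add: eigenfun_rotation cis_cnj cis_mult flip: r_def mult.assoc)
  then have "L2_inner \<mu> (eigenfun \<zeta> k) (\<lambda>x. f (rotation s t x)) =
      cis r * (\<integral>x. cnj (eigenfun \<zeta> k (rotation s t x)) * f (rotation s t x) \<partial>\<mu>)"
    unfolding L2_inner_def by (simp only: integral_mult_right_zero)
  also have "(\<integral>x. cnj (eigenfun \<zeta> k (rotation s t x)) * f (rotation s t x) \<partial>\<mu>) = L2_inner \<mu> (eigenfun \<zeta> k) f"
    unfolding L2_inner_def
    using L2_measurable[OF L2_cnj[OF z_L2]] L2_measurable[OF f] by (intro integral_rotation) measurable
  finally show ?thesis
    by (simp add: r_def)
qed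

lemma spectral_rotation_invariant:
  assumes f: "f \<in> spectral {k. (\<Sum>j\<in>UNIV. of_int (k j) * s $ j) = 0}"
  shows "L2_norm \<mu> (\<lambda>x. f (rotation s t x) - f x) = 0"
proof (rule L2_norm_eq_0I)
  note L2 = spectral_L2[OF f]
  show "(\<lambda>x. f (rotation s t x) - f x) \<in> L2 \<mu>"
    by (intro L2_diff L2_rotation L2)
  show "L2_inner \<mu> (eigenfun \<zeta> k) (\<lambda>x. f (rotation s t x) - f x) = 0" for k
  proof (cases "(\<Sum>j\<in>UNIV. of_int (k j) * s $ j) = 0")
    case True
    then show ?thesis
      by (simp add: L2_inner_diff_right z_L2 L2_rotation L2 L2_inner_eigenfun_rotation)
  next
    case False
    then have "L2_inner \<mu> (eigenfun \<zeta> k) f = 0"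
      using f by (simp add: spectral_def)
    then show ?thesis
      by (simp add: L2_inner_diff_right z_L2 L2_rotation L2 L2_inner_eigenfun_rotation)
  qed
qed

text \<open>The generator acts on the coefficient of frequency \<open>k\<close> as multiplication by
  \<i> times the pairing of \<open>k\<close> with \<open>s\<close>, so a kernel element has no
  coefficient where this pairing is nonzero. Conversely, a function with the remaining frequencies
  is invariant under the rotations, up to null sets.\<close>

lemma koopman_kernel:
  "{f. koopman_generator \<mu> (rotation s) f (\<lambda>_. 0)} = spectral {k. (\<Sum>j\<in>UNIV. of_int (k j) * s $ j) = 0}"
proof (intro set_eqI iffI)
  fix f assume "f \<in> {f. koopman_generator \<mu> (rotation s) f (\<lambda>_. 0)}"
  then have L2: "f \<in> L2 \<mu>"
    and lim: "((\<lambda>t. L2_norm \<mu> (\<lambda>x. (f (rotation s t x) - f x) / of_real t - 0)) \<longlongrightarrow> 0) (at 0)"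
    by (auto simp: koopman_generator_def)
  have "L2_inner \<mu> (eigenfun \<zeta> k) f = 0" if nz: "(\<Sum>j\<in>UNIV. of_int (k j) * s $ j) \<noteq> 0" for k
  proof -
    define r where "r = (\<Sum>j\<in>UNIV. of_int (k j) * s $ j)"
    let ?a = "L2_inner \<mu> (eigenfun \<zeta> k) f"
    have diff: "(\<lambda>x. f (rotation s t x) - f x) \<in> L2 \<mu>" for t
      by (intro L2_diff L2_rotation L2)
    \<comment> \<open>At \<open>t = 0\<close> both sides are 0, since division by zero gives
      0.\<close>
    have "cmod ((cis (t * r) - 1) / of_real t * ?a) \<le> L2_norm \<mu> (\<lambda>x. (f (rotation s t x) - f x) / of_real t - 0)" for t
    proof -
      have "L2_inner \<mu> (eigenfun \<zeta> k) (\<lambda>x. (1 / of_real t) * (f (rotation s t x) - f x)) = (cis (t * r) - 1) / of_real t * ?a"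
        by (simp only: L2_inner_scale_right L2_inner_diff_right z_L2 L2_rotation L2 L2_inner_eigenfun_rotation r_def)
          (simp add: left_diff_distrib diff_divide_distrib)
      then show ?thesis
        using L2_Cauchy_Schwarz[OF z_L2 L2_scale[OF diff], of k "1 / of_real t" t] by (simp add: z_norm)
    qed
    then have "((\<lambda>t. (cis (t * r) - 1) / of_real t * ?a) \<longlongrightarrow> 0) (at 0)"
      by (intro Lim_null_comparison[OF _ lim] always_eventually) simp
    moreover have "((\<lambda>t. (cis (t * r) - 1) / of_real t * ?a) \<longlongrightarrow> \<i> * of_real r * ?a) (at 0)"
      by (intro tendsto_mult_right cis_difference_quotient)
    ultimately have "\<i> * of_real r * ?a = 0"
      using tendsto_unique[OF at_neq_bot] by blast
    then show ?thesis
      using nz by (simp only: r_def[symmetric]) simp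
  qed
  then show "f \<in> spectral {k. (\<Sum>j\<in>UNIV. of_int (k j) * s $ j) = 0}"
    using L2 by (simp add: spectral_def)
next
  fix f assume f: "f \<in> spectral {k. (\<Sum>j\<in>UNIV. of_int (k j) * s $ j) = 0}"
  have "L2_norm \<mu> (\<lambda>x. (f (rotation s t x) - f x) / of_real t - 0) = 0" for t
    using L2_norm_scale[of \<mu> "1 / of_real t" "\<lambda>x. f (rotation s t x) - f x"] spectral_rotation_invariant[OF f]
    by simp
  then show "f \<in> {f. koopman_generator \<mu> (rotation s) f (\<lambda>_. 0)}"
    using spectral_L2[OF f] by (simp add: koopman_generator_def L2_zero)
qed

text \<open>A smooth function with zero derivative is constant along orbits, hence in the kernel of
  the Koopman generator. Conversely, invariance almost everywhere becomes invariance everywhere by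
  continuity and full support, and the derivative along orbits vanishes.\<close>

lemma smooth_kernel:
  "{f. smooth_fun A f \<and> (\<forall>a. vf_complex (constant_field s) f a = 0)} =
   {f. smooth_fun A f} \<inter> spectral {k. (\<Sum>j\<in>UNIV. of_int (k j) * s $ j) = 0}"
proof (intro set_eqI iffI)
  fix f assume "f \<in> {f. smooth_fun A f \<and> (\<forall>a. vf_complex (constant_field s) f a = 0)}"
  then have f: "smooth_fun A f" and zero: "\<And>a. vf_complex (constant_field s) f a = 0"
    by auto
  have const: "g (rotation s t a) = g a" if "smooth_fun A g" "\<And>a. constant_field s a g = 0" for g t a
  proof -
    have "\<forall>t. ((\<lambda>t. g (rotation s t a)) has_real_derivative 0) (at t)"
      using DERIV_rotation[OF that(1)] that(2) by metis
    from DERIV_isconst_all[OF this, of t 0] show ?thesis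
      by simp
  qed
  have "f (rotation s t a) = f a" for t a
    using const[OF smooth_fun_Re[OF atlas f]] const[OF smooth_fun_Im[OF atlas f]] zero
    by (simp add: vf_complex_def complex_eq_iff)
  then have "koopman_generator \<mu> (rotation s) f (\<lambda>_. 0)"
    by (simp add: koopman_generator_def smooth_L2[OF f] L2_zero L2_norm_def)
  then show "f \<in> {f. smooth_fun A f} \<inter> spectral {k. (\<Sum>j\<in>UNIV. of_int (k j) * s $ j) = 0}"
    using f koopman_kernel by blast
next
  fix f assume "f \<in> {f. smooth_fun A f} \<inter> spectral {k. (\<Sum>j\<in>UNIV. of_int (k j) * s $ j) = 0}"
  then have f: "smooth_fun A f" and spec: "f \<in> spectral {k. (\<Sum>j\<in>UNIV. of_int (k j) * s $ j) = 0}"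
    by auto
  have inv: "f (rotation s t a) = f a" for t a
  proof -
    have "AE x in \<mu>. f (rotation s t x) - f x = 0"
      by (intro L2_norm_eq_0_imp_AE spectral_rotation_invariant[OF spec] L2_diff L2_rotation smooth_L2[OF f])
    then have "AE x in \<mu>. f (rotation s t x) = f x"
      by simp
    from AE_eq_continuous[OF _ _ this] show ?thesis
      using smooth_fun_continuous[OF atlas f] smooth_fun_continuous[OF atlas smooth_fun_rotation[OF f]] by metis
  qed
  have "vf_complex (constant_field s) f a = 0" for a
  proof -
    have "constant_field s a (\<lambda>a. Re (f a)) = 0"
      by (rule constant_field_eqI[OF smooth_fun_Re[OF atlas f]]) (simp add: inv)
    moreover have "constant_field s a (\<lambda>a. Im (f a)) = 0"
      by (rule constant_field_eqI[OF smooth_fun_Im[OF atlas f]]) (simp add: inv)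
    ultimately show ?thesis
      by (simp add: vf_complex_def complex_eq_iff)
  qed
  then show "f \<in> {f. smooth_fun A f \<and> (\<forall>a. vf_complex (constant_field s) f a = 0)}"
    using f by blast
qed

section \<open>The full dynamics\<close>

text \<open>The difference quotients of a smooth function along the flow converge pointwise to its derivative
  along \<^term>\<open>v\<close> and, by assumption, in mean square to the value of the Koopman generator; Fatou's
  lemma identifies the limits.\<close>

lemma koopman_eigenfunction_pointwise:
  assumes v: "smooth_vector_field A v" and flow: "generates_flow A v \<Phi>"
    and meas: "\<And>t. \<Phi> t \<in> measurable \<mu> \<mu>" and f: "smooth_fun A f"
    and gen: "koopman_generator \<mu> \<Phi> f (\<lambda>x. w * f x)"
  shows "vf_complex v f a = w * f a"
proof -
  \<comment> \<open>Fatou's lemma concerns sequences, so the limit at time 0 is sampled along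
    \<open>e\<close>.\<close>
  define e where "e n = inverse (real (Suc n))" for n
  have e: "e n \<noteq> 0" "e \<longlonglongrightarrow> 0" for n
    unfolding e_def by (simp, rule LIMSEQ_inverse_real_of_nat)
  then have e_at: "filterlim e (at 0) sequentially"
    by (simp add: filterlim_at)
  define h where "h n x = (f (\<Phi> (e n) x) - f x) / of_real (e n) - w * f x" for n x
  note cont = smooth_fun_continuous[OF atlas f]
  note [measurable] = continuous_measurable[OF cont] meas
  have "(\<lambda>n. L2_norm \<mu> (h n)) \<longlonglongrightarrow> 0"
    using filterlim_compose[OF _ e_at] gen unfolding koopman_generator_def h_def by blast
  from tendsto_power[OF this, of 2] have hlim: "(\<lambda>n. (L2_norm \<mu> (h n))\<^sup>2) \<longlonglongrightarrow> 0"
    by simp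
  obtain B where B: "\<And>x. cmod (f x) \<le> B"
    using compact_imp_bounded[OF compact_continuous_image[OF cont compact]] by (auto simp: bounded_iff)
  have fPhi: "(\<lambda>x. f (\<Phi> t x)) \<in> L2 \<mu>" for t
    by (rule L2_bounded[OF _ B]) measurable
  have hL2: "h n \<in> L2 \<mu>" for n
    using L2_diff[OF L2_scale[OF L2_diff[OF fPhi smooth_L2[OF f]]] L2_scale[OF smooth_L2[OF f]], of "1 / of_real (e n)" "e n" w]
    by (simp add: h_def[abs_def])
  let ?g = "\<lambda>x. vf_complex v f x - w * f x"
  have vcont: "continuous_on UNIV (vf_complex v f)"
  proof -
    have "continuous_on UNIV (\<lambda>a. v a (\<lambda>x. Re (f x)))" "continuous_on UNIV (\<lambda>a. v a (\<lambda>x. Im (f x)))"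
      using v smooth_fun_Re[OF atlas f] smooth_fun_Im[OF atlas f] smooth_fun_continuous[OF atlas]
      unfolding smooth_vector_field_def by blast+
    then show ?thesis
      unfolding vf_complex_def[abs_def] Complex_eq by (intro continuous_intros)
  qed
  note [measurable] = continuous_measurable[OF vcont]
  have "(\<lambda>n. h n x) \<longlonglongrightarrow> ?g x" for x
  proof -
    have "((\<lambda>t. Complex ((Re (f (\<Phi> t x)) - Re (f x)) / t) ((Im (f (\<Phi> t x)) - Im (f x)) / t)) \<longlongrightarrow> vf_complex v f x) (at 0)"
      using flow smooth_fun_Re[OF atlas f] smooth_fun_Im[OF atlas f] unfolding generates_flow_def vf_complex_def
      by (intro tendsto_Complex) auto
    moreover have "Complex ((Re (f (\<Phi> t x)) - Re (f x)) / t) ((Im (f (\<Phi> t x)) - Im (f x)) / t) = (f (\<Phi> t x) - f x) / of_real t" for t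
      by (simp add: complex_eq_iff)
    ultimately have "((\<lambda>t. (f (\<Phi> t x) - f x) / of_real t) \<longlongrightarrow> vf_complex v f x) (at 0)"
      by simp
    from filterlim_compose[OF this e_at] show ?thesis
      unfolding h_def by (intro tendsto_intros)
  qed
  then have "ennreal ((cmod (?g x))\<^sup>2) = liminf (\<lambda>n. ennreal ((cmod (h n x))\<^sup>2))" for x
    by (intro lim_imp_Liminf[symmetric] sequentially_bot tendsto_intros)
  then have "(\<integral>\<^sup>+x. ennreal ((cmod (?g x))\<^sup>2) \<partial>\<mu>) = (\<integral>\<^sup>+x. liminf (\<lambda>n. ennreal ((cmod (h n x))\<^sup>2)) \<partial>\<mu>)"
    by simp
  also have "\<dots> \<le> liminf (\<lambda>n. \<integral>\<^sup>+x. ennreal ((cmod (h n x))\<^sup>2) \<partial>\<mu>)"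
    using L2_measurable[OF hL2] by (intro nn_integral_liminf) measurable
  also have "\<dots> = liminf (\<lambda>n. ennreal ((L2_norm \<mu> (h n))\<^sup>2))"
    by (simp add: L2_nn_integral[OF hL2])
  also have "\<dots> = ennreal 0"
    by (intro lim_imp_Liminf sequentially_bot tendsto_ennrealI hlim)
  finally have "(\<integral>\<^sup>+x. ennreal ((cmod (?g x))\<^sup>2) \<partial>\<mu>) = 0"
    by simp
  then have "AE x in \<mu>. ennreal ((cmod (?g x))\<^sup>2) = 0"
    by (subst (asm) nn_integral_0_iff_AE) auto
  then have "AE x in \<mu>. vf_complex v f x = w * f x"
    by eventually_elim simp
  \<comment> \<open>Smoothness of the vector field makes its action on \<open>f\<close> continuous,
    so equality almost everywhere holds at the given point.\<close>
  from AE_eq_continuous[OF vcont _ this] show ?thesis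
    using cont by (metis continuous_on_mult_left)
qed

text \<open>The pointwise eigenvalue equations identify the flow as a rotation; the field is then
  recovered as the limit of difference quotients along this flow. Off the smooth functions both
  fields are 0.\<close>

lemma vector_field_eq_constant_field:
  assumes v: "smooth_vector_field A v" and flow: "generates_flow A v \<Phi>"
    and meas: "\<And>t. \<Phi> t \<in> measurable \<mu> \<mu>"
    and gen: "\<And>j. koopman_generator \<mu> \<Phi> (\<zeta> j) (\<lambda>x. \<i> * of_real (s $ j) * \<zeta> j x)"
  shows "v = constant_field s"
proof (intro ext)
  fix a f
  have \<Phi>: "\<Phi> = rotation s"
    by (rule generates_flow_eq_rotation[OF flow koopman_eigenfunction_pointwise[OF v flow meas smooth gen]])
  show "v a f = constant_field s a f"
  proof (cases "smooth_fun A f")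
    case True
    have "((\<lambda>t. (f (rotation s t a) - f a) / t) \<longlongrightarrow> v a f) (at 0)"
      "((\<lambda>t. (f (rotation s t a) - f a) / t) \<longlongrightarrow> constant_field s a f) (at 0)"
      using flow generates_rotation True unfolding generates_flow_def \<Phi> by blast+
    then show ?thesis
      by (rule tendsto_unique[OF at_neq_bot])
  next
    case False
    then show ?thesis
      using v by (simp add: smooth_vector_field_def tangent_space_def constant_field_def)
  qed
qed

end

section \<open>Specialization to directions along the coordinate axes\<close>

lemma rationally_independent_nonzero:
  assumes "rationally_independent \<Omega>"
  shows "\<Omega> i \<noteq> 0"
proof
  assume "\<Omega> i = 0"
  then have "(\<Sum>j\<in>UNIV. of_rat (if j = i then 1 else 0) * \<Omega> j) = 0"
    by (intro sum.neutral) auto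
  then have "(if i = i then 1 else 0 :: rat) = 0"
    using assms unfolding rationally_independent_def by (metis (mono_tags))
  then show False by simp
qed

theorem theorem5:
  fixes A :: "('a::{t2_space, second_countable_topology}, real^'m) chart set"
    and \<mu> :: "'a measure"
    and \<Phi> :: "real \<Rightarrow> 'a \<Rightarrow> 'a"
    and v :: "'a vfield"
    and T :: real
    and \<Omega> :: "'m \<Rightarrow> real"
    and \<zeta> :: "'m \<Rightarrow> 'a \<Rightarrow> complex"
    and V :: "'m \<Rightarrow> 'a vfield"
    and \<Psi> :: "'m \<Rightarrow> real \<Rightarrow> 'a \<Rightarrow> 'a"
    and Z :: "'m \<Rightarrow> ('a \<Rightarrow> complex) set"
  assumes manifold: "closed_orientable_manifold A"
    and vector_field: "smooth_vector_field A v"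
    and flow: "generates_flow A v \<Phi>"
    and prob: "prob_space \<mu>"
    and borel: "sets \<mu> = sets borel"
    and density: "smooth_positive_density A \<mu>"
    and invariant: "\<And>t. preserves_measure \<mu> (\<Phi> t)"
    and sampling: "0 < T"
    and ergodic: "ergodic_sampling \<mu> \<Phi> T"
    and frequencies: "rationally_independent \<Omega>"
    and eigenfunctions: "\<And>i. koopman_generator \<mu> \<Phi> (\<zeta> i) (\<lambda>x. \<i> * of_real (\<Omega> i) * \<zeta> i x)"
    and normalized: "\<And>i x. cmod (\<zeta> i x) = 1"
    and pure_point: "L2_orthonormal_basis \<mu> (eigenfun \<zeta>)"
    and smooth: "\<And>i. smooth_fun A (\<zeta> i)"
    and diffeomorphism: "diffeomorphism_onto A torus (torus_map \<zeta>)"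
    and V: "\<And>i. V i = (\<lambda>a f. \<Omega> i * angle_field A \<zeta> i a f)"
    and \<Psi>: "\<And>i. \<Psi> i = flow_of A (V i)"
    and Z: "\<And>j. Z j = L2_subring \<mu> (\<zeta> j)"
  shows
    \<comment> \<open>the \<open>v\<^sub>i\<close> are smooth vector fields, and they generate unique flows\<close>
    "(\<forall>i. smooth_vector_field A (V i)) \<and> (\<forall>i. \<exists>!\<Theta>. generates_flow A (V i) \<Theta>) \<and>
    \<comment> \<open>(i)\<close>
     (\<forall>i k. vf_eigenfunction A (V i) (\<i> * of_int (k i) * of_real (\<Omega> i)) (eigenfun \<zeta> k)) \<and>
     (\<forall>j l f g. j \<noteq> l \<longrightarrow> f \<in> Z j \<longrightarrow> g \<in> Z l \<longrightarrow> (\<integral>x. f x \<partial>\<mu>) = 0 \<longrightarrow> (\<integral>x. g x \<partial>\<mu>) = 0 \<longrightarrow>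
        L2_inner \<mu> f g = 0) \<and>
     (\<forall>i. {f. koopman_generator \<mu> (\<Psi> i) f (\<lambda>_. 0)} = L2_tensor \<mu> (UNIV - {i}) Z) \<and>
     (\<forall>i. {f. smooth_fun A f \<and> (\<forall>a. vf_complex (V i) f a = 0)}
          = {f. smooth_fun A f} \<inter> L2_tensor \<mu> (UNIV - {i}) Z) \<and>
    \<comment> \<open>(ii)\<close>
     (\<forall>i a. V i a \<noteq> (\<lambda>_. 0)) \<and>
     (\<forall>a c. (\<lambda>f. \<Sum>i\<in>UNIV. c i * V i a f) = (\<lambda>_. 0) \<longrightarrow> (\<forall>i. c i = 0)) \<and>
     (\<forall>i j. commutator (V i) (V j) = (\<lambda>_ _. 0)) \<and>
    \<comment> \<open>(iii)\<close>
     (\<forall>i t. preserves_measure \<mu> (\<Psi> i t)) \<and>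
    \<comment> \<open>(iv)\<close>
     (\<forall>i j t a b u. b = \<Psi> j t a \<longrightarrow> u = pushforward A (\<Psi> j t) (V i a) \<longrightarrow>
        u \<in> tangent_space A b \<and> (\<forall>f. smooth_fun A f \<longrightarrow> u f = V i b f)) \<and>
    \<comment> \<open>(v)\<close>
     v = (\<lambda>a f. \<Sum>i\<in>UNIV. V i a f)"
proof -
  have atlas: "smooth_atlas A" and compact: "compact (UNIV :: 'a set)"
    using manifold by (auto simp: closed_orientable_manifold_def)
  interpret prob_space \<mu> by fact
  interpret torus_system A \<zeta> \<mu>
  proof
    show "emeasure \<mu> U \<noteq> 0" if "open U" "U \<noteq> {}" for U
      by (rule smooth_positive_density_support[OF atlas density borel that])
  qed (use atlas normalized smooth diffeomorphism pure_point compact borel in blast)+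
  have nonzero: "\<Omega> i \<noteq> 0" for i
    using frequencies by (rule rationally_independent_nonzero)
  have V_eq: "V i = constant_field (axis i (\<Omega> i))" for i
    by (simp add: V scaled_angle_field)
  have flow_unique: "generates_flow A (V i) \<Theta> \<longleftrightarrow> \<Theta> = rotation (axis i (\<Omega> i))" for i \<Theta>
    by (simp add: V_eq generates_flow_constant_field)
  \<comment> \<open>Existence and uniqueness in \<open>flow_unique\<close> give the definite
    description in \<open>flow_of\<close> its value.\<close>
  have \<Psi>_eq: "\<Psi> i = rotation (axis i (\<Omega> i))" for i
    by (simp add: \<Psi> flow_of_def flow_unique)
  have freq: "(\<Sum>j\<in>UNIV. of_int (k j) * axis i (\<Omega> i) $ j) = of_int (k i) * \<Omega> i" for i and k :: "'m \<Rightarrow> int"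
    by (simp add: axis_def if_distrib cong: if_cong)
  have freqs: "{k. (\<Sum>j\<in>UNIV. of_int (k j) * axis i (\<Omega> i) $ j) = 0} = freqs (UNIV - {i})" for i
    unfolding freq by (auto simp: freqs_def nonzero)
  have Z_eq: "Z = (\<lambda>j. L2_subring \<mu> (\<zeta> j))"
    by (simp add: Z fun_eq_iff)
  have V_zeta: "vf_complex (V i) (\<zeta> j) a = (if i = j then \<i> * of_real (\<Omega> i) * \<zeta> j a else 0)" for i j a
    by (simp add: V_eq constant_field_zeta axis_def)
  \<comment> \<open>Only \<open>V i\<close> acts nontrivially on \<open>\<zeta> i\<close>, so the
    relation applied to the real and imaginary parts of \<open>\<zeta> i\<close> isolates the
    coefficient \<open>c i\<close>.\<close>
  have independent: "c i = 0" if "(\<lambda>f. \<Sum>i\<in>UNIV. c i * V i a f) = (\<lambda>_. 0)" for a and c :: "'m \<Rightarrow> real" and i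
  proof -
    have 0: "(\<Sum>j\<in>UNIV. c j * V j a f) = 0" for f
      using fun_cong[OF that, of f] by simp
    have "(\<Sum>j\<in>UNIV. of_real (c j) * vf_complex (V j) (\<zeta> i) a) = 0"
      using 0[of "\<lambda>x. Re (\<zeta> i x)"] 0[of "\<lambda>x. Im (\<zeta> i x)"] by (simp add: complex_eq_iff vf_complex_def)
    then have "of_real (c i) * (\<i> * of_real (\<Omega> i) * \<zeta> i a) = 0"
      by (simp add: V_zeta if_distrib cong: if_cong)
    then show ?thesis
      using nonzero zeta_nonzero by simp
  qed
  have nonvanishing: "V i a \<noteq> (\<lambda>_. 0)" for i a
    using V_zeta[of i i a] nonzero zeta_nonzero by (auto simp: vf_complex_def complex_eq_iff)
  have eigen: "vf_eigenfunction A (V i) (\<i> * of_int (k i) * of_real (\<Omega> i)) (eigenfun \<zeta> k)" for i k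
  proof -
    have "eigenfun \<zeta> k \<noteq> (\<lambda>_. 0)"
      using norm_eigenfun[of \<zeta> _ k] normalized by (metis norm_zero zero_neq_one)
    then show ?thesis
      using constant_field_eigenfun[of "axis i (\<Omega> i)" k]
      by (simp add: vf_eigenfunction_def smooth_eigenfun V_eq freq)
  qed
  have decomposition: "v = (\<lambda>a f. \<Sum>i\<in>UNIV. V i a f)"
  proof -
    have "v = constant_field (\<chi> i. \<Omega> i)"
      using vector_field_eq_constant_field[OF vector_field flow, of "\<chi> i. \<Omega> i"] invariant eigenfunctions
      by (simp add: preserves_measure_def)
    then show ?thesis
      by (simp add: fun_eq_iff constant_field_decompose[of "\<chi> i. \<Omega> i"] V angle_field_eq)
  qed
  have pushforward: "u \<in> tangent_space A b \<and> (\<forall>f. smooth_fun A f \<longrightarrow> u f = V i b f)"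
    if "b = \<Psi> j t a" "u = pushforward A (\<Psi> j t) (V i a)" for i j t a b u
    using that smooth_vector_field_constant_field
    by (auto simp: V_eq \<Psi>_eq pushforward_constant_field smooth_vector_field_def)
  show ?thesis
  proof (intro conjI allI impI)
    show "smooth_vector_field A (V i)" for i
      by (simp add: V_eq smooth_vector_field_constant_field)
    show "\<exists>!\<Theta>. generates_flow A (V i) \<Theta>" for i
      by (simp add: flow_unique)
    show "L2_inner \<mu> f g = 0"
      if "j \<noteq> l" "f \<in> Z j" "g \<in> Z l" "(\<integral>x. f x \<partial>\<mu>) = 0" "(\<integral>x. g x \<partial>\<mu>) = 0" for j l f g
      using L2_subring_orthogonal that unfolding Z_eq by blast
    show "{f. koopman_generator \<mu> (\<Psi> i) f (\<lambda>_. 0)} = L2_tensor \<mu> (UNIV - {i}) Z" for i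
      by (simp only: \<Psi>_eq koopman_kernel freqs Z_eq L2_tensor_eq)
    show "{f. smooth_fun A f \<and> (\<forall>a. vf_complex (V i) f a = 0)} =
        {f. smooth_fun A f} \<inter> L2_tensor \<mu> (UNIV - {i}) Z" for i
      by (simp only: V_eq smooth_kernel freqs Z_eq L2_tensor_eq)
    show "commutator (V i) (V j) = (\<lambda>_ _. 0)" for i j
      by (simp only: V_eq commutator_constant_field)
    show "preserves_measure \<mu> (\<Psi> i t)" for i t
      by (simp only: \<Psi>_eq preserves_measure_rotation)
  qed (use eigen nonvanishing independent pushforward decomposition in blast)+
qed

end
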